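(* Let $u$ be the solution of $$\partial_t u(t,x)=\tfrac12\,\partial_x^2u(t,x)+u(t,x)\dot W(t,x),\quad t>0,\ x\in\mathbb{R},\qquad u(0,x)=u_0(x),$$ where $\dot W$ is space-time white noise, and suppose that $\log u_0(\cdot)$ is a bounded measurable function on $\mathbb{R}$. For any $\gamma>\frac1{24}$ and $\epsilon>0$, there exist $c=c(\gamma,\epsilon)>0$ and $t_0=t_0(\gamma,\epsilon)>0$ such that for all $t\ge t_0$ and all $x\in\mathbb{R}$, $$\mathbb{P}\big(u(t,x)\le e^{-\gamma t}\big)\ \ge\ e^{-ct^{4+\epsilon}}.$$
   Context: The solution $u$ is the standard (Itô/mild) solution of the stochastic heat equation with multiplicative space-time white noise; the initial datum $u_0$ is non-random and fixed. *)

theory Defs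
  imports "HOL-Probability.Probability"
begin

text \<open>
  Walsh's theory of the stochastic heat equation on a probability space \<open>M\<close>.  Points of
  space-time are pairs \<open>(s, y)\<close> with time \<open>s > 0\<close> and position \<open>y \<in> \<real>\<close>; a random field is a
  function \<open>\<Phi> s y \<omega>\<close>.  The time-zero slice is Lebesgue-null and is left out.
\<close>

definition spacetime :: "(real \<times> real) measure"
  where "spacetime = restrict_space lborel ({0<..} \<times> UNIV)"

definition finite_spacetime_sets :: "(real \<times> real) set set"
  where "finite_spacetime_sets = {B \<in> sets spacetime. emeasure spacetime B < \<infinity>}"

text \<open>The point mass at \<open>0\<close> (variance zero) counts as a centered Gaussian law.\<close>

definition centered_gaussian :: "'a measure \<Rightarrow> ('a \<Rightarrow> real) \<Rightarrow> bool"
  where "centered_gaussian M X \<longleftrightarrow>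
    X \<in> borel_measurable M \<and>
    ((AE \<omega> in M. X \<omega> = 0) \<or> (\<exists>\<sigma>>0. distributed M lborel X (normal_density 0 \<sigma>)))"

text \<open>
  A white noise is a centered Gaussian process, indexed by the Borel sets of finite Lebesgue
  measure, with covariance \<open>E[W(A) W(B)] = |A \<inter> B|\<close>.
\<close>

definition space_time_white_noise :: "'a measure \<Rightarrow> ((real \<times> real) set \<Rightarrow> 'a \<Rightarrow> real) \<Rightarrow> bool"
  where "space_time_white_noise M W \<longleftrightarrow>
    (\<forall>I c. finite I \<and> I \<subseteq> finite_spacetime_sets \<longrightarrow>
       centered_gaussian M (\<lambda>\<omega>. \<Sum>B\<in>I. c B * W B \<omega>)) \<and>
    (\<forall>A\<in>finite_spacetime_sets. \<forall>B\<in>finite_spacetime_sets.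
       (LINT \<omega>|M. W A \<omega> * W B \<omega>) = measure spacetime (A \<inter> B))"

text \<open>The filtration generated by the noise up to time \<open>t\<close>, augmented by the null sets.\<close>

definition noise_filtration ::
    "'a measure \<Rightarrow> ((real \<times> real) set \<Rightarrow> 'a \<Rightarrow> real) \<Rightarrow> real \<Rightarrow> 'a measure"
  where "noise_filtration M W t =
    sigma (space M)
      ({W B -` S \<inter> space M | B S.
          B \<in> finite_spacetime_sets \<and> B \<subseteq> {0<..t} \<times> UNIV \<and> S \<in> sets borel} \<union> null_sets M)"

text \<open>
  A quadruple \<open>(X, a, b, A)\<close> encodes the elementary process
  \<open>X(\<omega>) 1\<^bsub>(a, b]\<^esub>(s) 1\<^bsub>A\<^esub>(y)\<close>, and a list of quadruples the sum of these processes
  (a simple predictable process).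
\<close>

type_synonym 'a elementary = "('a \<Rightarrow> real) \<times> real \<times> real \<times> real set"

definition elementary_process ::
    "'a measure \<Rightarrow> ((real \<times> real) set \<Rightarrow> 'a \<Rightarrow> real) \<Rightarrow> 'a elementary \<Rightarrow> bool"
  where "elementary_process M W = (\<lambda>(X, a, b, A).
    0 \<le> a \<and> a < b \<and> A \<in> sets borel \<and> emeasure lborel A < \<infinity> \<and>
    X \<in> borel_measurable (noise_filtration M W a) \<and> (\<exists>K. \<forall>\<omega>\<in>space M. \<bar>X \<omega>\<bar> \<le> K))"

definition simple_process :: "'a elementary list \<Rightarrow> real \<Rightarrow> real \<Rightarrow> 'a \<Rightarrow> real"
  where "simple_process P s y \<omega> =
    (\<Sum>(X, a, b, A)\<leftarrow>P. X \<omega> * indicator {a<..b} s * indicator A y)"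

definition simple_integral_noise ::
    "((real \<times> real) set \<Rightarrow> 'a \<Rightarrow> real) \<Rightarrow> 'a elementary list \<Rightarrow> 'a \<Rightarrow> real"
  where "simple_integral_noise W P \<omega> = (\<Sum>(X, a, b, A)\<leftarrow>P. X \<omega> * W ({a<..b} \<times> A) \<omega>)"

text \<open>
  \<open>J\<close> is (a version of) the Walsh integral of \<open>\<Phi>\<close> over \<open>(0, \<infinity>) \<times> \<real>\<close>: the extension by
  \<open>L\<^sup>2\<close>-continuity of the integral of simple predictable processes.
\<close>

definition has_walsh_integral ::
    "'a measure \<Rightarrow> ((real \<times> real) set \<Rightarrow> 'a \<Rightarrow> real) \<Rightarrow>
     (real \<Rightarrow> real \<Rightarrow> 'a \<Rightarrow> real) \<Rightarrow> ('a \<Rightarrow> real) \<Rightarrow> bool"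
  where "has_walsh_integral M W \<Phi> J \<longleftrightarrow>
    (\<lambda>((s, y), \<omega>). \<Phi> s y \<omega>) \<in> borel_measurable (spacetime \<Otimes>\<^sub>M M) \<and>
    J \<in> borel_measurable M \<and>
    (\<exists>P :: nat \<Rightarrow> 'a elementary list.
       (\<forall>n. \<forall>e\<in>set (P n). elementary_process M W e) \<and>
       (\<lambda>n. \<integral>\<^sup>+((s, y), \<omega>). ennreal ((simple_process (P n) s y \<omega> - \<Phi> s y \<omega>)\<^sup>2)
              \<partial>(spacetime \<Otimes>\<^sub>M M)) \<longlonglongrightarrow> 0 \<and>
       (\<lambda>n. \<integral>\<^sup>+\<omega>. ennreal ((simple_integral_noise W (P n) \<omega> - J \<omega>)\<^sup>2) \<partial>M) \<longlonglongrightarrow> 0)"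

text \<open>The fundamental solution of \<open>\<partial>\<^sub>t = \<onehalf> \<partial>\<^sub>x\<^sup>2\<close>: the centered Gaussian density of variance \<open>t\<close>.\<close>

definition heat_kernel :: "real \<Rightarrow> real \<Rightarrow> real"
  where "heat_kernel t x = normal_density 0 (sqrt t) x"

text \<open>
  Mild (Ito--Walsh) solutions of \<open>\<partial>\<^sub>t u = \<onehalf> \<partial>\<^sub>x\<^sup>2 u + u W'\<close>, \<open>W'\<close> the noise, started at \<open>u0\<close>:
  for all \<open>t > 0\<close> and \<open>x\<close>, almost surely,
  \<open>u(t,x) = \<integral> p(t, x - y) u0(y) dy + \<integral>\<^bsub>(0,t) \<times> \<real>\<^esub> p(t - s, x - y) u(s,y) W(ds, dy)\<close>.
  The second-moment bound, locally uniform in time, is the usual class in which solutions with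
  bounded initial datum exist and are unique up to modification.
\<close>

definition she_mild_solution ::
    "'a measure \<Rightarrow> ((real \<times> real) set \<Rightarrow> 'a \<Rightarrow> real) \<Rightarrow> (real \<Rightarrow> real) \<Rightarrow>
     (real \<Rightarrow> real \<Rightarrow> 'a \<Rightarrow> real) \<Rightarrow> bool"
  where "she_mild_solution M W u0 u \<longleftrightarrow>
    (\<forall>x. AE \<omega> in M. u 0 x \<omega> = u0 x) \<and>
    (\<lambda>((t, x), \<omega>). u t x \<omega>) \<in> borel_measurable (spacetime \<Otimes>\<^sub>M M) \<and>
    (\<forall>t>0. \<forall>x. u t x \<in> borel_measurable (noise_filtration M W t)) \<and>
    (\<forall>T>0. \<exists>K::real. \<forall>t\<in>{0<..T}. \<forall>x. (\<integral>\<^sup>+\<omega>. ennreal ((u t x \<omega>)\<^sup>2) \<partial>M) \<le> ennreal K) \<and>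
    (\<forall>t>0. \<forall>x. \<exists>J.
       has_walsh_integral M W
         (\<lambda>s y \<omega>. if s < t then heat_kernel (t - s) (x - y) * u s y \<omega> else 0) J \<and>
       (AE \<omega> in M. u t x \<omega> = (LINT y|lborel. heat_kernel t (x - y) * u0 y) + J \<omega>))"

end

theory Submission
  imports Defs
begin

text \<open>
  Change the law of the noise by the Gaussian density \<open>Z = exp (- a W(D) - a\<^sup>2 |D| / 2)\<close>, which adds
  the drift \<open>- a\<close> on a window \<open>D = (0, t] \<times> [x - L, x + L]\<close>.  Integration by parts shows that
  \<open>m(s, y) = E[u(s, y) Z]\<close> solves the heat equation killed at rate \<open>a\<close> inside the window, so that
  \<open>m(t, x)\<close> is at most a constant times \<open>exp (- a t)\<close> as soon as \<open>L\<close> is a large multiple of \<open>t\<close>,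
  while \<open>|D|\<close> is then of order \<open>t\<^sup>2\<close>.  With \<open>a = \<gamma> + 1\<close> this would contradict \<open>u(t, x) > exp (- \<gamma> t)\<close>
  off an event of too small a probability: on the event itself the Cauchy--Schwarz inequality, the
  exponential growth of \<open>E[u\<^sup>2]\<close> and the moments of \<open>Z\<close> give a bound \<open>exp (O(t\<^sup>2))\<close> times a power of its
  probability.  This yields the lower bound \<open>exp (- c t\<^sup>2)\<close> for every \<open>\<gamma> > 0\<close>.
\<close>

section \<open>Fourier uniqueness and Gaussian variables\<close>

text \<open>The definition of white noise supplies Gaussian finite combinations and a covariance.
  Additivity of \<open>W\<close>, independence of the noise on disjoint regions and the Ito isometry
  have to be extracted from these; the Fourier lemmas are there for the independence.

  No tilted solution is ever constructed. The equation is linear in \<open>u\<close>, so pairing its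
  mild form with the density gives a closed linear equation for the mean \<open>m\<close>, and the
  density enters only through expectations.

  The obstacle is that the density exists only for a window of finite area, so the drift cannot act
  everywhere and undamped mass leaks in from outside. The leak is controlled by comparing
  \<open>m\<close> with the solution killed on the whole line, in a sup norm weighted by
  \<open>cosh\<close>: the heat flow enlarges this weight only by \<open>exp (t / 2)\<close>, while
  outside the window the weight is at least \<open>exp L / 2\<close>. A half width \<open>L\<close>
  linear in time therefore beats every exponential rate. Moments of the density cost the exponential
  of a multiple of the area, which is where the exponent 2 comes from.\<close>

lemma (in prob_space) real_fourier_orthogonal:
  fixes X \<Psi> :: "'a \<Rightarrow> real"
  assumes X[measurable]: "X \<in> borel_measurable M" and I: "integrable M \<Psi>"
    and fourier: "\<And>\<theta>. (CLINT \<omega>|M. iexp (\<theta> * X \<omega>) * \<Psi> \<omega>) = 0"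
    and A[measurable]: "A \<in> sets borel"
  shows "(LINT \<omega>|M. indicator A (X \<omega>) * \<Psi> \<omega>) = 0"
proof -
  define p where "p \<omega> = max 0 (\<Psi> \<omega>)" for \<omega>
  define n where "n \<omega> = max 0 (- \<Psi> \<omega>)" for \<omega>
  have [measurable]: "\<Psi> \<in> borel_measurable M" using I by auto
  have Ip: "integrable M p" and In: "integrable M n"
    unfolding p_def n_def using I by auto
  have p0: "p \<omega> \<ge> 0" and n0: "n \<omega> \<ge> 0" and eq: "\<Psi> \<omega> = p \<omega> - n \<omega>" for \<omega>
    by (auto simp: p_def n_def)
  have [measurable]: "p \<in> borel_measurable M" "n \<in> borel_measurable M" using Ip In by auto
  have Ie: "integrable M (\<lambda>\<omega>. iexp (\<theta> * X \<omega>) * complex_of_real (q \<omega>))"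
    if "integrable M q" for q :: "'a \<Rightarrow> real" and \<theta>
    using that by (intro Bochner_Integration.integrable_bound[OF that])
      (auto simp: norm_mult)
  have fpn: "(CLINT \<omega>|M. iexp (\<theta> * X \<omega>) * p \<omega>) = (CLINT \<omega>|M. iexp (\<theta> * X \<omega>) * n \<omega>)" for \<theta>
  proof -
    have "(CLINT \<omega>|M. iexp (\<theta> * X \<omega>) * p \<omega>) - (CLINT \<omega>|M. iexp (\<theta> * X \<omega>) * n \<omega>)
      = (CLINT \<omega>|M. iexp (\<theta> * X \<omega>) * \<Psi> \<omega>)"
      by (subst Bochner_Integration.integral_diff[symmetric, OF Ie[OF Ip] Ie[OF In]])
        (simp add: eq algebra_simps)
    then show ?thesis using fourier by simp
  qed
  define c where "c = (LINT \<omega>|M. p \<omega>)"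
  \<comment> \<open>Frequency zero: both parts of \<open>\<Psi>\<close> carry the same mass
    \<open>c\<close>, so they can be normalised by the same constant.\<close>
  have "complex_of_real (LINT \<omega>|M. p \<omega>) = complex_of_real (LINT \<omega>|M. n \<omega>)"
    using fpn[of 0] by (simp del: of_real_eq_iff)
  then have cn: "c = (LINT \<omega>|M. n \<omega>)" by (simp add: c_def)
  have c0: "c \<ge> 0" unfolding c_def using p0 by simp
  have split: "(LINT \<omega>|M. indicator A (X \<omega>) * \<Psi> \<omega>) =
    (LINT \<omega>|M. indicator A (X \<omega>) * p \<omega>) - (LINT \<omega>|M. indicator A (X \<omega>) * n \<omega>)"
  proof -
    have "integrable M (\<lambda>\<omega>. indicator A (X \<omega>) * q \<omega>)" if "integrable M q" for q :: "'a \<Rightarrow> real"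
      by (rule Bochner_Integration.integrable_bound[OF that])
        (use that in \<open>auto split: split_indicator\<close>)
    from Bochner_Integration.integral_diff[OF this[OF Ip] this[OF In]]
    show ?thesis by (simp add: eq algebra_simps)
  qed
  show ?thesis
  proof (cases "c = 0")
    case True
    have "AE \<omega> in M. p \<omega> = 0" 
      using True integral_nonneg_eq_0_iff_AE[OF Ip] p0 unfolding c_def by simp
    moreover have "AE \<omega> in M. n \<omega> = 0" 
      using True integral_nonneg_eq_0_iff_AE[OF In] n0 unfolding cn by simp
    ultimately have "AE \<omega> in M. indicator A (X \<omega>) * \<Psi> \<omega> = 0"
      by eventually_elim (simp add: eq)
    then have "(LINT \<omega>|M. indicator A (X \<omega>) * \<Psi> \<omega>) = (LINT \<omega>|M. 0)"
      by (intro integral_cong_AE) auto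
    then show ?thesis by simp
  next
    case False
    with c0 have c: "c > 0" by simp
    \<comment> \<open>Law of \<open>X\<close> under the probability density \<open>q / c\<close>.
      The equality of the Fourier integrals makes the characteristic functions of
      \<open>\<mu> p\<close> and \<open>\<mu> n\<close> agree, and Levy's theorem identifies the two
      laws.\<close>
    define \<mu> where "\<mu> q = distr (density M (\<lambda>\<omega>. ennreal (q \<omega> / c))) borel X" for q
    have *: "real_distribution (\<mu> q) \<and> char (\<mu> q) = (\<lambda>\<theta>. (CLINT \<omega>|M. iexp (\<theta> * X \<omega>) * q \<omega>) / c)
        \<and> measure (\<mu> q) A = (LINT \<omega>|M. indicator A (X \<omega>) * q \<omega>) / c"
      if Iq: "integrable M q" and q0: "\<And>\<omega>. q \<omega> \<ge> 0" and cq: "c = (LINT \<omega>|M. q \<omega>)" for q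
    proof (intro conjI ext)
      have [measurable]: "q \<in> borel_measurable M" using Iq by auto
      have "emeasure (density M (\<lambda>\<omega>. ennreal (q \<omega> / c))) (space M) = (\<integral>\<^sup>+\<omega>. ennreal (q \<omega> / c) \<partial>M)"
        by (subst emeasure_density) (auto intro!: nn_integral_cong)
      also have "\<dots> = 1"
        using Iq q0 c cq by (subst nn_integral_eq_integral) auto
      finally interpret D: prob_space "density M (\<lambda>\<omega>. ennreal (q \<omega> / c))"
        by (intro prob_spaceI) simp
      show "real_distribution (\<mu> q)" unfolding \<mu>_def real_distribution_def real_distribution_axioms_def
        by (auto intro!: D.prob_space_distr)
      show "char (\<mu> q) \<theta> = (CLINT \<omega>|M. iexp (\<theta> * X \<omega>) * q \<omega>) / c" for \<theta>
        unfolding char_def \<mu>_def using q0 c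
        by (subst integral_distr, simp, simp, subst integral_density) (auto simp: scaleR_conv_of_real mult_ac)
      have "measure (\<mu> q) A = (LINT x|\<mu> q. indicator A x)" by (simp add: \<mu>_def)
      also have "\<dots> = (LINT \<omega>|M. indicator A (X \<omega>) * q \<omega>) / c"
        unfolding \<mu>_def using q0 c
        by (subst integral_distr, simp, simp, subst integral_density) (auto simp: mult_ac)
      finally show "measure (\<mu> q) A = (LINT \<omega>|M. indicator A (X \<omega>) * q \<omega>) / c" .
    qed
    have "\<mu> p = \<mu> n"
      using *[OF Ip p0 c_def] *[OF In n0 cn] by (intro Levy_uniqueness) (simp_all only: fpn)
    then show ?thesis
      using *[OF Ip p0 c_def] *[OF In n0 cn] c split by auto
  qed
qed

text \<open>Conjugation sends the frequency \<open>\<theta>\<close> to \<open>- \<theta>\<close>, so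
  the hypothesis passes from \<open>\<Psi>\<close> to its conjugate and by linearity to the real and
  imaginary parts, where the real version applies.\<close>

lemma (in prob_space) fourier_orthogonal:
  fixes X :: "'a \<Rightarrow> real" and \<Psi> :: "'a \<Rightarrow> complex"
  assumes X[measurable]: "X \<in> borel_measurable M" and I: "integrable M \<Psi>"
    and fourier: "\<And>\<theta>. (CLINT \<omega>|M. iexp (\<theta> * X \<omega>) * \<Psi> \<omega>) = 0"
    and A[measurable]: "A \<in> sets borel"
  shows "(CLINT \<omega>|M. indicator A (X \<omega>) * \<Psi> \<omega>) = 0"
proof -
  have [measurable]: "\<Psi> \<in> borel_measurable M" using I by auto
  have Ie: "integrable M (\<lambda>\<omega>. iexp (\<theta> * X \<omega>) * q \<omega>)"
    if "integrable M q" for q :: "'a \<Rightarrow> complex" and \<theta>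
    using that by (intro Bochner_Integration.integrable_bound[OF that])
      (auto simp: norm_mult)
  have cnj0: "(CLINT \<omega>|M. iexp (\<theta> * X \<omega>) * cnj (\<Psi> \<omega>)) = 0" for \<theta>
  proof -
    have "(CLINT \<omega>|M. iexp (\<theta> * X \<omega>) * cnj (\<Psi> \<omega>)) = (CLINT \<omega>|M. cnj (iexp (- \<theta> * X \<omega>) * \<Psi> \<omega>))"
      by (intro Bochner_Integration.integral_cong) (auto simp: exp_cnj)
    also have "\<dots> = cnj (CLINT \<omega>|M. iexp (- \<theta> * X \<omega>) * \<Psi> \<omega>)" by (rule integral_bounded_linear[OF bounded_linear_cnj Ie[OF I]])
    also have "\<dots> = 0" by (subst fourier) simp
    finally show ?thesis .
  qed
  have Ic: "integrable M (\<lambda>\<omega>. cnj (\<Psi> \<omega>))" using I by simp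
  have re: "(CLINT \<omega>|M. iexp (\<theta> * X \<omega>) * Re (\<Psi> \<omega>)) = 0" for \<theta>
  proof -
    have "(CLINT \<omega>|M. iexp (\<theta> * X \<omega>) * Re (\<Psi> \<omega>)) =
      (CLINT \<omega>|M. (iexp (\<theta> * X \<omega>) * \<Psi> \<omega> + iexp (\<theta> * X \<omega>) * cnj (\<Psi> \<omega>)) / 2)"
      by (intro Bochner_Integration.integral_cong) (auto simp: complex_add_cnj distrib_left[symmetric])
    also have "\<dots> = 0"
      using Ie[OF I, of \<theta>] Ie[OF Ic, of \<theta>] fourier[of \<theta>] cnj0[of \<theta>] by simp
    finally show ?thesis .
  qed
  have Im_eq: "complex_of_real (Im z) = - (\<i> / 2) * (z - cnj z)" for z
    by (simp add: complex_eq_iff)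
  have im: "(CLINT \<omega>|M. iexp (\<theta> * X \<omega>) * Im (\<Psi> \<omega>)) = 0" for \<theta>
  proof -
    have "(CLINT \<omega>|M. iexp (\<theta> * X \<omega>) * Im (\<Psi> \<omega>)) =
      (CLINT \<omega>|M. - (\<i> / 2) * (iexp (\<theta> * X \<omega>) * \<Psi> \<omega> - iexp (\<theta> * X \<omega>) * cnj (\<Psi> \<omega>)))"
      by (intro Bochner_Integration.integral_cong) (auto simp: Im_eq algebra_simps)
    also have "\<dots> = 0"
      using Ie[OF I, of \<theta>] Ie[OF Ic, of \<theta>] fourier[of \<theta>] cnj0[of \<theta>] by simp
    finally show ?thesis .
  qed
  have IA: "integrable M (\<lambda>\<omega>. indicator A (X \<omega>) * \<Psi> \<omega>)"
    by (rule Bochner_Integration.integrable_bound[OF I]) (auto split: split_indicator)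
  have "Re (CLINT \<omega>|M. indicator A (X \<omega>) * \<Psi> \<omega>) = (LINT \<omega>|M. indicator A (X \<omega>) * Re (\<Psi> \<omega>))"
    using IA by (subst integral_Re[symmetric]) (auto intro!: Bochner_Integration.integral_cong split: split_indicator)
  moreover have "Im (CLINT \<omega>|M. indicator A (X \<omega>) * \<Psi> \<omega>) = (LINT \<omega>|M. indicator A (X \<omega>) * Im (\<Psi> \<omega>))"
    using IA by (subst integral_Im[symmetric]) (auto intro!: Bochner_Integration.integral_cong split: split_indicator)
  ultimately show ?thesis
    using real_fourier_orthogonal[OF X integrable_Re[OF I] re A]
      real_fourier_orthogonal[OF X integrable_Im[OF I] im A] by (simp add: complex_eq_iff)
qed

text \<open>Exponentials are exchanged for indicators one variable at a time. Multiplying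
  \<open>\<Psi>\<close> by \<open>iexp (t * X k)\<close> keeps it integrable, so the induction
  hypothesis treats the other variables at each fixed \<open>t\<close>; letting \<open>t\<close>
  vary, the one-variable lemma then treats \<open>X k\<close>. This is why the induction generalises
  \<open>\<Psi>\<close>.\<close>

lemma (in prob_space) fourier_orthogonal_family:
  fixes X :: "'i \<Rightarrow> 'a \<Rightarrow> real" and \<Psi> :: "'a \<Rightarrow> complex"
  assumes "finite N" and "\<And>i. i \<in> N \<Longrightarrow> X i \<in> borel_measurable M" and "integrable M \<Psi>"
    and "\<And>\<theta>. (CLINT \<omega>|M. iexp (\<Sum>i\<in>N. \<theta> i * X i \<omega>) * \<Psi> \<omega>) = 0"
    and "\<And>i. i \<in> N \<Longrightarrow> A i \<in> sets borel"
  shows "(CLINT \<omega>|M. (\<Prod>i\<in>N. indicator (A i) (X i \<omega>)) * \<Psi> \<omega>) = 0"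
  using assms
proof (induction N arbitrary: \<Psi> rule: finite_induct)
  case empty
  then show ?case by simp
next
  case (insert k N)
  note [measurable] = insert.prems(1)[OF insertI1] insert.prems(1)[OF insertI2] insert.prems(4)[OF insertI1] insert.prems(4)[OF insertI2]
  have [measurable]: "\<Psi> \<in> borel_measurable M" using insert.prems(2) by auto
  have Ie: "integrable M (\<lambda>\<omega>. iexp (t * X k \<omega>) * \<Psi> \<omega>)" for t
    by (rule Bochner_Integration.integrable_bound[OF insert.prems(2)]) (auto simp: norm_mult)
  have IN: "integrable M (\<lambda>\<omega>. (\<Prod>i\<in>N. indicator (A i) (X i \<omega>)) * \<Psi> \<omega>)"
  proof (rule Bochner_Integration.integrable_bound[OF insert.prems(2)])
    have "cmod (\<Prod>i\<in>N. indicator (A i) (X i \<omega>)) \<le> 1" for \<omega>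
      unfolding prod_norm[symmetric] by (intro prod_le_1) (auto split: split_indicator)
    then show "AE \<omega> in M. cmod ((\<Prod>i\<in>N. indicator (A i) (X i \<omega>)) * \<Psi> \<omega>) \<le> cmod (\<Psi> \<omega>)"
      by (auto simp: norm_mult intro!: mult_left_le_one_le)
  qed measurable
  have "(CLINT \<omega>|M. (\<Prod>i\<in>N. indicator (A i) (X i \<omega>)) * (iexp (t * X k \<omega>) * \<Psi> \<omega>)) = 0" for t
  proof (rule insert.IH[OF _ Ie])
    fix \<theta> :: "'i \<Rightarrow> real"
    have "(\<Sum>i\<in>insert k N. (\<theta>(k := t)) i * X i \<omega>) = t * X k \<omega> + (\<Sum>i\<in>N. \<theta> i * X i \<omega>)" for \<omega>
      using insert.hyps by (auto intro!: sum.cong)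
    then show "(CLINT \<omega>|M. iexp (\<Sum>i\<in>N. \<theta> i * X i \<omega>) * (iexp (t * X k \<omega>) * \<Psi> \<omega>)) = 0"
      using insert.prems(3)[of "\<theta>(k := t)"] by (simp add: exp_add distrib_left mult_ac)
  qed (use insert.prems in auto)
  then have "(CLINT \<omega>|M. indicator (A k) (X k \<omega>) * ((\<Prod>i\<in>N. indicator (A i) (X i \<omega>)) * \<Psi> \<omega>)) = 0"
    by (intro fourier_orthogonal IN) (auto simp: mult_ac)
  then show ?case using insert.hyps by (simp add: mult_ac)
qed

section \<open>Exponential moments and characteristic functions of Gaussian variables\<close>

lemma normal_density_exp_tilt:
  assumes "\<sigma> > 0"
  shows "normal_density 0 \<sigma> x * exp (c * x) = exp (c\<^sup>2 * \<sigma>\<^sup>2 / 2) * normal_density (c * \<sigma>\<^sup>2) \<sigma> x"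
proof -
  \<comment> \<open>Completing the square: an exponential weight shifts the mean by
    \<open>c * \<sigma>\<^sup>2\<close>.\<close>
  have "- (x\<^sup>2) / (2 * \<sigma>\<^sup>2) + c * x = c\<^sup>2 * \<sigma>\<^sup>2 / 2 + - (x - c * \<sigma>\<^sup>2)\<^sup>2 / (2 * \<sigma>\<^sup>2)"
    using assms by (simp add: field_simps power2_eq_square)
  then have "exp (- (x\<^sup>2) / (2 * \<sigma>\<^sup>2)) * exp (c * x) = exp (c\<^sup>2 * \<sigma>\<^sup>2 / 2) * exp (- (x - c * \<sigma>\<^sup>2)\<^sup>2 / (2 * \<sigma>\<^sup>2))"
    by (simp only: exp_add[symmetric])
  then show ?thesis by (simp add: normal_density_def)
qed

text \<open>Everything is expressed through the second moment of \<open>Y\<close> rather than a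
  parameter \<open>\<sigma>\<close>, so that the point mass at 0, which
  \<open>centered_gaussian\<close> admits, obeys the same formulas.\<close>

lemma (in prob_space)
  assumes "centered_gaussian M Y"
  shows centered_gaussian_square: "integrable M (\<lambda>\<omega>. (Y \<omega>)\<^sup>2)"
    and centered_gaussian_exp_has_integral:
      "has_bochner_integral M (\<lambda>\<omega>. exp (c * Y \<omega>)) (exp (c\<^sup>2 * expectation (\<lambda>\<omega>. (Y \<omega>)\<^sup>2) / 2))"
    and centered_gaussian_mult_exp_has_integral:
      "has_bochner_integral M (\<lambda>\<omega>. Y \<omega> * exp (c * Y \<omega>))
         (c * expectation (\<lambda>\<omega>. (Y \<omega>)\<^sup>2) * exp (c\<^sup>2 * expectation (\<lambda>\<omega>. (Y \<omega>)\<^sup>2) / 2))"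
    and centered_gaussian_char:
      "(CLINT \<omega>|M. iexp (Y \<omega>)) = exp (- expectation (\<lambda>\<omega>. (Y \<omega>)\<^sup>2) / 2)"
proof -
  have [measurable]: "Y \<in> borel_measurable M" using assms by (simp add: centered_gaussian_def)
  have "integrable M (\<lambda>\<omega>. (Y \<omega>)\<^sup>2) \<and> has_bochner_integral M (\<lambda>\<omega>. exp (c * Y \<omega>)) (exp (c\<^sup>2 * expectation (\<lambda>\<omega>. (Y \<omega>)\<^sup>2) / 2))
    \<and> has_bochner_integral M (\<lambda>\<omega>. Y \<omega> * exp (c * Y \<omega>))
         (c * expectation (\<lambda>\<omega>. (Y \<omega>)\<^sup>2) * exp (c\<^sup>2 * expectation (\<lambda>\<omega>. (Y \<omega>)\<^sup>2) / 2))
    \<and> (CLINT \<omega>|M. iexp (Y \<omega>)) = exp (- expectation (\<lambda>\<omega>. (Y \<omega>)\<^sup>2) / 2)"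
  proof (cases "AE \<omega> in M. Y \<omega> = 0")
    case True
    then have ae: "AE \<omega> in M. (Y \<omega>)\<^sup>2 = 0" "AE \<omega> in M. exp (c * Y \<omega>) = 1" 
      "AE \<omega> in M. Y \<omega> * exp (c * Y \<omega>) = 0" "AE \<omega> in M. iexp (Y \<omega>) = 1"
      by (auto elim!: eventually_mono)
    have E2: "expectation (\<lambda>\<omega>. (Y \<omega>)\<^sup>2) = expectation (\<lambda>\<omega>. 0)" by (intro integral_cong_AE ae) auto
    have "(CLINT \<omega>|M. iexp (Y \<omega>)) = (CLINT \<omega>|M. 1)" by (intro integral_cong_AE ae) auto
    moreover have "integrable M (\<lambda>\<omega>. (Y \<omega>)\<^sup>2)"
      by (subst integrable_cong_AE[OF _ _ ae(1)]) auto
    moreover have "has_bochner_integral M (\<lambda>\<omega>. exp (c * Y \<omega>)) 1"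
      by (subst has_bochner_integral_cong_AE[OF _ _ ae(2)]) (auto simp: has_bochner_integral_iff prob_space)
    moreover have "has_bochner_integral M (\<lambda>\<omega>. Y \<omega> * exp (c * Y \<omega>)) 0"
      by (subst has_bochner_integral_cong_AE[OF _ _ ae(3)]) (auto simp: has_bochner_integral_iff)
    ultimately show ?thesis
      by (simp add: E2 prob_space)
  next
    case False
    then obtain \<sigma> where \<sigma>: "\<sigma> > 0" and D: "distributed M lborel Y (normal_density 0 \<sigma>)"
      using assms by (auto simp: centered_gaussian_def)
    have I2: "has_bochner_integral M (\<lambda>\<omega>. (Y \<omega>)\<^sup>2) (\<sigma>\<^sup>2)"
    proof -
      have "has_bochner_integral lborel (\<lambda>x. normal_density 0 \<sigma> x * x\<^sup>2) (\<sigma>\<^sup>2)"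
        using normal_moment_even[OF \<sigma>, of 0 1] by (simp add: fact_numeral)
      then show ?thesis
        using distributed_integrable[OF D, of "\<lambda>x. x\<^sup>2"] distributed_integral[OF D, of "\<lambda>x. x\<^sup>2"]
        by (auto simp: has_bochner_integral_iff)
    qed
    then have E2: "expectation (\<lambda>\<omega>. (Y \<omega>)\<^sup>2) = \<sigma>\<^sup>2" by (rule has_bochner_integral_integral_eq)
    have "has_bochner_integral lborel (\<lambda>x. normal_density 0 \<sigma> x * exp (c * x)) (exp (c\<^sup>2 * \<sigma>\<^sup>2 / 2))"
      unfolding normal_density_exp_tilt[OF \<sigma>]
      using \<sigma> by (auto simp: has_bochner_integral_iff)
    then have I3: "has_bochner_integral M (\<lambda>\<omega>. exp (c * Y \<omega>)) (exp (c\<^sup>2 * \<sigma>\<^sup>2 / 2))"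
      using distributed_integrable[OF D, of "\<lambda>x. exp (c * x)"] distributed_integral[OF D, of "\<lambda>x. exp (c * x)"]
      by (auto simp: has_bochner_integral_iff)
    have "has_bochner_integral lborel (\<lambda>x. exp (c\<^sup>2 * \<sigma>\<^sup>2 / 2) * (normal_density (c * \<sigma>\<^sup>2) \<sigma> x * x)) 
       (exp (c\<^sup>2 * \<sigma>\<^sup>2 / 2) * (c * \<sigma>\<^sup>2))"
      using normal_moment_nz_1[OF \<sigma>, of "c * \<sigma>\<^sup>2"] by (intro has_bochner_integral_mult_right)
    then have "has_bochner_integral lborel (\<lambda>x. normal_density 0 \<sigma> x * (x * exp (c * x))) (c * \<sigma>\<^sup>2 * exp (c\<^sup>2 * \<sigma>\<^sup>2 / 2))"
      by (simp add: normal_density_exp_tilt[OF \<sigma>, symmetric] mult.assoc[symmetric]) (simp add: mult_ac)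
    then have I4: "has_bochner_integral M (\<lambda>\<omega>. Y \<omega> * exp (c * Y \<omega>)) (c * \<sigma>\<^sup>2 * exp (c\<^sup>2 * \<sigma>\<^sup>2 / 2))"
      using distributed_integrable[OF D, of "\<lambda>x. x * exp (c * x)"] distributed_integral[OF D, of "\<lambda>x. x * exp (c * x)"]
      by (auto simp: has_bochner_integral_iff)
    have S: "distributed M lborel (\<lambda>\<omega>. (Y \<omega> - 0) / \<sigma>) std_normal_density"
      using normal_standard_normal_convert[OF \<sigma>, of Y 0] D by simp
    have "(CLINT \<omega>|M. iexp (Y \<omega>)) = (CLINT \<omega>|M. iexp (\<sigma> * ((Y \<omega> - 0) / \<sigma>)))" using \<sigma> by simp
    also have "\<dots> = (CLINT x|distr M lborel (\<lambda>\<omega>. (Y \<omega> - 0) / \<sigma>). iexp (\<sigma> * x))"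
      by (subst integral_distr) auto
    also have "distr M lborel (\<lambda>\<omega>. (Y \<omega> - 0) / \<sigma>) = std_normal_distribution"
      by (rule distributed_distr_eq_density[OF S])
    also have "(CLINT x|std_normal_distribution. iexp (\<sigma> * x)) = char std_normal_distribution \<sigma>"
      by (simp add: char_def)
    also have "\<dots> = exp (- \<sigma>\<^sup>2 / 2)" by (simp add: char_std_normal_distribution exp_of_real)
    finally show ?thesis using I2 I3 I4 by (auto simp: E2 has_bochner_integral_iff)
  qed
  then show "integrable M (\<lambda>\<omega>. (Y \<omega>)\<^sup>2)"
    "has_bochner_integral M (\<lambda>\<omega>. exp (c * Y \<omega>)) (exp (c\<^sup>2 * expectation (\<lambda>\<omega>. (Y \<omega>)\<^sup>2) / 2))"
    "has_bochner_integral M (\<lambda>\<omega>. Y \<omega> * exp (c * Y \<omega>))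
         (c * expectation (\<lambda>\<omega>. (Y \<omega>)\<^sup>2) * exp (c\<^sup>2 * expectation (\<lambda>\<omega>. (Y \<omega>)\<^sup>2) / 2))"
    "(CLINT \<omega>|M. iexp (Y \<omega>)) = exp (- expectation (\<lambda>\<omega>. (Y \<omega>)\<^sup>2) / 2)" by auto
qed

section \<open>White noise\<close>

text \<open>The filtration with time slabs replaced by arbitrary regions. The covariance
  computations below need the noise off a given set, such as \<open>noise_field M W (- C)\<close>,
  which no slab describes.\<close>

definition noise_field ::
    "'a measure \<Rightarrow> ((real \<times> real) set \<Rightarrow> 'a \<Rightarrow> real) \<Rightarrow> (real \<times> real) set \<Rightarrow> 'a measure"
  where "noise_field M W R =
    sigma (space M)
      ({W B -` S \<inter> space M | B S.
          B \<in> finite_spacetime_sets \<and> B \<subseteq> R \<and> S \<in> sets borel} \<union> null_sets M)"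

lemma noise_filtration_eq_field: "noise_filtration M W t = noise_field M W ({0<..t} \<times> UNIV)"
  by (simp add: noise_filtration_def noise_field_def)

lemma finite_spacetime_sets_subset:
  "A \<in> finite_spacetime_sets \<Longrightarrow> B \<in> sets spacetime \<Longrightarrow> B \<subseteq> A \<Longrightarrow> B \<in> finite_spacetime_sets"
  by (auto simp: finite_spacetime_sets_def intro: le_less_trans[OF emeasure_mono])

lemma finite_spacetime_sets_Int: 
  "A \<in> finite_spacetime_sets \<Longrightarrow> B \<in> finite_spacetime_sets \<Longrightarrow> A \<inter> B \<in> finite_spacetime_sets"
  and finite_spacetime_sets_Diff: 
  "A \<in> finite_spacetime_sets \<Longrightarrow> B \<in> finite_spacetime_sets \<Longrightarrow> A - B \<in> finite_spacetime_sets"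
  using finite_spacetime_sets_subset[of A "A \<inter> B"] finite_spacetime_sets_subset[of A "A - B"]
  by (auto simp: finite_spacetime_sets_def)

lemma finite_spacetime_sets_Un: 
  "A \<in> finite_spacetime_sets \<Longrightarrow> B \<in> finite_spacetime_sets \<Longrightarrow> A \<union> B \<in> finite_spacetime_sets"
  by (auto simp: finite_spacetime_sets_def intro!: le_less_trans[OF emeasure_subadditive])

lemma finite_spacetime_sets_empty: "{} \<in> finite_spacetime_sets"
  by (simp add: finite_spacetime_sets_def)

lemma measure_spacetime_Un:
  "A \<in> finite_spacetime_sets \<Longrightarrow> B \<in> finite_spacetime_sets \<Longrightarrow> A \<inter> B = {} \<Longrightarrow>
    measure spacetime (A \<union> B) = measure spacetime A + measure spacetime B"
  by (rule measure_Union) (auto simp: finite_spacetime_sets_def)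

lemma integrable_mult_L2:
  fixes f g :: "'b \<Rightarrow> real"
  assumes [measurable]: "f \<in> borel_measurable N" "g \<in> borel_measurable N"
    and "integrable N (\<lambda>x. (f x)\<^sup>2)" "integrable N (\<lambda>x. (g x)\<^sup>2)"
  shows "integrable N (\<lambda>x. f x * g x)"
proof (rule Bochner_Integration.integrable_bound)
  show "integrable N (\<lambda>x. (f x)\<^sup>2 + (g x)\<^sup>2)" using assms by auto
  have "\<bar>x * y\<bar> \<le> x\<^sup>2 + y\<^sup>2" for x y :: real
    using sum_squares_bound[of "\<bar>x\<bar>" "\<bar>y\<bar>"] mult_nonneg_nonneg[of "\<bar>x\<bar>" "\<bar>y\<bar>"]
    unfolding abs_mult power2_abs by linarith
  then show "AE x in N. norm (f x * g x) \<le> norm ((f x)\<^sup>2 + (g x)\<^sup>2)" by simp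
qed measurable

section \<open>Moments and almost sure additivity of the noise\<close>

locale white_noise = prob_space M
  for M :: "'a measure" +
  fixes W :: "(real \<times> real) set \<Rightarrow> 'a \<Rightarrow> real"
  assumes noise: "space_time_white_noise M W"
begin

abbreviation "\<F> \<equiv> noise_field M W"

lemma combination_gaussian:
  "finite I \<Longrightarrow> I \<subseteq> finite_spacetime_sets \<Longrightarrow> centered_gaussian M (\<lambda>\<omega>. \<Sum>B\<in>I. c B * W B \<omega>)"
  using noise by (simp add: space_time_white_noise_def)

lemma noise_gaussian: "B \<in> finite_spacetime_sets \<Longrightarrow> centered_gaussian M (W B)"
  using combination_gaussian[of "{B}" "\<lambda>_. 1"] by simp

lemma noise_measurable: "B \<in> finite_spacetime_sets \<Longrightarrow> W B \<in> borel_measurable M"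
  using noise_gaussian by (simp add: centered_gaussian_def)

lemma integrable_noise_mult:
  assumes "A \<in> finite_spacetime_sets" "B \<in> finite_spacetime_sets"
  shows "integrable M (\<lambda>\<omega>. W A \<omega> * W B \<omega>)"
  using assms by (intro integrable_mult_L2 noise_measurable centered_gaussian_square noise_gaussian)

lemma noise_covariance:
  "A \<in> finite_spacetime_sets \<Longrightarrow> B \<in> finite_spacetime_sets \<Longrightarrow>
    expectation (\<lambda>\<omega>. W A \<omega> * W B \<omega>) = measure spacetime (A \<inter> B)"
  using noise by (simp add: space_time_white_noise_def)

lemma noise_variance:
  "A \<in> finite_spacetime_sets \<Longrightarrow> expectation (\<lambda>\<omega>. (W A \<omega>)\<^sup>2) = measure spacetime A"
  using noise_covariance[of A A] by (simp add: power2_eq_square)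

lemma noise_has_exp_moment:
  assumes "B \<in> finite_spacetime_sets"
  shows "has_bochner_integral M (\<lambda>\<omega>. exp (c * W B \<omega>)) (exp (c\<^sup>2 * measure spacetime B / 2))"
    "has_bochner_integral M (\<lambda>\<omega>. W B \<omega> * exp (c * W B \<omega>))
       (c * measure spacetime B * exp (c\<^sup>2 * measure spacetime B / 2))"
  using centered_gaussian_exp_has_integral[OF noise_gaussian[OF assms], of c]
    centered_gaussian_mult_exp_has_integral[OF noise_gaussian[OF assms], of c]
  by (simp_all add: noise_variance[OF assms])

lemma noise_mean:
  assumes "B \<in> finite_spacetime_sets"
  shows "integrable M (W B)" "expectation (W B) = 0"
  using noise_has_exp_moment(2)[OF assms, of 0] by (auto simp: has_bochner_integral_iff)

lemma noise_empty: "AE \<omega> in M. W {} \<omega> = 0"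
proof -
  have "AE \<omega> in M. (W {} \<omega>)\<^sup>2 = 0"
    using noise_variance[OF finite_spacetime_sets_empty]
    by (subst integral_nonneg_eq_0_iff_AE[symmetric])
      (auto intro: centered_gaussian_square noise_gaussian finite_spacetime_sets_empty)
  then show ?thesis by simp
qed

text \<open>Additivity is hidden in the covariance: the second moment of
  \<open>W (A \<union> B) - (W A + W B)\<close> expands to
  \<open>(|A| + |B|) + |A| + |B| - 2|A| - 2|B| = 0\<close>. The exceptional null set depends on the
  pair of sets.\<close>

lemma noise_Un:
  assumes A: "A \<in> finite_spacetime_sets" and B: "B \<in> finite_spacetime_sets" and disj: "A \<inter> B = {}"
  shows "AE \<omega> in M. W (A \<union> B) \<omega> = W A \<omega> + W B \<omega>"
proof -
  note U = finite_spacetime_sets_Un[OF A B]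
  note I = integrable_noise_mult
  have i: "A \<inter> (A \<union> B) = A" "B \<inter> (A \<union> B) = B" "(A \<union> B) \<inter> A = A" "(A \<union> B) \<inter> B = B" by auto
  have e: "(W (A \<union> B) \<omega> - (W A \<omega> + W B \<omega>))\<^sup>2 = W (A \<union> B) \<omega> * W (A \<union> B) \<omega> + W A \<omega> * W A \<omega> + W B \<omega> * W B \<omega>
     - 2 * (W (A \<union> B) \<omega> * W A \<omega>) - 2 * (W (A \<union> B) \<omega> * W B \<omega>) + 2 * (W A \<omega> * W B \<omega>)" for \<omega>
    by (simp add: power2_eq_square algebra_simps)
  have "has_bochner_integral M (\<lambda>\<omega>. (W (A \<union> B) \<omega> - (W A \<omega> + W B \<omega>))\<^sup>2) 0"
    unfolding e has_bochner_integral_iff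
    using I[OF U U] I[OF A A] I[OF B B] I[OF U A] I[OF U B] I[OF A B]
    by (simp add: noise_covariance A B U i disj measure_spacetime_Un)
  then have "AE \<omega> in M. (W (A \<union> B) \<omega> - (W A \<omega> + W B \<omega>))\<^sup>2 = 0"
    by (subst integral_nonneg_eq_0_iff_AE[symmetric]) (auto simp: has_bochner_integral_iff)
  then show ?thesis by simp
qed

lemma noise_split:
  assumes A: "A \<in> finite_spacetime_sets" and B: "B \<in> finite_spacetime_sets"
  shows "AE \<omega> in M. W A \<omega> = W (A \<inter> B) \<omega> + W (A - B) \<omega>"
proof -
  have "A \<inter> B \<union> (A - B) = A" by auto
  then show ?thesis
    using noise_Un[OF finite_spacetime_sets_Int[OF A B] finite_spacetime_sets_Diff[OF A B]] by auto
qed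

text \<open>Disjointness makes \<open>W B\<close> uncorrelated with the combination. The joint
  combinations are again Gaussian, so variances add and characteristic functions factor.
  Combinations are indexed by sets; with \<open>B \<notin> I\<close> the coefficient of
  \<open>B\<close> can be prescribed by updating \<open>\<theta>\<close> at
  \<open>B\<close>.\<close>

lemma combination_char_indep:
  assumes I: "finite I" "I \<subseteq> finite_spacetime_sets" and B: "B \<in> finite_spacetime_sets" "B \<notin> I"
    and disj: "\<And>C. C \<in> I \<Longrightarrow> C \<inter> B = {}"
  shows "(CLINT \<omega>|M. iexp (\<eta> * W B \<omega>) * iexp (\<Sum>C\<in>I. \<theta> C * W C \<omega>)) =
    (CLINT \<omega>|M. iexp (\<eta> * W B \<omega>)) * (CLINT \<omega>|M. iexp (\<Sum>C\<in>I. \<theta> C * W C \<omega>))"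
proof -
  define S where "S \<omega> = (\<Sum>C\<in>I. \<theta> C * W C \<omega>)" for \<omega>
  have gS: "centered_gaussian M S" unfolding S_def by (rule combination_gaussian[OF I])
  have gB: "centered_gaussian M (\<lambda>\<omega>. \<eta> * W B \<omega>)" 
    using combination_gaussian[of "{B}" "\<lambda>_. \<eta>"] B by simp
  have gSB: "centered_gaussian M (\<lambda>\<omega>. \<eta> * W B \<omega> + S \<omega>)"
  proof -
    have "(\<Sum>C\<in>insert B I. (\<theta>(B := \<eta>)) C * W C \<omega>) = \<eta> * W B \<omega> + S \<omega>" for \<omega>
      unfolding S_def using I B by (auto intro!: sum.cong)
    then show ?thesis
      using combination_gaussian[of "insert B I" "\<theta>(B := \<eta>)"] I B by simp
  qed
  have cr: "has_bochner_integral M (\<lambda>\<omega>. W B \<omega> * S \<omega>) 0"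
  proof -
    have "has_bochner_integral M (\<lambda>\<omega>. \<Sum>C\<in>I. \<theta> C * (W C \<omega> * W B \<omega>)) (\<Sum>C\<in>I. \<theta> C * measure spacetime (C \<inter> B))"
    proof (rule has_bochner_integral_sum)
      fix C assume "C \<in> I"
      with I have "C \<in> finite_spacetime_sets" by auto
      with B show "has_bochner_integral M (\<lambda>\<omega>. \<theta> C * (W C \<omega> * W B \<omega>)) (\<theta> C * measure spacetime (C \<inter> B))"
        by (auto simp: has_bochner_integral_iff integrable_noise_mult noise_covariance)
    qed
    then show ?thesis using disj by (simp add: S_def sum_distrib_left mult_ac)
  qed
  have "expectation (\<lambda>\<omega>. (\<eta> * W B \<omega> + S \<omega>)\<^sup>2) = expectation (\<lambda>\<omega>. (\<eta> * W B \<omega>)\<^sup>2) + expectation (\<lambda>\<omega>. (S \<omega>)\<^sup>2)"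
  proof -
    have "(\<eta> * W B \<omega> + S \<omega>)\<^sup>2 = (\<eta> * W B \<omega>)\<^sup>2 + (S \<omega>)\<^sup>2 + (2 * \<eta>) * (W B \<omega> * S \<omega>)" for \<omega>
      by (simp add: power2_eq_square algebra_simps)
    then show ?thesis
      using cr centered_gaussian_square[OF gS] centered_gaussian_square[OF gB]
      by (simp add: has_bochner_integral_iff)
  qed
  then have "exp (- expectation (\<lambda>\<omega>. (\<eta> * W B \<omega> + S \<omega>)\<^sup>2) / 2) =
      exp (- expectation (\<lambda>\<omega>. (\<eta> * W B \<omega>)\<^sup>2) / 2) * exp (- expectation (\<lambda>\<omega>. (S \<omega>)\<^sup>2) / 2)"
    by (simp add: exp_add[symmetric] field_simps)
  then have "(CLINT \<omega>|M. iexp (\<eta> * W B \<omega> + S \<omega>)) = (CLINT \<omega>|M. iexp (\<eta> * W B \<omega>)) * (CLINT \<omega>|M. iexp (S \<omega>))"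
    using centered_gaussian_char[OF gSB] centered_gaussian_char[OF gB] centered_gaussian_char[OF gS] by simp
  moreover have "iexp (\<eta> * W B \<omega> + S \<omega>) = iexp (\<eta> * W B \<omega>) * iexp (S \<omega>)" for \<omega>
    by (simp add: exp_add distrib_left)
  ultimately show ?thesis unfolding S_def by simp
qed

text \<open>Independence in Fourier form is upgraded to events in two stages: the exponentials of
  \<open>W B\<close> are replaced by the indicator of \<open>T\<close> while the exponential of the
  other variables is kept, and then that exponential is replaced by the indicators of the sets
  \<open>S C\<close>.\<close>

lemma cylinder_indep:
  assumes I: "finite I" "I \<subseteq> finite_spacetime_sets" and B: "B \<in> finite_spacetime_sets"
    and disj: "\<And>C. C \<in> I \<Longrightarrow> C \<inter> B = {}"
    and S: "\<And>C. C \<in> I \<Longrightarrow> S C \<in> sets borel" and T[measurable]: "T \<in> sets borel"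
  shows "prob ((space M \<inter> (\<Inter>C\<in>I. W C -` S C)) \<inter> (W B -` T \<inter> space M)) =
    prob (space M \<inter> (\<Inter>C\<in>I. W C -` S C)) * prob (W B -` T \<inter> space M)"
proof -
  note [measurable] = noise_measurable[OF B]
  have mI[measurable]: "C \<in> I \<Longrightarrow> W C \<in> borel_measurable M" for C using I noise_measurable by auto
  define E where "E = space M \<inter> (\<Inter>C\<in>I. W C -` S C)"
  define F where "F = W B -` T \<inter> space M"
  have F[measurable]: "F \<in> events" unfolding F_def by measurable
  have E[measurable]: "E \<in> events"
  proof -
    have "E = space M \<inter> {\<omega>\<in>space M. \<forall>C\<in>I. W C \<omega> \<in> S C}" by (auto simp: E_def)
    also have "\<dots> \<in> events" 
      using I by (intro sets.Int sets.top sets.sets_Collect_finite_All) (auto intro!: measurable_sets_Collect[OF mI] S)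
    finally show ?thesis .
  qed
  \<comment> \<open>The centred indicator of \<open>F\<close>: independence of \<open>F\<close> and
    the cylinder \<open>E\<close> is orthogonality of \<open>\<Psi>\<close> to the indicator of
    \<open>E\<close>.\<close>
  define \<Psi> where "\<Psi> \<omega> = complex_of_real (indicator F \<omega> - prob F)" for \<omega>
  have I\<Psi>: "integrable M \<Psi>" unfolding \<Psi>_def
    by (intro integrable_of_real Bochner_Integration.integrable_diff) (auto simp: emeasure_eq_measure)
  have "(CLINT \<omega>|M. iexp (\<Sum>C\<in>I. \<theta> C * W C \<omega>) * \<Psi> \<omega>) = 0" for \<theta>
  proof (cases "B \<in> I")
    case False
    define e where "e \<omega> = iexp (\<Sum>C\<in>I. \<theta> C * W C \<omega>)" for \<omega>
    have [measurable]: "e \<in> borel_measurable M" unfolding e_def using mI by measurable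
    have Ie: "integrable M e"
      by (rule integrable_const_bound[where B=1]) (auto simp: e_def)
    have IB: "integrable M (\<lambda>\<omega>. iexp (\<eta> * W B \<omega>) * e \<omega>)" "integrable M (\<lambda>\<omega>. iexp (\<eta> * W B \<omega>))" for \<eta>
      by (rule integrable_const_bound[where B=1], auto simp: e_def norm_mult)+
    \<comment> \<open>The factorised characteristic function, read as orthogonality of the centred
      exponential to every exponential of \<open>W B\<close>.\<close>
    have "(CLINT \<omega>|M. iexp (\<eta> * W B \<omega>) * (e \<omega> - expectation e)) = 0" for \<eta>
      using IB[of \<eta>] combination_char_indep[OF I B False disj, of \<eta> \<theta>] 
      unfolding right_diff_distrib e_def by (simp add: e_def)
    then have *: "(CLINT \<omega>|M. indicator T (W B \<omega>) * (e \<omega> - expectation e)) = 0"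
      using Ie by (intro fourier_orthogonal) auto
    have IF: "integrable M (\<lambda>\<omega>. indicator F \<omega> * e \<omega>)"
      by (rule Bochner_Integration.integrable_bound[OF Ie]) (auto split: split_indicator)
    have iF: "has_bochner_integral M (\<lambda>\<omega>. indicator F \<omega> :: complex) (prob F)"
    proof -
      have "has_bochner_integral M (\<lambda>\<omega>. complex_of_real (indicator F \<omega>)) (complex_of_real (prob F))"
        by (intro has_bochner_integral_of_real) (auto simp: has_bochner_integral_iff emeasure_eq_measure)
      moreover have "(\<lambda>\<omega>. complex_of_real (indicator F \<omega>)) = indicator F"
        by (auto simp: indicator_def fun_eq_iff)
      ultimately show ?thesis by simp
    qed
    have "(CLINT \<omega>|M. indicator T (W B \<omega>) * (e \<omega> - expectation e)) =
        (CLINT \<omega>|M. indicator F \<omega> * e \<omega> - expectation e * indicator F \<omega>)"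
      by (intro Bochner_Integration.integral_cong) (auto simp: F_def split: split_indicator)
    also have "\<dots> = (CLINT \<omega>|M. indicator F \<omega> * e \<omega>) - expectation e * prob F"
      using IF iF by (subst Bochner_Integration.integral_diff) (auto simp: has_bochner_integral_iff)
    also have "\<dots> = (CLINT \<omega>|M. e \<omega> * \<Psi> \<omega>)"
    proof -
      have "e \<omega> * \<Psi> \<omega> = indicator F \<omega> * e \<omega> - prob F * e \<omega>" for \<omega>
        by (auto simp: \<Psi>_def algebra_simps split: split_indicator)
      then show ?thesis using IF Ie by simp
    qed
    finally show ?thesis using * by (simp add: e_def)
  next
    case True
    \<comment> \<open>A set disjoint from itself is empty. As \<open>W {}\<close> vanishes almost
      surely, \<open>F\<close> has probability 0 or 1 and \<open>\<Psi>\<close> is almost surely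
      0.\<close>
    then have "B = {}" using disj[of B] by auto
    then have "AE \<omega> in M. W B \<omega> = 0" using noise_empty by simp
    then have "AE \<omega> in M. \<Psi> \<omega> = 0"
    proof -
      have "prob F = indicator T 0"
      proof (cases "(0::real) \<in> T")
        case True
        have "AE \<omega> in M. \<omega> \<in> F" using \<open>AE \<omega> in M. W B \<omega> = 0\<close> AE_space
          by eventually_elim (use True in \<open>auto simp: F_def\<close>)
        then show ?thesis using True by (simp add: prob_eq_1)
      next
        case False
        have "AE \<omega> in M. \<omega> \<notin> F" using \<open>AE \<omega> in M. W B \<omega> = 0\<close> AE_space
          by eventually_elim (use False in \<open>auto simp: F_def\<close>)
        then show ?thesis using False by (simp add: prob_eq_0)
      qed
      note pF = this
      show ?thesis using \<open>AE \<omega> in M. W B \<omega> = 0\<close> AE_space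
        by eventually_elim (unfold \<Psi>_def pF, auto simp: F_def split: split_indicator)
    qed
    then have "AE \<omega> in M. iexp (\<Sum>C\<in>I. \<theta> C * W C \<omega>) * \<Psi> \<omega> = 0" by eventually_elim simp
    then have "(CLINT \<omega>|M. iexp (\<Sum>C\<in>I. \<theta> C * W C \<omega>) * \<Psi> \<omega>) = (CLINT \<omega>|M. 0)"
      using borel_measurable_integrable[OF I\<Psi>] mI by (intro integral_cong_AE) auto
    then show ?thesis by simp
  qed
  then have *: "(CLINT \<omega>|M. (\<Prod>C\<in>I. indicator (S C) (W C \<omega>)) * \<Psi> \<omega>) = 0"
    by (intro fourier_orthogonal_family I I\<Psi> S mI)
  have "(CLINT \<omega>|M. (\<Prod>C\<in>I. indicator (S C) (W C \<omega>)) * \<Psi> \<omega>) =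
      (CLINT \<omega>|M. complex_of_real (indicator (E \<inter> F) \<omega> - prob F * indicator E \<omega>))"
  proof (intro Bochner_Integration.integral_cong refl)
    fix \<omega> assume "\<omega> \<in> space M"
    then have "(\<Prod>C\<in>I. indicator (S C) (W C \<omega>)) = (indicator E \<omega> :: complex)"
      using I by (auto simp: E_def indicator_def)
    then show "(\<Prod>C\<in>I. indicator (S C) (W C \<omega>)) * \<Psi> \<omega> = complex_of_real (indicator (E \<inter> F) \<omega> - prob F * indicator E \<omega>)"
      by (auto simp: \<Psi>_def split: split_indicator)
  qed
  also have "\<dots> = complex_of_real (expectation (\<lambda>\<omega>. indicator (E \<inter> F) \<omega> - prob F * indicator E \<omega>))"
    by (rule integral_complex_of_real)
  also have "expectation (\<lambda>\<omega>. indicator (E \<inter> F) \<omega> - prob F * indicator E \<omega>) = prob (E \<inter> F) - prob F * prob E"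
    by (simp add: emeasure_eq_measure)
  finally have "complex_of_real (prob (E \<inter> F) - prob F * prob E) = 0" using * by simp
  then have "prob (E \<inter> F) = prob F * prob E" by (simp only: of_real_eq_0_iff)
  then show ?thesis by (simp add: E_def F_def mult.commute)
qed

section \<open>Independence of the noise fields of disjoint regions\<close>

lemma generator_events:
  "{W B -` S \<inter> space M | B S. B \<in> finite_spacetime_sets \<and> B \<subseteq> R \<and> S \<in> sets borel} \<union> null_sets M \<subseteq> events"
  using noise_measurable by (auto dest: measurable_sets)

lemma space_noise_field[simp]: "space (\<F> R) = space M"
  unfolding noise_field_def using generator_events[of R] sets.space_closed[of M]
  by (intro space_measure_of) blast

lemma sets_noise_field:
  "sets (\<F> R) = sigma_sets (space M)
    ({W B -` S \<inter> space M | B S. B \<in> finite_spacetime_sets \<and> B \<subseteq> R \<and> S \<in> sets borel} \<union> null_sets M)"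
  unfolding noise_field_def using generator_events[of R] sets.space_closed[of M]
  by (intro sets_measure_of) blast

lemma sets_noise_field_mono: "R \<subseteq> R' \<Longrightarrow> sets (\<F> R) \<subseteq> sets (\<F> R')"
  unfolding sets_noise_field by (intro sigma_sets_mono') blast

lemma sets_noise_field_le: "sets (\<F> R) \<subseteq> events"
  unfolding sets_noise_field using generator_events[of R] by (rule sets.sigma_sets_subset)

lemma measurable_noise_field_mono:
  "f \<in> borel_measurable (\<F> R) \<Longrightarrow> R \<subseteq> R' \<Longrightarrow> f \<in> borel_measurable (\<F> R')"
  using sets_noise_field_mono[of R R'] by (auto simp: measurable_def)

lemma measurable_noise_field: "f \<in> borel_measurable (\<F> R) \<Longrightarrow> f \<in> borel_measurable M"
  using sets_noise_field_le[of R] by (auto simp: measurable_def)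

lemma noise_measurable_field:
  assumes "B \<in> finite_spacetime_sets" "B \<subseteq> R"
  shows "W B \<in> borel_measurable (\<F> R)"
proof (rule measurableI)
  fix S :: "real set" assume "S \<in> sets borel"
  with assms show "W B -` S \<inter> space (\<F> R) \<in> sets (\<F> R)"
    unfolding sets_noise_field space_noise_field by (intro sigma_sets.Basic) blast
qed simp

text \<open>Dynkin's argument: finite cylinders over subsets of \<open>R\<close>, together with the
  null sets from the augmentation, form an intersection-stable family whose generated sigma-algebra
  contains the field, and each member is independent of \<open>W B\<close>.\<close>

lemma noise_field_indep:
  assumes B: "B \<in> finite_spacetime_sets" and disj: "B \<inter> R = {}"
    and X: "X \<in> borel_measurable (\<F> R)"
  shows "indep_var borel X borel (W B)"
proof -
  define G where "G = {space M \<inter> (\<Inter>C\<in>I. W C -` S C) | I S. finite I \<and> I \<subseteq> finite_spacetime_sets \<inter> Pow R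
      \<and> (\<forall>C\<in>I. S C \<in> sets borel)}"
  define H where "H = {W B -` S \<inter> space M | S. S \<in> sets borel}"
  have GI: "E \<inter> E' \<in> G" if EG: "E \<in> G" "E' \<in> G" for E E'
  proof -
    obtain I S where E: "E = space M \<inter> (\<Inter>C\<in>I. W C -` S C)" "finite I" "I \<subseteq> finite_spacetime_sets \<inter> Pow R"
      "\<forall>C\<in>I. S C \<in> sets borel" using EG(1) unfolding G_def by blast
    obtain I' S' where E': "E' = space M \<inter> (\<Inter>C\<in>I'. W C -` S' C)" "finite I'" "I' \<subseteq> finite_spacetime_sets \<inter> Pow R"
      "\<forall>C\<in>I'. S' C \<in> sets borel" using EG(2) unfolding G_def by blast
    \<comment> \<open>A set indexing only one of the two cylinders receives the trivial constraint
      \<open>UNIV\<close> from the other, so both can be written over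
      \<open>I \<union> I'\<close>.\<close>
    define S'' where "S'' C = (if C \<in> I then S C else UNIV) \<inter> (if C \<in> I' then S' C else UNIV)" for C
    have "E \<inter> E' = space M \<inter> (\<Inter>C\<in>I \<union> I'. W C -` S'' C)"
      unfolding E E' S''_def by (auto split: if_splits)
    then show ?thesis using E E' unfolding G_def
      by (intro CollectI exI[of _ "I \<union> I'"] exI[of _ S'']) (auto simp: S''_def)
  qed
  have Gev: "G \<subseteq> events"
  proof
    fix E assume "E \<in> G"
    then obtain I S where E: "E = space M \<inter> (\<Inter>C\<in>I. W C -` S C)" "finite I" "I \<subseteq> finite_spacetime_sets"
      "\<forall>C\<in>I. S C \<in> sets borel" unfolding G_def by blast
    have "E = {\<omega>\<in>space M. \<forall>C\<in>I. W C \<omega> \<in> S C}" by (auto simp: E)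
    also have "\<dots> \<in> events" 
      using E by (intro sets.sets_Collect_finite_All) (auto intro!: measurable_sets_Collect[OF noise_measurable])
    finally show "E \<in> events" .
  qed
  have Hev: "H \<subseteq> events" using noise_measurable[OF B] by (auto simp: H_def dest: measurable_sets)
  have "indep_set (G \<union> null_sets M) H"
  proof (rule indep_setI)
    fix a b assume ab: "a \<in> G \<union> null_sets M" "b \<in> H"
    then obtain T where T: "T \<in> sets borel" "b = W B -` T \<inter> space M" by (auto simp: H_def)
    show "prob (a \<inter> b) = prob a * prob b"
    proof (cases "a \<in> null_sets M")
      case True
      then have "a \<inter> b \<in> null_sets M" using ab Hev by (intro null_set_Int2) auto
      then show ?thesis using True by (simp add: null_sets_def measure_def)
    next
      case False
      then obtain I S where E: "a = space M \<inter> (\<Inter>C\<in>I. W C -` S C)" "finite I" "I \<subseteq> finite_spacetime_sets \<inter> Pow R"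
        "\<forall>C\<in>I. S C \<in> sets borel" using ab unfolding G_def by blast
      have "C \<inter> B = {}" if "C \<in> I" for C using that E(3) disj by blast
      then show ?thesis unfolding E(1) T(2)
        by (intro cylinder_indep) (use E B T in auto)
    qed
  qed (use Gev Hev in auto)
  moreover have "Int_stable (G \<union> null_sets M)"
  proof (rule Int_stableI)
    fix a b assume ab: "a \<in> G \<union> null_sets M" "b \<in> G \<union> null_sets M"
    then have "a \<in> events" "b \<in> events" using Gev by auto
    with ab GI show "a \<inter> b \<in> G \<union> null_sets M"
      by (auto intro: null_set_Int1 null_set_Int2)
  qed
  moreover have "Int_stable H"
  proof (rule Int_stableI)
    fix a b assume "a \<in> H" "b \<in> H"
    then obtain S T where "S \<in> sets borel" "T \<in> sets borel" "a = W B -` S \<inter> space M" "b = W B -` T \<inter> space M"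
      by (auto simp: H_def)
    then show "a \<inter> b \<in> H" unfolding H_def by (intro CollectI exI[of _ "S \<inter> T"]) auto
  qed
  ultimately have ind: "indep_set (sigma_sets (space M) (G \<union> null_sets M)) (sigma_sets (space M) H)"
    by (rule indep_set_sigma_sets)
  have "sets (\<F> R) \<subseteq> sigma_sets (space M) (G \<union> null_sets M)"
    unfolding sets_noise_field
  proof (rule sigma_sets_mono', safe)
    fix C S assume "C \<in> finite_spacetime_sets" "C \<subseteq> R" "S \<in> sets borel" "W C -` S \<inter> space M \<notin> null_sets M"
    then show "W C -` S \<inter> space M \<in> G"
      unfolding G_def by (intro CollectI exI[of _ "{C}"] exI[of _ "\<lambda>_. S"]) auto
  qed
  moreover have "sigma_sets (space M) {X -` A \<inter> space M |A. A \<in> sets borel} \<subseteq> sets (\<F> R)"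
    using measurable_sets[OF X] sets.sigma_sets_subset[of "{X -` A \<inter> space M |A. A \<in> sets borel}" "\<F> R"]
    by auto
  ultimately have "indep_set (sigma_sets (space M) {X -` A \<inter> space M |A. A \<in> sets borel}) (sigma_sets (space M) H)"
    using ind unfolding indep_sets2_eq by blast
  then show ?thesis
    unfolding indep_var_eq H_def using measurable_noise_field[OF X] noise_measurable[OF B] by simp
qed

text \<open>The form in which independence is used; \<open>f\<close> will be the identity, the
  square, \<open>exp (- a * x)\<close> and \<open>x * exp (- a * x)\<close>.\<close>

lemma noise_field_indep_integral:
  assumes B: "B \<in> finite_spacetime_sets" and disj: "B \<inter> R = {}"
    and X: "X \<in> borel_measurable (\<F> R)" "integrable M X"
    and f: "f \<in> borel_measurable borel" "integrable M (\<lambda>\<omega>. f (W B \<omega>))"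
  shows "has_bochner_integral M (\<lambda>\<omega>. X \<omega> * f (W B \<omega>)) (expectation X * expectation (\<lambda>\<omega>. f (W B \<omega>)) :: real)"
proof -
  have "indep_var borel (id \<circ> X) borel (f \<circ> W B)"
    using noise_field_indep[OF B disj X(1)] f by (intro indep_var_compose) auto
  then have "indep_var borel X borel (\<lambda>\<omega>. f (W B \<omega>))" by (simp add: comp_def)
  from indep_var_integrable[OF this X(2) f(2)] indep_var_lebesgue_integral[OF this X(2) f(2)]
  show ?thesis by (simp add: has_bochner_integral_iff)
qed

end

section \<open>The Walsh integral\<close>

lemma Cauchy_Schwarz_integral_nn:
  fixes f g :: "'b \<Rightarrow> real"
  assumes [measurable]: "f \<in> borel_measurable N" "g \<in> borel_measurable N"
  shows "(ennreal \<bar>LINT x|N. f x * g x\<bar>)\<^sup>2 \<le> (\<integral>\<^sup>+x. ennreal ((f x)\<^sup>2) \<partial>N) * (\<integral>\<^sup>+x. ennreal ((g x)\<^sup>2) \<partial>N)"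
proof -
  \<comment> \<open>If the product is not integrable, its Bochner integral is 0 by convention and
    the bound is trivial.\<close>
  have "ennreal \<bar>LINT x|N. f x * g x\<bar> \<le> (\<integral>\<^sup>+x. ennreal \<bar>f x * g x\<bar> \<partial>N)"
    using integral_norm_bound_ennreal[of N "\<lambda>x. f x * g x"] not_integrable_integral_eq[of N "\<lambda>x. f x * g x"]
    by (cases "integrable N (\<lambda>x. f x * g x)") auto
  also have "\<dots> = (\<integral>\<^sup>+x. ennreal \<bar>f x\<bar> * ennreal \<bar>g x\<bar> \<partial>N)"
    by (simp add: abs_mult ennreal_mult)
  finally have "(ennreal \<bar>LINT x|N. f x * g x\<bar>)\<^sup>2 \<le> (\<integral>\<^sup>+x. ennreal \<bar>f x\<bar> * ennreal \<bar>g x\<bar> \<partial>N)\<^sup>2"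
    by (intro power_mono) auto
  also have "\<dots> \<le> (\<integral>\<^sup>+x. (ennreal \<bar>f x\<bar>)\<^sup>2 \<partial>N) * (\<integral>\<^sup>+x. (ennreal \<bar>g x\<bar>)\<^sup>2 \<partial>N)"
    by (rule Cauchy_Schwarz_nn_integral) measurable
  finally show ?thesis by (simp add: ennreal_power)
qed

lemma Cauchy_Schwarz_integral:
  fixes f g :: "'b \<Rightarrow> real"
  assumes [measurable]: "f \<in> borel_measurable N" "g \<in> borel_measurable N"
    and I: "integrable N (\<lambda>x. (f x)\<^sup>2)" "integrable N (\<lambda>x. (g x)\<^sup>2)"
  shows "\<bar>LINT x|N. f x * g x\<bar> \<le> sqrt (LINT x|N. (f x)\<^sup>2) * sqrt (LINT x|N. (g x)\<^sup>2)"
proof -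
  have "(ennreal \<bar>LINT x|N. f x * g x\<bar>)\<^sup>2 \<le> ennreal (LINT x|N. (f x)\<^sup>2) * ennreal (LINT x|N. (g x)\<^sup>2)"
    using Cauchy_Schwarz_integral_nn[of f N g] I by (simp add: nn_integral_eq_integral)
  then have "(LINT x|N. f x * g x)\<^sup>2 \<le> (LINT x|N. (f x)\<^sup>2) * (LINT x|N. (g x)\<^sup>2)"
    by (simp add: ennreal_power ennreal_mult[symmetric])
  then have "sqrt ((LINT x|N. f x * g x)\<^sup>2) \<le> sqrt ((LINT x|N. (f x)\<^sup>2) * (LINT x|N. (g x)\<^sup>2))"
    by (rule real_sqrt_le_mono)
  then show ?thesis by (simp add: real_sqrt_mult)
qed

text \<open>Convergence makes some error \<open>f n - h\<close> square integrable, and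
  \<open>g * h\<close> is then the difference of the integrable products \<open>g * f n\<close> and
  \<open>g * (f n - h)\<close>. The same splitting with Cauchy-Schwarz gives the limit. This carries
  identities from simple processes over to Walsh integrals.\<close>

lemma L2_pairing_tendsto:
  fixes f :: "nat \<Rightarrow> 'b \<Rightarrow> real"
  assumes [measurable]: "\<And>n. f n \<in> borel_measurable N" "h \<in> borel_measurable N" "g \<in> borel_measurable N"
    and lim: "(\<lambda>n. \<integral>\<^sup>+x. ennreal ((f n x - h x)\<^sup>2) \<partial>N) \<longlonglongrightarrow> 0"
    and g: "integrable N (\<lambda>x. (g x)\<^sup>2)" and f: "\<And>n. integrable N (\<lambda>x. (f n x)\<^sup>2)"
  shows "integrable N (\<lambda>x. g x * h x)" and "(\<lambda>n. LINT x|N. g x * f n x) \<longlonglongrightarrow> (LINT x|N. g x * h x)"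
proof -
  have ev: "\<forall>\<^sub>F n in sequentially. integrable N (\<lambda>x. (f n x - h x)\<^sup>2)"
    using order_tendstoD(2)[OF lim zero_less_one]
    by eventually_elim (auto simp: integrable_iff_bounded intro: less_trans)
  have gf: "integrable N (\<lambda>x. g x * f n x)" for n by (intro integrable_mult_L2 g f) measurable
  obtain n where n: "integrable N (\<lambda>x. (f n x - h x)\<^sup>2)"
    using ev by (auto simp: eventually_sequentially)
  have gd: "integrable N (\<lambda>x. g x * (f n x - h x))" if "integrable N (\<lambda>x. (f n x - h x)\<^sup>2)" for n
    by (intro integrable_mult_L2 g that) measurable
  show gh: "integrable N (\<lambda>x. g x * h x)"
    using Bochner_Integration.integrable_diff[OF gf[of n] gd[OF n]] by (simp add: algebra_simps)
  have "(\<lambda>n. (ennreal \<bar>(LINT x|N. g x * f n x) - (LINT x|N. g x * h x)\<bar>)\<^sup>2) \<longlonglongrightarrow> 0"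
  proof (rule tendsto_sandwich[OF _ _ tendsto_const])
    have "(\<lambda>n. (\<integral>\<^sup>+x. ennreal ((g x)\<^sup>2) \<partial>N) * (\<integral>\<^sup>+x. ennreal ((f n x - h x)\<^sup>2) \<partial>N)) \<longlonglongrightarrow> (\<integral>\<^sup>+x. ennreal ((g x)\<^sup>2) \<partial>N) * 0"
      using g by (intro ennreal_tendsto_cmult lim) (auto simp: integrable_iff_bounded)
    then show "(\<lambda>n. (\<integral>\<^sup>+x. ennreal ((g x)\<^sup>2) \<partial>N) * (\<integral>\<^sup>+x. ennreal ((f n x - h x)\<^sup>2) \<partial>N)) \<longlonglongrightarrow> 0" by simp
    show "\<forall>\<^sub>F n in sequentially. (ennreal \<bar>(LINT x|N. g x * f n x) - (LINT x|N. g x * h x)\<bar>)\<^sup>2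
      \<le> (\<integral>\<^sup>+x. ennreal ((g x)\<^sup>2) \<partial>N) * (\<integral>\<^sup>+x. ennreal ((f n x - h x)\<^sup>2) \<partial>N)"
      using ev
    proof eventually_elim
      case (elim n)
      have "(LINT x|N. g x * f n x) - (LINT x|N. g x * h x) = (LINT x|N. g x * (f n x - h x))"
        by (subst Bochner_Integration.integral_diff[OF gf gh, symmetric]) (simp add: algebra_simps)
      then show ?case by (simp only:) (rule Cauchy_Schwarz_integral_nn; measurable)
    qed
  qed auto
  then have "(\<lambda>n. ennreal (((LINT x|N. g x * f n x) - (LINT x|N. g x * h x))\<^sup>2)) \<longlonglongrightarrow> ennreal 0"
    by (simp add: ennreal_power)
  then have "(\<lambda>n. ((LINT x|N. g x * f n x) - (LINT x|N. g x * h x))\<^sup>2) \<longlonglongrightarrow> 0"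
    by (subst (asm) tendsto_ennreal_iff) auto
  then have "(\<lambda>n. sqrt (((LINT x|N. g x * f n x) - (LINT x|N. g x * h x))\<^sup>2)) \<longlonglongrightarrow> sqrt 0"
    by (rule tendsto_real_sqrt)
  then have "(\<lambda>n. (LINT x|N. g x * f n x) - (LINT x|N. g x * h x)) \<longlonglongrightarrow> 0"
    by (simp add: tendsto_rabs_zero_iff)
  then show "(\<lambda>n. LINT x|N. g x * f n x) \<longlonglongrightarrow> (LINT x|N. g x * h x)"
    by (rule LIM_zero_cancel)
qed

lemma integrable_bounded_mult:
  fixes f X :: "'b \<Rightarrow> real"
  assumes "integrable N f" and [measurable]: "X \<in> borel_measurable N" and "\<And>x. x \<in> space N \<Longrightarrow> \<bar>X x\<bar> \<le> K"
  shows "integrable N (\<lambda>x. X x * f x)"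
proof (rule Bochner_Integration.integrable_bound)
  show "integrable N (\<lambda>x. K * f x)" using assms by simp
  have "\<bar>X x\<bar> * \<bar>f x\<bar> \<le> \<bar>K\<bar> * \<bar>f x\<bar>" if "x \<in> space N" for x
    using assms(3)[OF that] by (intro mult_right_mono) auto
  then show "AE x in N. norm (X x * f x) \<le> norm (K * f x)" by (auto simp: abs_mult)
qed (use assms in measurable)

section \<open>Space-time measure and boxes\<close>

lemma space_spacetime: "space spacetime = {0<..} \<times> UNIV"
  by (simp add: spacetime_def space_restrict_space)

lemma emeasure_spacetime: "A \<in> sets spacetime \<Longrightarrow> emeasure spacetime A = emeasure lborel A"
  unfolding spacetime_def
  by (subst emeasure_restrict_space) (auto simp: sets_restrict_space borel_Times)

lemma sets_spacetime: "A \<in> sets spacetime \<longleftrightarrow> A \<in> sets borel \<and> A \<subseteq> {0<..} \<times> UNIV"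
  unfolding spacetime_def by (subst sets_restrict_space_iff) (auto simp: borel_Times)

lemma emeasure_spacetime_Times:
  assumes "A \<in> sets borel" "B \<in> sets borel" "A \<subseteq> {0<..}"
  shows "A \<times> B \<in> sets spacetime" "emeasure spacetime (A \<times> B) = emeasure lborel A * emeasure lborel B"
proof -
  show *: "A \<times> B \<in> sets spacetime" using assms by (auto simp: sets_spacetime borel_Times)
  have "emeasure lborel (A \<times> B) = emeasure (lborel \<Otimes>\<^sub>M lborel) (A \<times> B)" by (simp add: lborel_prod)
  also have "\<dots> = emeasure lborel A * emeasure lborel B"
    using assms by (intro lborel.emeasure_pair_measure_Times) auto
  finally show "emeasure spacetime (A \<times> B) = emeasure lborel A * emeasure lborel B"
    using emeasure_spacetime[OF *] by simp
qed

lemma sigma_finite_spacetime: "sigma_finite_measure spacetime"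
  unfolding spacetime_def
  by (intro sigma_finite_measure_restrict_space lborel.sigma_finite_measure_axioms) (auto simp: borel_Times)

definition elementary_box :: "'a elementary \<Rightarrow> (real \<times> real) set"
  where "elementary_box = (\<lambda>(X, a, b, A). {a<..b} \<times> A)"

text \<open>Summing over positions rather than entries turns the square of a sum into a double sum
  over indices, in which repeated entries of the list are harmless.\<close>

lemma simple_process_nth:
  "simple_process P s y \<omega> = (\<Sum>i<length P. fst (P ! i) \<omega> * indicator (elementary_box (P ! i)) (s, y))"
  unfolding simple_process_def sum_list_sum_nth
  by (auto simp: elementary_box_def case_prod_unfold atLeast0LessThan indicator_def intro!: sum.cong)

lemma simple_integral_noise_nth:
  "simple_integral_noise W P \<omega> = (\<Sum>i<length P. fst (P ! i) \<omega> * W (elementary_box (P ! i)) \<omega>)"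
  unfolding simple_integral_noise_def sum_list_sum_nth
  by (auto simp: elementary_box_def case_prod_unfold atLeast0LessThan intro!: sum.cong)

section \<open>Ito isometry and the second moment of the Walsh integral\<close>

context white_noise
begin

text \<open>The half-open time interval of the box starts just after \<open>a\<close>, whereas the
  coefficient depends on the noise up to and including time \<open>a\<close>. This disjointness is
  what independence needs.\<close>

lemma elementary_processE:
  assumes "elementary_process M W e"
  obtains a K where "elementary_box e \<in> finite_spacetime_sets" "elementary_box e \<inter> {0<..a} \<times> UNIV = {}"
    "fst e \<in> borel_measurable (\<F> ({0<..a} \<times> UNIV))" "\<forall>\<omega>\<in>space M. \<bar>fst e \<omega>\<bar> \<le> K"
proof -
  obtain X a b A where e: "e = (X, a, b, A)" by (cases e)
  from assms obtain K where *: "0 \<le> a" "a < b" "A \<in> sets borel" "emeasure lborel A < \<infinity>"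
    "X \<in> borel_measurable (\<F> ({0<..a} \<times> UNIV))" "\<And>\<omega>. \<omega> \<in> space M \<Longrightarrow> \<bar>X \<omega>\<bar> \<le> K"
    by (auto simp: elementary_process_def e noise_filtration_eq_field)
  have "elementary_box e \<in> finite_spacetime_sets"
    using * emeasure_spacetime_Times[of "{a<..b}" A]
    by (auto simp: elementary_box_def e finite_spacetime_sets_def ennreal_mult_less_top subset_eq)
  then show ?thesis using * by (intro that[of a K]) (auto simp: e elementary_box_def)
qed

text \<open>Almost surely \<open>W B * W B'\<close> equals
  \<open>(W C)\<^sup>2 + W V * W C + W U * W B'\<close>, where \<open>C\<close> is the common part
  and \<open>U\<close>, \<open>V\<close> are the differences. Because
  \<open>R \<subseteq> R'\<close> and \<open>B'\<close> avoids \<open>R'\<close>, both coefficients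
  are determined by noise outside \<open>B'\<close>. Hence in the last two products the final factor
  is centred and independent of the rest, and only \<open>(W C)\<^sup>2\<close> contributes.\<close>

lemma elementary_pair_integral:
  assumes B: "B \<in> finite_spacetime_sets" "B \<inter> R = {}" and B': "B' \<in> finite_spacetime_sets" "B' \<inter> R' = {}"
    and R: "R \<subseteq> R'"
    and X: "X \<in> borel_measurable (\<F> R)" "\<And>\<omega>. \<omega> \<in> space M \<Longrightarrow> \<bar>X \<omega>\<bar> \<le> K"
    and X': "X' \<in> borel_measurable (\<F> R')" "\<And>\<omega>. \<omega> \<in> space M \<Longrightarrow> \<bar>X' \<omega>\<bar> \<le> K'"
  shows "has_bochner_integral M (\<lambda>\<omega>. (X \<omega> * W B \<omega>) * (X' \<omega> * W B' \<omega>))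
    (expectation (\<lambda>\<omega>. X \<omega> * X' \<omega>) * measure spacetime (B \<inter> B'))"
proof -
  define C where "C = B \<inter> B'"
  define U where "U = B - B'"
  define V where "V = B' - B"
  have fin: "C \<in> finite_spacetime_sets" "U \<in> finite_spacetime_sets" "V \<in> finite_spacetime_sets"
    using B B' by (auto simp: C_def U_def V_def intro: finite_spacetime_sets_Int finite_spacetime_sets_Diff)
  note [measurable] = noise_measurable[OF fin(1)] noise_measurable[OF fin(2)] noise_measurable[OF fin(3)]
     measurable_noise_field[OF X(1)] measurable_noise_field[OF X'(1)] noise_measurable[OF B(1)] noise_measurable[OF B'(1)]
  have bXX: "\<bar>X \<omega> * X' \<omega>\<bar> \<le> K * K'" if "\<omega> \<in> space M" for \<omega>
    unfolding abs_mult using X(2)[OF that] X'(2)[OF that] by (intro mult_mono) auto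
  have mXX: "(\<lambda>\<omega>. X \<omega> * X' \<omega>) \<in> borel_measurable (\<F> S)" if "R' \<subseteq> S" for S
    using that R measurable_noise_field_mono[OF X(1), of S] measurable_noise_field_mono[OF X'(1), of S]
    by (intro borel_measurable_times) auto
  have IXX: "integrable M (\<lambda>\<omega>. X \<omega> * X' \<omega> * f \<omega>)" if "integrable M f" for f
    using that bXX by (intro integrable_bounded_mult[where X="\<lambda>\<omega>. X \<omega> * X' \<omega>" and K="K * K'"]) auto
  have IXX1: "integrable M (\<lambda>\<omega>. X \<omega> * X' \<omega>)" using IXX[of "\<lambda>_. 1"] by simp
  have 1: "has_bochner_integral M (\<lambda>\<omega>. X \<omega> * X' \<omega> * (W C \<omega>)\<^sup>2) (expectation (\<lambda>\<omega>. X \<omega> * X' \<omega>) * measure spacetime C)"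
  proof -
    have "C \<inter> R' = {}" using B' by (auto simp: C_def)
    from noise_field_indep_integral[OF fin(1) this mXX[OF order_refl] IXX1, of "\<lambda>x. x\<^sup>2"]
    show ?thesis
      using centered_gaussian_square[OF noise_gaussian[OF fin(1)]] by (simp add: noise_variance[OF fin(1)])
  qed
  have 2: "has_bochner_integral M (\<lambda>\<omega>. (X \<omega> * X' \<omega> * W V \<omega>) * W C \<omega>) 0"
  proof -
    have "(\<lambda>\<omega>. X \<omega> * X' \<omega> * W V \<omega>) \<in> borel_measurable (\<F> (- C))"
      using B' fin by (intro borel_measurable_times[OF mXX] noise_measurable_field) (auto simp: C_def V_def)
    then show ?thesis
      using noise_field_indep_integral[OF fin(1), of "- C" "\<lambda>\<omega>. X \<omega> * X' \<omega> * W V \<omega>" "\<lambda>x. x"]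
        IXX[OF noise_mean(1)[OF fin(3)]] noise_mean[OF fin(1)] by auto
  qed
  have 3: "has_bochner_integral M (\<lambda>\<omega>. (X \<omega> * X' \<omega> * W U \<omega>) * W B' \<omega>) 0"
  proof -
    have "(\<lambda>\<omega>. X \<omega> * X' \<omega> * W U \<omega>) \<in> borel_measurable (\<F> (- B'))"
      using B' fin by (intro borel_measurable_times[OF mXX] noise_measurable_field) (auto simp: U_def)
    then show ?thesis
      using noise_field_indep_integral[OF B'(1), of "- B'" "\<lambda>\<omega>. X \<omega> * X' \<omega> * W U \<omega>" "\<lambda>x. x"]
        IXX[OF noise_mean(1)[OF fin(2)]] noise_mean[OF B'(1)] by auto
  qed
  have ae: "AE \<omega> in M. (X \<omega> * W B \<omega>) * (X' \<omega> * W B' \<omega>) =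
      X \<omega> * X' \<omega> * (W C \<omega>)\<^sup>2 + (X \<omega> * X' \<omega> * W V \<omega>) * W C \<omega> + (X \<omega> * X' \<omega> * W U \<omega>) * W B' \<omega>"
    using noise_split[OF B(1) B'(1)] noise_split[OF B'(1) B(1)]
    by eventually_elim (simp add: C_def U_def V_def Int_commute power2_eq_square algebra_simps)
  show ?thesis
    using has_bochner_integral_add[OF has_bochner_integral_add[OF 1 2] 3]
    by (subst has_bochner_integral_cong_AE[OF _ _ ae]) (auto simp: C_def)
qed

text \<open>The process with the larger time \<open>a\<close> takes the role of the primed one,
  whose region of dependence has to contain the other.\<close>

lemma elementary_pair:
  assumes "elementary_process M W e" "elementary_process M W e'"
  shows "has_bochner_integral M
    (\<lambda>\<omega>. (fst e \<omega> * W (elementary_box e) \<omega>) * (fst e' \<omega> * W (elementary_box e') \<omega>))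
    (expectation (\<lambda>\<omega>. fst e \<omega> * fst e' \<omega>) * measure spacetime (elementary_box e \<inter> elementary_box e'))"
proof -
  obtain a K where e: "elementary_box e \<in> finite_spacetime_sets" "elementary_box e \<inter> {0<..a} \<times> UNIV = {}"
    "fst e \<in> borel_measurable (\<F> ({0<..a} \<times> UNIV))" "\<forall>\<omega>\<in>space M. \<bar>fst e \<omega>\<bar> \<le> K"
    using elementary_processE[OF assms(1)] by blast
  obtain a' K' where e': "elementary_box e' \<in> finite_spacetime_sets" "elementary_box e' \<inter> {0<..a'} \<times> UNIV = {}"
    "fst e' \<in> borel_measurable (\<F> ({0<..a'} \<times> UNIV))" "\<forall>\<omega>\<in>space M. \<bar>fst e' \<omega>\<bar> \<le> K'"
    using elementary_processE[OF assms(2)] by blast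
  show ?thesis
  proof (cases "a \<le> a'")
    case True
    then have "{0<..a} \<times> (UNIV::real set) \<subseteq> {0<..a'} \<times> UNIV" by auto
    then show ?thesis by (intro elementary_pair_integral[OF e(1,2) e'(1,2) _ e(3) e(4)[rule_format] e'(3) e'(4)[rule_format]])
  next
    case False
    then have "{0<..a'} \<times> (UNIV::real set) \<subseteq> {0<..a} \<times> UNIV" by auto
    from elementary_pair_integral[OF e'(1,2) e(1,2) this e'(3) e'(4)[rule_format] e(3) e(4)[rule_format]]
    show ?thesis by (simp add: mult_ac Int_commute)
  qed
qed

lemma elementary_process_basic:
  assumes "elementary_process M W e"
  shows "fst e \<in> borel_measurable M" "elementary_box e \<in> finite_spacetime_sets"
    "integrable M f \<Longrightarrow> integrable M (\<lambda>\<omega>. fst e \<omega> * f \<omega>)"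
proof -
  obtain a K where e: "elementary_box e \<in> finite_spacetime_sets" "elementary_box e \<inter> {0<..a} \<times> UNIV = {}"
    "fst e \<in> borel_measurable (\<F> ({0<..a} \<times> UNIV))" "\<forall>\<omega>\<in>space M. \<bar>fst e \<omega>\<bar> \<le> K"
    using elementary_processE[OF assms(1)] by blast
  then show "fst e \<in> borel_measurable M" "elementary_box e \<in> finite_spacetime_sets"
    by (auto intro: measurable_noise_field)
  then show "integrable M f \<Longrightarrow> integrable M (\<lambda>\<omega>. fst e \<omega> * f \<omega>)"
    using e by (intro integrable_bounded_mult) auto
qed

lemma elementary_mult_integrable:
  "elementary_process M W e \<Longrightarrow> elementary_process M W e' \<Longrightarrow> integrable M (\<lambda>\<omega>. fst e \<omega> * fst e' \<omega>)"
  using elementary_process_basic(3)[of e' "\<lambda>_. 1"] elementary_process_basic(3)[of e "fst e'"] by simp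

lemma simple_process_measurable:
  assumes P: "\<And>e. e \<in> set P \<Longrightarrow> elementary_process M W e"
  shows "(\<lambda>((s, y), \<omega>). simple_process P s y \<omega>) \<in> borel_measurable (spacetime \<Otimes>\<^sub>M M)"
    "simple_integral_noise W P \<in> borel_measurable M"
proof -
  have 1: "i < length P \<Longrightarrow> fst (P ! i) \<in> borel_measurable M" for i
    using elementary_process_basic[OF P] by simp
  have 2: "i < length P \<Longrightarrow> elementary_box (P ! i) \<in> sets spacetime" for i
    using elementary_process_basic[OF P] by (simp add: finite_spacetime_sets_def)
  have 3: "i < length P \<Longrightarrow> W (elementary_box (P ! i)) \<in> borel_measurable M" for i
    using elementary_process_basic[OF P] by (intro noise_measurable) simp
  note [measurable] = 1 2 3
  have "(\<lambda>p. \<Sum>i<length P. fst (P ! i) (snd p) * indicator (elementary_box (P ! i)) (fst p))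
    \<in> borel_measurable (spacetime \<Otimes>\<^sub>M M)"
    by (intro borel_measurable_sum) measurable
  then show "(\<lambda>((s, y), \<omega>). simple_process P s y \<omega>) \<in> borel_measurable (spacetime \<Otimes>\<^sub>M M)"
    unfolding simple_process_nth by (simp add: case_prod_unfold)
  show "simple_integral_noise W P \<in> borel_measurable M"
    unfolding simple_integral_noise_nth[abs_def] by (intro borel_measurable_sum) measurable
qed

text \<open>Boxes may overlap: the pair formula accounts for intersections, so the list is not
  refined to disjoint boxes. Both sides expand to the same double sum \<open>S\<close>.\<close>

lemma simple_ito_isometry:
  assumes P: "\<And>e. e \<in> set P \<Longrightarrow> elementary_process M W e"
  shows "integrable M (\<lambda>\<omega>. (simple_integral_noise W P \<omega>)\<^sup>2)"
    "(\<integral>\<^sup>+\<omega>. ennreal ((simple_integral_noise W P \<omega>)\<^sup>2) \<partial>M) =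
      (\<integral>\<^sup>+((s, y), \<omega>). ennreal ((simple_process P s y \<omega>)\<^sup>2) \<partial>(spacetime \<Otimes>\<^sub>M M))"
proof -
  define X where "X i = fst (P ! i)" for i
  define B where "B i = elementary_box (P ! i)" for i
  define n where "n = length P"
  have el: "elementary_process M W (P ! i)" if "i < n" for i using that P by (simp add: n_def)
  have XB: "X i \<in> borel_measurable M" "B i \<in> finite_spacetime_sets" if "i < n" for i
    using elementary_process_basic[OF el[OF that]] by (simp_all add: X_def B_def)
  have IX: "integrable M (\<lambda>\<omega>. X i \<omega> * X j \<omega>)" if "i < n" "j < n" for i j
    using elementary_mult_integrable[OF el el, OF that] by (simp add: X_def)
  define S where "S = (\<Sum>i<n. \<Sum>j<n. expectation (\<lambda>\<omega>. X i \<omega> * X j \<omega>) * measure spacetime (B i \<inter> B j))"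
  have "has_bochner_integral M (\<lambda>\<omega>. \<Sum>i<n. \<Sum>j<n. (X i \<omega> * W (B i) \<omega>) * (X j \<omega> * W (B j) \<omega>)) S"
    unfolding S_def X_def B_def
    by (intro has_bochner_integral_sum elementary_pair el) auto
  then have M: "has_bochner_integral M (\<lambda>\<omega>. (simple_integral_noise W P \<omega>)\<^sup>2) S"
    by (simp add: simple_integral_noise_nth power2_eq_square sum_product X_def B_def n_def)
  then show I: "integrable M (\<lambda>\<omega>. (simple_integral_noise W P \<omega>)\<^sup>2)" by (simp add: has_bochner_integral_iff)
  have "(\<integral>\<^sup>+\<omega>. ennreal ((simple_integral_noise W P \<omega>)\<^sup>2) \<partial>M) = ennreal S"
    using M by (subst nn_integral_eq_integral) (auto simp: has_bochner_integral_iff)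
  also have "\<dots> = (\<integral>\<^sup>+z. (\<integral>\<^sup>+\<omega>. ennreal ((simple_process P (fst z) (snd z) \<omega>)\<^sup>2) \<partial>M) \<partial>spacetime)"
  proof -
    have z: "has_bochner_integral M (\<lambda>\<omega>. (simple_process P (fst z) (snd z) \<omega>)\<^sup>2)
      (\<Sum>i<n. \<Sum>j<n. expectation (\<lambda>\<omega>. X i \<omega> * X j \<omega>) * indicator (B i \<inter> B j) z)" (is "has_bochner_integral M _ (?S z)") for z
    proof -
      have "has_bochner_integral M (\<lambda>\<omega>. \<Sum>i<n. \<Sum>j<n. (X i \<omega> * X j \<omega>) * indicator (B i \<inter> B j) z) (?S z)"
        using IX by (intro has_bochner_integral_sum) (auto simp: has_bochner_integral_iff)
      moreover have "(\<Sum>i<n. \<Sum>j<n. (X i \<omega> * X j \<omega>) * indicator (B i \<inter> B j) z) = (simple_process P (fst z) (snd z) \<omega>)\<^sup>2" for \<omega>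
        unfolding simple_process_nth power2_eq_square sum_product X_def B_def n_def
        by (auto intro!: sum.cong simp: indicator_inter_arith)
      ultimately show ?thesis by simp
    qed
    have nn: "(\<integral>\<^sup>+\<omega>. ennreal ((simple_process P (fst z) (snd z) \<omega>)\<^sup>2) \<partial>M) = ennreal (?S z)" for z
      using z[of z] by (subst nn_integral_eq_integral) (auto simp: has_bochner_integral_iff)
    have S0: "?S z \<ge> 0" for z
    proof -
      have "?S z = expectation (\<lambda>\<omega>. (simple_process P (fst z) (snd z) \<omega>)\<^sup>2)"
        using z[of z] by (simp add: has_bochner_integral_iff)
      then show ?thesis by simp
    qed
    have "has_bochner_integral spacetime ?S S"
      unfolding S_def
    proof (intro has_bochner_integral_sum has_bochner_integral_mult_right)
      fix i j assume "i \<in> {..<n}" "j \<in> {..<n}"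
      then have "B i \<inter> B j \<in> finite_spacetime_sets" by (auto intro!: finite_spacetime_sets_Int XB)
      then show "has_bochner_integral spacetime (indicator (B i \<inter> B j)) (measure spacetime (B i \<inter> B j))"
        by (auto simp: has_bochner_integral_iff finite_spacetime_sets_def)
    qed
    then have "(\<integral>\<^sup>+z. ennreal (?S z) \<partial>spacetime) = ennreal S"
      using S0 by (subst nn_integral_eq_integral) (auto simp: has_bochner_integral_iff)
    then show ?thesis by (simp only: nn)
  qed
  also have "\<dots> = (\<integral>\<^sup>+((s, y), \<omega>). ennreal ((simple_process P s y \<omega>)\<^sup>2) \<partial>(spacetime \<Otimes>\<^sub>M M))"
    using simple_process_measurable(1)[OF P]
    by (subst nn_integral_fst[symmetric]) (auto simp: case_prod_unfold)
  finally show "(\<integral>\<^sup>+\<omega>. ennreal ((simple_integral_noise W P \<omega>)\<^sup>2) \<partial>M) =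
      (\<integral>\<^sup>+((s, y), \<omega>). ennreal ((simple_process P s y \<omega>)\<^sup>2) \<partial>(spacetime \<Otimes>\<^sub>M M))" .
qed

text \<open>The inequality \<open>(x + y)\<^sup>2 \<le> 2 * x\<^sup>2 + 2 * y\<^sup>2\<close> is
  spent once on \<open>J\<close> and once on \<open>\<Phi>\<close>, whence the factor 4; the
  approximation errors vanish in the limit. The bound also makes sense when the right side is
  infinite.\<close>

lemma walsh_second_moment:
  assumes "has_walsh_integral M W \<Phi> J"
  shows "(\<integral>\<^sup>+\<omega>. ennreal ((J \<omega>)\<^sup>2) \<partial>M) \<le> 4 * (\<integral>\<^sup>+((s, y), \<omega>). ennreal ((\<Phi> s y \<omega>)\<^sup>2) \<partial>(spacetime \<Otimes>\<^sub>M M))"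
proof -
  let ?N = "spacetime \<Otimes>\<^sub>M M"
  from assms obtain P where [measurable]: "(\<lambda>((s, y), \<omega>). \<Phi> s y \<omega>) \<in> borel_measurable ?N" "J \<in> borel_measurable M"
    and P: "\<And>n e. e \<in> set (P n) \<Longrightarrow> elementary_process M W e"
    and l1: "(\<lambda>n. \<integral>\<^sup>+((s, y), \<omega>). ennreal ((simple_process (P n) s y \<omega> - \<Phi> s y \<omega>)\<^sup>2) \<partial>?N) \<longlonglongrightarrow> 0"
    and l2: "(\<lambda>n. \<integral>\<^sup>+\<omega>. ennreal ((simple_integral_noise W (P n) \<omega> - J \<omega>)\<^sup>2) \<partial>M) \<longlonglongrightarrow> 0"
    unfolding has_walsh_integral_def by blast
  note [measurable] = simple_process_measurable[OF P]
  define F where "F z = (\<lambda>((s, y), \<omega>). \<Phi> s y \<omega>) z" for z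
  define G where "G n z = (\<lambda>((s, y), \<omega>). simple_process (P n) s y \<omega>) z" for n z
  have [measurable]: "F \<in> borel_measurable ?N" "\<And>n. G n \<in> borel_measurable ?N"
    unfolding F_def[abs_def] G_def[abs_def] by measurable
  have two: "(x + y)\<^sup>2 \<le> 2 * x\<^sup>2 + 2 * y\<^sup>2" for x y :: real
    using zero_le_power2[of "x - y"] by (simp add: power2_eq_square algebra_simps)
  have le: "(\<integral>\<^sup>+x. ennreal ((f x)\<^sup>2) \<partial>N) \<le> 2 * (\<integral>\<^sup>+x. ennreal ((g x)\<^sup>2) \<partial>N) + 2 * (\<integral>\<^sup>+x. ennreal ((g x - f x)\<^sup>2) \<partial>N)"
    if [measurable]: "f \<in> borel_measurable N" "g \<in> borel_measurable N" for N :: "'z measure" and f g :: "'z \<Rightarrow> real"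
  proof -
    have "(\<integral>\<^sup>+x. ennreal ((f x)\<^sup>2) \<partial>N) \<le> (\<integral>\<^sup>+x. 2 * ennreal ((g x)\<^sup>2) + 2 * ennreal ((g x - f x)\<^sup>2) \<partial>N)"
    proof (rule nn_integral_mono)
      fix x
      have "(f x)\<^sup>2 \<le> 2 * (g x)\<^sup>2 + 2 * (g x - f x)\<^sup>2"
        using two[of "g x" "f x - g x"] by (simp add: power2_commute)
      then have "ennreal ((f x)\<^sup>2) \<le> ennreal (2 * (g x)\<^sup>2 + 2 * (g x - f x)\<^sup>2)" by (rule ennreal_leI)
      then show "ennreal ((f x)\<^sup>2) \<le> 2 * ennreal ((g x)\<^sup>2) + 2 * ennreal ((g x - f x)\<^sup>2)"
        by (simp add: ennreal_mult)
    qed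
    then show ?thesis by (simp add: nn_integral_add nn_integral_cmult)
  qed
  have bound: "(\<integral>\<^sup>+\<omega>. ennreal ((J \<omega>)\<^sup>2) \<partial>M) \<le> 4 * (\<integral>\<^sup>+z. ennreal ((F z)\<^sup>2) \<partial>?N)
     + (4 * (\<integral>\<^sup>+z. ennreal ((G n z - F z)\<^sup>2) \<partial>?N) + 2 * (\<integral>\<^sup>+\<omega>. ennreal ((simple_integral_noise W (P n) \<omega> - J \<omega>)\<^sup>2) \<partial>M))" for n
  proof -
    have "(\<integral>\<^sup>+\<omega>. ennreal ((J \<omega>)\<^sup>2) \<partial>M) \<le> 2 * (\<integral>\<^sup>+\<omega>. ennreal ((simple_integral_noise W (P n) \<omega>)\<^sup>2) \<partial>M)
       + 2 * (\<integral>\<^sup>+\<omega>. ennreal ((simple_integral_noise W (P n) \<omega> - J \<omega>)\<^sup>2) \<partial>M)"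
      by (rule le) measurable
    also have "(\<integral>\<^sup>+\<omega>. ennreal ((simple_integral_noise W (P n) \<omega>)\<^sup>2) \<partial>M) = (\<integral>\<^sup>+z. ennreal ((G n z)\<^sup>2) \<partial>?N)"
      using simple_ito_isometry(2)[OF P] by (simp add: G_def case_prod_unfold)
    also have "2 * (\<integral>\<^sup>+z. ennreal ((G n z)\<^sup>2) \<partial>?N) \<le> 
        2 * (2 * (\<integral>\<^sup>+z. ennreal ((F z)\<^sup>2) \<partial>?N) + 2 * (\<integral>\<^sup>+z. ennreal ((F z - G n z)\<^sup>2) \<partial>?N))"
      by (intro mult_left_mono le) auto
    also have "\<dots> = 4 * (\<integral>\<^sup>+z. ennreal ((F z)\<^sup>2) \<partial>?N) + 4 * (\<integral>\<^sup>+z. ennreal ((G n z - F z)\<^sup>2) \<partial>?N)"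
      by (simp add: distrib_left power2_commute[of "F _"] mult.assoc[symmetric])
    finally show ?thesis
      by (simp add: add_right_mono add.assoc)
  qed
  have l1': "(\<lambda>n. \<integral>\<^sup>+z. ennreal ((G n z - F z)\<^sup>2) \<partial>?N) \<longlonglongrightarrow> 0"
    using l1 by (simp add: F_def G_def case_prod_unfold)
  have "(\<lambda>n. 4 * (\<integral>\<^sup>+z. ennreal ((F z)\<^sup>2) \<partial>?N)
     + (4 * (\<integral>\<^sup>+z. ennreal ((G n z - F z)\<^sup>2) \<partial>?N) + 2 * (\<integral>\<^sup>+\<omega>. ennreal ((simple_integral_noise W (P n) \<omega> - J \<omega>)\<^sup>2) \<partial>M)))
    \<longlonglongrightarrow> 4 * (\<integral>\<^sup>+z. ennreal ((F z)\<^sup>2) \<partial>?N) + (4 * 0 + 2 * 0)"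
    by (intro tendsto_add tendsto_const ennreal_tendsto_cmult l1' l2) auto
  from LIMSEQ_le_const[OF this, of "\<integral>\<^sup>+\<omega>. ennreal ((J \<omega>)\<^sup>2) \<partial>M"] bound
  show ?thesis by (auto simp: F_def case_prod_unfold)
qed

end

section \<open>Tilting by the noise of a window\<close>

context white_noise
begin

text \<open>The Cameron-Martin density for a shift of the noise by \<open>- a\<close> on
  \<open>D\<close>; the deterministic term in the exponent normalises its mean to 1.\<close>

definition tilt :: "real \<Rightarrow> (real \<times> real) set \<Rightarrow> 'a \<Rightarrow> real"
  where "tilt a D \<omega> = exp (- a * W D \<omega> - a\<^sup>2 * measure spacetime D / 2)"

lemma tilt_pos: "0 < tilt a D \<omega>"
  by (simp add: tilt_def)

lemma tilt_measurable: "D \<in> finite_spacetime_sets \<Longrightarrow> tilt a D \<in> borel_measurable M"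
  using noise_measurable[of D] unfolding tilt_def[abs_def] by measurable

text \<open>In the exponent the square of \<open>n\<close> comes from the Gaussian moment and
  \<open>- n\<close> from the normalisation. The powers 1, 2 and 4 will be used, with exponents 0,
  \<open>a\<^sup>2 |D|\<close> and \<open>6 a\<^sup>2 |D|\<close>.\<close>

lemma tilt_power_integral:
  assumes "D \<in> finite_spacetime_sets"
  shows "has_bochner_integral M (\<lambda>\<omega>. tilt a D \<omega> ^ n) (exp ((real n ^ 2 - real n) * a\<^sup>2 * measure spacetime D / 2))"
proof -
  have "has_bochner_integral M (\<lambda>\<omega>. exp (- (real n * a\<^sup>2 * measure spacetime D / 2)) * exp ((- (real n * a)) * W D \<omega>))
    (exp (- (real n * a\<^sup>2 * measure spacetime D / 2)) * exp ((- (real n * a))\<^sup>2 * measure spacetime D / 2))"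
    by (intro has_bochner_integral_mult_right noise_has_exp_moment assms)
  also have "(\<lambda>\<omega>. exp (- (real n * a\<^sup>2 * measure spacetime D / 2)) * exp ((- (real n * a)) * W D \<omega>)) = (\<lambda>\<omega>. tilt a D \<omega> ^ n)"
    by (auto simp: tilt_def fun_eq_iff exp_of_nat_mult[symmetric] exp_add[symmetric] algebra_simps)
  also have "exp (- (real n * a\<^sup>2 * measure spacetime D / 2)) * exp ((- (real n * a))\<^sup>2 * measure spacetime D / 2)
    = exp ((real n ^ 2 - real n) * a\<^sup>2 * measure spacetime D / 2)"
    by (simp add: exp_add[symmetric] power_mult_distrib algebra_simps diff_divide_distrib)
  finally show ?thesis .
qed

text \<open>Only \<open>C = D \<inter> B\<close> correlates \<open>W B\<close> with the density. The
  share of the density from \<open>U = D - B\<close> is absorbed with \<open>X\<close> into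
  \<open>Y\<close>, which depends on noise outside \<open>C\<close>. What remains on
  \<open>C\<close> is the derivative of a Gaussian moment generating function, namely
  \<open>- a * |C|\<close> times the generating function itself. The part of \<open>W B\<close> on
  \<open>V = B - D\<close> is centred and independent of all other factors.\<close>

lemma tilt_noise_integral:
  assumes B: "B \<in> finite_spacetime_sets" "B \<inter> R = {}" and D: "D \<in> finite_spacetime_sets"
    and X: "X \<in> borel_measurable (\<F> R)" "\<And>\<omega>. \<omega> \<in> space M \<Longrightarrow> \<bar>X \<omega>\<bar> \<le> K"
  shows "has_bochner_integral M (\<lambda>\<omega>. tilt a D \<omega> * (X \<omega> * W B \<omega>))
    (- a * measure spacetime (D \<inter> B) * expectation (\<lambda>\<omega>. tilt a D \<omega> * X \<omega>))"
proof -
  define C where "C = D \<inter> B"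
  define U where "U = D - B"
  define V where "V = B - D"
  have fin: "C \<in> finite_spacetime_sets" "U \<in> finite_spacetime_sets" "V \<in> finite_spacetime_sets"
    using B D by (auto simp: C_def U_def V_def intro: finite_spacetime_sets_Int finite_spacetime_sets_Diff)
  note [measurable] = noise_measurable[OF fin(1)] noise_measurable[OF fin(2)] noise_measurable[OF fin(3)]
     measurable_noise_field[OF X(1)] noise_measurable[OF B(1)] noise_measurable[OF D(1)] tilt_measurable[OF D]
  have IX: "integrable M (\<lambda>\<omega>. X \<omega> * exp (- a * W A \<omega>))" if "A \<in> finite_spacetime_sets" for A
    using noise_has_exp_moment(1)[OF that, of "- a"] X measurable_noise_field[OF X(1)]
    by (intro integrable_bounded_mult) (auto simp: has_bochner_integral_iff)
  define Y where "Y \<omega> = X \<omega> * exp (- a * W U \<omega>)" for \<omega>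
  have Y[measurable]: "Y \<in> borel_measurable M" unfolding Y_def[abs_def] by measurable
  have "X \<in> borel_measurable (\<F> (- C))"
    using B by (intro measurable_noise_field_mono[OF X(1)]) (auto simp: C_def)
  moreover have "W U \<in> borel_measurable (\<F> (- C))"
    using fin by (intro noise_measurable_field) (auto simp: C_def U_def)
  ultimately have YC: "Y \<in> borel_measurable (\<F> (- C))" unfolding Y_def[abs_def] by measurable
  have IY: "integrable M Y" unfolding Y_def[abs_def] by (rule IX[OF fin(2)])
  define k where "k = measure spacetime C"
  have CC: "C \<inter> - C = {}" by auto
  have 1: "has_bochner_integral M (\<lambda>\<omega>. Y \<omega> * exp (- a * W C \<omega>)) (expectation Y * exp (a\<^sup>2 * k / 2))"
    using noise_field_indep_integral[OF fin(1) CC YC IY, of "\<lambda>x. exp (- a * x)"] noise_has_exp_moment(1)[OF fin(1), of "- a"]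
    by (simp add: has_bochner_integral_iff k_def)
  have 2: "has_bochner_integral M (\<lambda>\<omega>. Y \<omega> * (W C \<omega> * exp (- a * W C \<omega>))) (expectation Y * (- a * k * exp (a\<^sup>2 * k / 2)))"
    using noise_field_indep_integral[OF fin(1) CC YC IY, of "\<lambda>x. x * exp (- a * x)"] noise_has_exp_moment(2)[OF fin(1), of "- a"]
    by (simp add: has_bochner_integral_iff k_def)
  have aeD: "AE \<omega> in M. W D \<omega> = W C \<omega> + W U \<omega>"
    using noise_split[OF D B(1)] by (simp add: C_def U_def)
  have aeB: "AE \<omega> in M. W B \<omega> = W C \<omega> + W V \<omega>"
    using noise_split[OF B(1) D] by (simp add: C_def V_def Int_commute)
  have "AE \<omega> in M. X \<omega> * exp (- a * W D \<omega>) = Y \<omega> * exp (- a * W C \<omega>)"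
    using aeD by eventually_elim (simp add: Y_def exp_add[symmetric] algebra_simps)
  \<comment> \<open>Reassembles the split density, so that
    \<open>expectation Y * exp (a\<^sup>2 * k / 2)\<close> can be traded for the unsplit
    expectation.\<close>
  then have eY: "expectation (\<lambda>\<omega>. X \<omega> * exp (- a * W D \<omega>)) = expectation Y * exp (a\<^sup>2 * k / 2)"
    using 1 by (subst integral_cong_AE[of _ _ "\<lambda>\<omega>. Y \<omega> * exp (- a * W C \<omega>)"]) (auto simp: has_bochner_integral_iff)
  have 3: "has_bochner_integral M (\<lambda>\<omega>. (X \<omega> * exp (- a * W D \<omega>)) * W V \<omega>) 0"
  proof -
    have "X \<in> borel_measurable (\<F> (- V))"
      using B by (intro measurable_noise_field_mono[OF X(1)]) (auto simp: V_def)
    moreover have "W D \<in> borel_measurable (\<F> (- V))"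
      using D by (intro noise_measurable_field) (auto simp: V_def)
    ultimately have "(\<lambda>\<omega>. X \<omega> * exp (- a * W D \<omega>)) \<in> borel_measurable (\<F> (- V))" by measurable
    then show ?thesis
      using noise_field_indep_integral[OF fin(3), of "- V" "\<lambda>\<omega>. X \<omega> * exp (- a * W D \<omega>)" "\<lambda>x. x"]
        IX[OF D] noise_mean[OF fin(3)] by simp
  qed
  define q where "q = exp (- (a\<^sup>2 * measure spacetime D / 2))"
  have tq: "tilt a D \<omega> = q * exp (- a * W D \<omega>)" for \<omega> by (simp add: tilt_def q_def exp_add[symmetric])
  have ae: "AE \<omega> in M. tilt a D \<omega> * (X \<omega> * W B \<omega>) =
     q * (Y \<omega> * (W C \<omega> * exp (- a * W C \<omega>)) + (X \<omega> * exp (- a * W D \<omega>)) * W V \<omega>)"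
    using aeD aeB by eventually_elim (simp add: tq Y_def exp_add exp_diff exp_minus algebra_simps divide_inverse)
  have "has_bochner_integral M (\<lambda>\<omega>. q * (Y \<omega> * (W C \<omega> * exp (- a * W C \<omega>)) + (X \<omega> * exp (- a * W D \<omega>)) * W V \<omega>))
     (q * (expectation Y * (- a * k * exp (a\<^sup>2 * k / 2)) + 0))"
    by (intro has_bochner_integral_mult_right has_bochner_integral_add 2 3)
  also have "q * (expectation Y * (- a * k * exp (a\<^sup>2 * k / 2)) + 0) = - a * k * (q * expectation (\<lambda>\<omega>. X \<omega> * exp (- a * W D \<omega>)))"
    unfolding eY by (simp add: mult_ac)
  also have "q * expectation (\<lambda>\<omega>. X \<omega> * exp (- a * W D \<omega>)) = expectation (\<lambda>\<omega>. tilt a D \<omega> * X \<omega>)"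
    by (subst integral_mult_right_zero[symmetric]) (simp add: tq mult_ac)
  finally show ?thesis
    by (subst has_bochner_integral_cong_AE[OF _ _ ae]) (auto simp: k_def C_def)
qed

text \<open>A Gaussian integration by parts: under the measure with density \<open>tilt a D\<close> the noise
  acquires the drift \<open>- a\<close> on \<open>D\<close>.\<close>

lemma walsh_tilt:
  assumes walsh: "has_walsh_integral M W \<Phi> J" and D: "D \<in> finite_spacetime_sets"
  shows "integrable spacetime (\<lambda>z. indicator D z * expectation (\<lambda>\<omega>. tilt a D \<omega> * \<Phi> (fst z) (snd z) \<omega>))"
    and "expectation (\<lambda>\<omega>. tilt a D \<omega> * J \<omega>) =
      - a * (LINT z|spacetime. indicator D z * expectation (\<lambda>\<omega>. tilt a D \<omega> * \<Phi> (fst z) (snd z) \<omega>))"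
proof -
  let ?N = "spacetime \<Otimes>\<^sub>M M"
  note nn_fst = nn_integral_fst
  interpret spacetime: sigma_finite_measure spacetime by (rule sigma_finite_spacetime)
  interpret pair_sigma_finite spacetime M ..
  from walsh obtain P where [measurable]: "(\<lambda>((s, y), \<omega>). \<Phi> s y \<omega>) \<in> borel_measurable ?N" "J \<in> borel_measurable M"
    and P: "\<And>n e. e \<in> set (P n) \<Longrightarrow> elementary_process M W e"
    and l1: "(\<lambda>n. \<integral>\<^sup>+((s, y), \<omega>). ennreal ((simple_process (P n) s y \<omega> - \<Phi> s y \<omega>)\<^sup>2) \<partial>?N) \<longlonglongrightarrow> 0"
    and l2: "(\<lambda>n. \<integral>\<^sup>+\<omega>. ennreal ((simple_integral_noise W (P n) \<omega> - J \<omega>)\<^sup>2) \<partial>M) \<longlonglongrightarrow> 0"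
    unfolding has_walsh_integral_def by blast
  note [measurable] = simple_process_measurable[OF P] tilt_measurable[OF D]
  have [measurable]: "D \<in> sets spacetime" using D by (simp add: finite_spacetime_sets_def)
  define F where "F z = (\<lambda>((s, y), \<omega>). \<Phi> s y \<omega>) z" for z
  define G where "G n z = (\<lambda>((s, y), \<omega>). simple_process (P n) s y \<omega>) z" for n z
  \<comment> \<open>\<open>D\<close> has finite measure and the density has a second moment, so
    \<open>g\<close> lies in L2 of the product space and can be paired with the approximating simple
    processes.\<close>
  define g where "g z = (indicator D (fst z) * tilt a D (snd z) :: real)" for z
  have [measurable]: "F \<in> borel_measurable ?N" "\<And>n. G n \<in> borel_measurable ?N" "g \<in> borel_measurable ?N"
    unfolding F_def[abs_def] G_def[abs_def] g_def[abs_def] by measurable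
  have t2: "integrable M (\<lambda>\<omega>. (tilt a D \<omega>)\<^sup>2)"
    using tilt_power_integral[OF D, of a 2] by (simp add: has_bochner_integral_iff)
  have g2: "integrable ?N (\<lambda>z. (g z)\<^sup>2)"
  proof -
    have "(\<integral>\<^sup>+z. ennreal ((g z)\<^sup>2) \<partial>?N) = (\<integral>\<^sup>+z. indicator D z * (\<integral>\<^sup>+\<omega>. ennreal ((tilt a D \<omega>)\<^sup>2) \<partial>M) \<partial>spacetime)"
      by (subst nn_fst[symmetric])
        (auto simp: g_def power_mult_distrib nn_integral_cmult[symmetric] intro!: nn_integral_cong split: split_indicator)
    also have "\<dots> < \<infinity>"
      using t2 D by (simp add: nn_integral_multc finite_spacetime_sets_def integrable_iff_bounded ennreal_mult_less_top)
    finally show ?thesis by (simp add: integrable_iff_bounded)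
  qed
  have G2: "integrable ?N (\<lambda>z. (G n z)\<^sup>2)" for n
  proof -
    have "(\<integral>\<^sup>+z. ennreal ((G n z)\<^sup>2) \<partial>?N) = (\<integral>\<^sup>+\<omega>. ennreal ((simple_integral_noise W (P n) \<omega>)\<^sup>2) \<partial>M)"
      using simple_ito_isometry(2)[OF P] by (simp add: G_def case_prod_unfold)
    also have "\<dots> < \<infinity>" using simple_ito_isometry(1)[OF P] by (simp add: integrable_iff_bounded)
    finally show ?thesis by (simp add: integrable_iff_bounded)
  qed
  have l1': "(\<lambda>n. \<integral>\<^sup>+z. ennreal ((G n z - F z)\<^sup>2) \<partial>?N) \<longlonglongrightarrow> 0"
    using l1 by (simp add: F_def G_def case_prod_unfold)
  have IgF: "integrable ?N (\<lambda>z. g z * F z)" and lim: "(\<lambda>n. LINT z|?N. g z * G n z) \<longlonglongrightarrow> (LINT z|?N. g z * F z)"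
    by (rule L2_pairing_tendsto[OF _ _ _ l1' g2 G2]; measurable)+
  have limJ: "(\<lambda>n. expectation (\<lambda>\<omega>. tilt a D \<omega> * simple_integral_noise W (P n) \<omega>)) \<longlonglongrightarrow> expectation (\<lambda>\<omega>. tilt a D \<omega> * J \<omega>)"
    by (rule L2_pairing_tendsto(2)[OF _ _ _ l2 t2 simple_ito_isometry(1)[OF P]]) measurable
  have inner: "(LINT \<omega>|M. g (z, \<omega>) * F (z, \<omega>)) = indicator D z * expectation (\<lambda>\<omega>. tilt a D \<omega> * \<Phi> (fst z) (snd z) \<omega>)" for z
    by (simp add: g_def F_def case_prod_unfold mult.assoc)
  show "integrable spacetime (\<lambda>z. indicator D z * expectation (\<lambda>\<omega>. tilt a D \<omega> * \<Phi> (fst z) (snd z) \<omega>))"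
    using integrable_fst'[OF IgF] by (simp add: inner)
  have gF: "(LINT z|?N. g z * F z) = (LINT z|spacetime. indicator D z * expectation (\<lambda>\<omega>. tilt a D \<omega> * \<Phi> (fst z) (snd z) \<omega>))"
    using integral_fst'[OF IgF] by (simp add: inner)
  \<comment> \<open>For simple processes both sides are the same finite sum; the two limits already
    obtained carry the identity over to \<open>J\<close> and \<open>\<Phi>\<close>.\<close>
  have "expectation (\<lambda>\<omega>. tilt a D \<omega> * simple_integral_noise W (P n) \<omega>) = - a * (LINT z|?N. g z * G n z)" for n
  proof -
    define X where "X i = fst (P n ! i)" for i
    define B where "B i = elementary_box (P n ! i)" for i
    define l where "l = length (P n)"
    have el: "elementary_process M W (P n ! i)" if "i < l" for i using that P[of "P n ! i" n] by (simp add: l_def)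
    have It: "integrable M (tilt a D)" using tilt_power_integral[OF D, of a 1] by (simp add: has_bochner_integral_iff)
    have IX: "integrable M (\<lambda>\<omega>. tilt a D \<omega> * X i \<omega>)" if "i < l" for i
      using elementary_process_basic(3)[OF el[OF that] It] by (simp add: X_def mult.commute)
    have "has_bochner_integral M (\<lambda>\<omega>. tilt a D \<omega> * (X i \<omega> * W (B i) \<omega>))
      (- a * measure spacetime (D \<inter> B i) * expectation (\<lambda>\<omega>. tilt a D \<omega> * X i \<omega>))" if i: "i < l" for i
    proof -
      obtain b K where e: "B i \<in> finite_spacetime_sets" "B i \<inter> {0<..b} \<times> UNIV = {}"
        "X i \<in> borel_measurable (\<F> ({0<..b} \<times> UNIV))" "\<forall>\<omega>\<in>space M. \<bar>X i \<omega>\<bar> \<le> K"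
        using elementary_processE[OF el[OF i]] unfolding X_def B_def by blast
      show ?thesis by (rule tilt_noise_integral[OF e(1,2) D e(3) e(4)[rule_format]])
    qed
    then have "has_bochner_integral M (\<lambda>\<omega>. \<Sum>i<l. tilt a D \<omega> * (X i \<omega> * W (B i) \<omega>))
      (\<Sum>i<l. - a * measure spacetime (D \<inter> B i) * expectation (\<lambda>\<omega>. tilt a D \<omega> * X i \<omega>))"
      by (intro has_bochner_integral_sum) auto
    then have E: "expectation (\<lambda>\<omega>. tilt a D \<omega> * simple_integral_noise W (P n) \<omega>) =
      (\<Sum>i<l. - a * measure spacetime (D \<inter> B i) * expectation (\<lambda>\<omega>. tilt a D \<omega> * X i \<omega>))"
      by (simp add: simple_integral_noise_nth sum_distrib_left X_def B_def l_def has_bochner_integral_iff)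
    have "(LINT z|?N. g z * G n z) = (LINT z|spacetime. LINT \<omega>|M. g (z, \<omega>) * G n (z, \<omega>))"
      by (intro integral_fst'[symmetric] integrable_mult_L2 g2 G2) measurable
    also have "\<dots> = (LINT z|spacetime. (\<Sum>i<l. expectation (\<lambda>\<omega>. tilt a D \<omega> * X i \<omega>) * indicator (D \<inter> B i) z))"
    proof (intro Bochner_Integration.integral_cong refl)
      fix z
      have "g (z, \<omega>) * G n (z, \<omega>) = (\<Sum>i<l. (tilt a D \<omega> * X i \<omega>) * indicator (D \<inter> B i) z)" for \<omega>
        unfolding g_def G_def case_prod_unfold simple_process_nth X_def B_def l_def sum_distrib_left
        by (intro sum.cong refl) (simp only: fst_conv snd_conv prod.collapse indicator_inter_arith mult_ac)
      moreover have "(LINT \<omega>|M. (\<Sum>i<l. (tilt a D \<omega> * X i \<omega>) * indicator (D \<inter> B i) z)) =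
         (\<Sum>i<l. expectation (\<lambda>\<omega>. tilt a D \<omega> * X i \<omega>) * indicator (D \<inter> B i) z)"
        using IX by (subst Bochner_Integration.integral_sum) auto
      ultimately show "(LINT \<omega>|M. g (z, \<omega>) * G n (z, \<omega>)) =
         (\<Sum>i<l. expectation (\<lambda>\<omega>. tilt a D \<omega> * X i \<omega>) * indicator (D \<inter> B i) z)" by simp
    qed
    also have "\<dots> = (\<Sum>i<l. expectation (\<lambda>\<omega>. tilt a D \<omega> * X i \<omega>) * measure spacetime (D \<inter> B i))"
    proof -
      have "has_bochner_integral spacetime (\<lambda>z. \<Sum>i<l. expectation (\<lambda>\<omega>. tilt a D \<omega> * X i \<omega>) * indicator (D \<inter> B i) z)
        (\<Sum>i<l. expectation (\<lambda>\<omega>. tilt a D \<omega> * X i \<omega>) * measure spacetime (D \<inter> B i))"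
      proof (intro has_bochner_integral_sum has_bochner_integral_mult_right)
        fix i assume "i \<in> {..<l}"
        then have "D \<inter> B i \<in> finite_spacetime_sets"
          using elementary_process_basic(2)[OF el] D by (auto simp: B_def intro!: finite_spacetime_sets_Int)
        then show "has_bochner_integral spacetime (indicator (D \<inter> B i)) (measure spacetime (D \<inter> B i))"
          by (auto simp: has_bochner_integral_iff finite_spacetime_sets_def)
      qed
      then show ?thesis by (simp add: has_bochner_integral_iff)
    qed
    finally show ?thesis unfolding E by (simp add: sum_distrib_left mult_ac)
  qed
  then have "(\<lambda>n. - a * (LINT z|?N. g z * G n z)) \<longlonglongrightarrow> expectation (\<lambda>\<omega>. tilt a D \<omega> * J \<omega>)" using limJ by simp
  moreover have "(\<lambda>n. - a * (LINT z|?N. g z * G n z)) \<longlonglongrightarrow> - a * (LINT z|?N. g z * F z)"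
    by (intro tendsto_mult_left lim)
  ultimately show "expectation (\<lambda>\<omega>. tilt a D \<omega> * J \<omega>) =
      - a * (LINT z|spacetime. indicator D z * expectation (\<lambda>\<omega>. tilt a D \<omega> * \<Phi> (fst z) (snd z) \<omega>))"
    unfolding gF[symmetric] by (rule LIMSEQ_unique)
qed

end

section \<open>The heat kernel\<close>

lemma borel_measurable_fst_snd_real[measurable]:
  "fst \<in> borel_measurable (borel :: (real \<times> real) measure)"
  "snd \<in> borel_measurable (borel :: (real \<times> real) measure)"
  by (simp_all add: borel_prod[symmetric])

lemma borel_measurable_cosh_real[measurable]:
  assumes [measurable]: "f \<in> borel_measurable N"
  shows "(\<lambda>x. cosh (f x :: real)) \<in> borel_measurable N"
  unfolding cosh_field_def by measurable

lemma heat_kernel_measurable[measurable]: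
  assumes [measurable]: "f \<in> borel_measurable N" "g \<in> borel_measurable N"
  shows "(\<lambda>z. heat_kernel (f z) (g z)) \<in> borel_measurable N"
  unfolding heat_kernel_def normal_density_def by measurable

lemma heat_kernel_nonneg[simp]: "0 \<le> heat_kernel t x"
  by (simp add: heat_kernel_def)

lemma nn_integral_reflect:
  fixes f :: "real \<Rightarrow> ennreal"
  assumes "f \<in> borel_measurable borel"
  shows "(\<integral>\<^sup>+y. f y \<partial>lborel) = (\<integral>\<^sup>+y. f (x - y) \<partial>lborel)"
  using nn_integral_real_affine[OF assms, of "-1" x] by simp

lemma heat_kernel_nn_integral:
  assumes "t > 0"
  shows "(\<integral>\<^sup>+y. ennreal (heat_kernel t (x - y)) \<partial>lborel) = 1"
proof -
  have "(\<integral>\<^sup>+y. ennreal (heat_kernel t (x - y)) \<partial>lborel) = (\<integral>\<^sup>+y. ennreal (heat_kernel t y) \<partial>lborel)"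
    by (rule nn_integral_reflect[symmetric]) measurable
  also have "\<dots> = 1"
    using assms by (subst nn_integral_eq_integral) (auto simp: heat_kernel_def[abs_def])
  finally show ?thesis .
qed

text \<open>\<open>cosh\<close> is an eigenfunction of half the second derivative with eigenvalue
  1/2, so the heat flow multiplies it by \<open>exp (t / 2)\<close>. It will serve as a weight
  growing exponentially in both directions from \<open>c\<close>.\<close>

lemma heat_kernel_cosh_nn_integral:
  assumes "t > 0"
  shows "(\<integral>\<^sup>+y. ennreal (heat_kernel t (x - y) * cosh (y - c)) \<partial>lborel) = ennreal (exp (t / 2) * cosh (x - c))"
proof -
  have s: "sqrt t > 0" using assms by simp
  have tilted: "has_bochner_integral lborel (\<lambda>y. normal_density 0 (sqrt t) y * exp (b * y)) (exp (b\<^sup>2 * t / 2))" for b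
    unfolding normal_density_exp_tilt[OF s] using assms by (auto simp: has_bochner_integral_iff)
  have "has_bochner_integral lborel (\<lambda>y. exp (x - c) / 2 * (normal_density 0 (sqrt t) y * exp (-1 * y))
     + exp (- (x - c)) / 2 * (normal_density 0 (sqrt t) y * exp (1 * y)))
    (exp (x - c) / 2 * exp ((-1)\<^sup>2 * t / 2) + exp (- (x - c)) / 2 * exp (1\<^sup>2 * t / 2))"
    by (intro has_bochner_integral_add has_bochner_integral_mult_right tilted)
  also have "(\<lambda>y. exp (x - c) / 2 * (normal_density 0 (sqrt t) y * exp (-1 * y))
     + exp (- (x - c)) / 2 * (normal_density 0 (sqrt t) y * exp (1 * y))) = (\<lambda>y. heat_kernel t y * cosh (x - y - c))"
  proof
    fix y
    have "exp (x - y - c) = exp (x - c) * exp (- y)" "exp (- (x - y - c)) = exp (- (x - c)) * exp y"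
      by (simp_all add: exp_add[symmetric])
    then show "exp (x - c) / 2 * (normal_density 0 (sqrt t) y * exp (-1 * y))
     + exp (- (x - c)) / 2 * (normal_density 0 (sqrt t) y * exp (1 * y)) = heat_kernel t y * cosh (x - y - c)"
      by (simp add: heat_kernel_def cosh_field_def field_simps)
  qed
  also have "exp (x - c) / 2 * exp ((-1)\<^sup>2 * t / 2) + exp (- (x - c)) / 2 * exp (1\<^sup>2 * t / 2) = exp (t / 2) * cosh (x - c)"
    by (simp add: cosh_field_def field_simps)
  finally have *: "has_bochner_integral lborel (\<lambda>y. heat_kernel t y * cosh (x - y - c)) (exp (t / 2) * cosh (x - c))" .
  have "(\<integral>\<^sup>+y. ennreal (heat_kernel t (x - y) * cosh (y - c)) \<partial>lborel) = (\<integral>\<^sup>+y. ennreal (heat_kernel t y * cosh (x - y - c)) \<partial>lborel)"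
    by (subst nn_integral_reflect[of _ x]) auto
  also have "\<dots> = ennreal (exp (t / 2) * cosh (x - c))"
    using * by (subst nn_integral_eq_integral) (auto simp: has_bochner_integral_iff)
  finally show ?thesis .
qed

lemma heat_kernel_semigroup:
  assumes "s > 0" "r > 0"
  shows "(\<integral>\<^sup>+z. ennreal (heat_kernel s (y - z) * heat_kernel r (z - w)) \<partial>lborel) = ennreal (heat_kernel (s + r) (y - w))"
proof -
  have "(\<integral>\<^sup>+z. ennreal (heat_kernel s (y - z) * heat_kernel r (z - w)) \<partial>lborel) =
      (\<integral>\<^sup>+z. ennreal (heat_kernel s ((y - w) - z) * heat_kernel r z) \<partial>lborel)"
    by (subst nn_integral_real_affine[of _ 1 w]) (auto simp: algebra_simps)
  also have "\<dots> = ennreal (heat_kernel (s + r) (y - w))"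
    using fun_cong[OF conv_normal_density_zero_mean[of "sqrt s" "sqrt r"], of "y - w"] assms
    by (simp add: heat_kernel_def)
  finally show ?thesis .
qed

section \<open>Heat flow of bounded data and space-time potentials\<close>

definition heat_flow :: "(real \<Rightarrow> real) \<Rightarrow> real \<Rightarrow> real \<Rightarrow> real"
  where "heat_flow f t x = (LINT y|lborel. heat_kernel t (x - y) * f y)"

lemma heat_flow_nn_integral:
  assumes [measurable]: "f \<in> borel_measurable borel" and f: "\<And>y. 0 \<le> f y" "\<And>y. f y \<le> C" and t: "t > 0"
  shows "ennreal (heat_flow f t x) = (\<integral>\<^sup>+y. ennreal (heat_kernel t (x - y) * f y) \<partial>lborel)"
    and "0 \<le> heat_flow f t x" "heat_flow f t x \<le> C"
proof -
  have C: "C \<ge> 0" using f[of 0] by linarith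
  have "(\<integral>\<^sup>+y. ennreal (heat_kernel t (x - y) * f y) \<partial>lborel) \<le> (\<integral>\<^sup>+y. ennreal C * ennreal (heat_kernel t (x - y)) \<partial>lborel)"
    using f C by (intro nn_integral_mono) (auto simp: ennreal_mult[symmetric] mult.commute intro!: ennreal_leI mult_right_mono)
  also have "\<dots> = ennreal C" using t by (simp add: nn_integral_cmult heat_kernel_nn_integral)
  finally have le: "(\<integral>\<^sup>+y. ennreal (heat_kernel t (x - y) * f y) \<partial>lborel) \<le> ennreal C" .
  then have "integrable lborel (\<lambda>y. heat_kernel t (x - y) * f y)"
    using f by (auto simp: integrable_iff_bounded intro: le_less_trans)
  then show eq: "ennreal (heat_flow f t x) = (\<integral>\<^sup>+y. ennreal (heat_kernel t (x - y) * f y) \<partial>lborel)"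
    unfolding heat_flow_def using f by (subst nn_integral_eq_integral) auto
  show "0 \<le> heat_flow f t x" unfolding heat_flow_def using f by (intro integral_nonneg_AE) auto
  show "heat_flow f t x \<le> C" using le C unfolding eq[symmetric] by simp
qed

lemma heat_flow_measurable[measurable]:
  assumes [measurable]: "f \<in> borel_measurable borel" "g \<in> borel_measurable N" "h \<in> borel_measurable N"
  shows "(\<lambda>z. heat_flow f (g z) (h z)) \<in> borel_measurable N"
  unfolding heat_flow_def by measurable

lemma nn_integral_spacetime:
  assumes [measurable]: "f \<in> borel_measurable borel"
  shows "(\<integral>\<^sup>+z. f z \<partial>spacetime) = (\<integral>\<^sup>+r. indicator {0<..} r * (\<integral>\<^sup>+y. f (r, y) \<partial>lborel) \<partial>lborel)"
proof -
  have S: "{0<..} \<times> UNIV \<in> sets (borel :: (real \<times> real) measure)" by (auto simp: borel_Times)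
  have "(\<integral>\<^sup>+z. f z \<partial>spacetime) = (\<integral>\<^sup>+z. f z * indicator ({0<..} \<times> UNIV) z \<partial>lborel)"
    unfolding spacetime_def using S by (subst nn_integral_restrict_space) auto
  also have "\<dots> = (\<integral>\<^sup>+z. f z * indicator ({0<..} \<times> UNIV) z \<partial>(lborel \<Otimes>\<^sub>M lborel))"
    by (simp add: lborel_prod)
  also have "\<dots> = (\<integral>\<^sup>+r. \<integral>\<^sup>+y. f (r, y) * indicator ({0<..} \<times> UNIV) (r, y) \<partial>lborel \<partial>lborel)"
    using S by (subst lborel.nn_integral_fst[symmetric]) (auto simp: lborel_prod intro!: borel_measurable_times_ennreal)
  also have "\<dots> = (\<integral>\<^sup>+r. indicator {0<..} r * (\<integral>\<^sup>+y. f (r, y) \<partial>lborel) \<partial>lborel)"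
    by (intro nn_integral_cong) (auto split: split_indicator)
  finally show ?thesis .
qed

text \<open>The kernel of the mild formulation as a function of the past point alone. Extension by 0
  turns integrals over times before \<open>t\<close> into integrals over all of
  \<open>spacetime\<close>.\<close>

definition past_kernel :: "real \<Rightarrow> real \<Rightarrow> real \<times> real \<Rightarrow> real"
  where "past_kernel t x z = (if fst z < t then heat_kernel (t - fst z) (x - snd z) else 0)"

lemma past_kernel_nonneg[simp]: "0 \<le> past_kernel t x z"
  by (simp add: past_kernel_def)

lemma past_kernel_measurable[measurable]: "past_kernel t x \<in> borel_measurable borel"
  unfolding past_kernel_def[abs_def] by measurable

lemma measurable_spacetime: "f \<in> borel_measurable borel \<Longrightarrow> f \<in> borel_measurable spacetime"
  unfolding spacetime_def by (intro measurable_restrict_space1) simp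

lemma nn_integral_exp_interval:
  fixes c s :: real
  assumes "c \<noteq> 0" "s \<ge> 0"
  shows "(\<integral>\<^sup>+r. indicator {0<..<s} r * ennreal (exp (c * r)) \<partial>lborel) = ennreal ((exp (c * s) - 1) / c)"
proof -
  have "(\<integral>\<^sup>+r. indicator {0<..<s} r * ennreal (exp (c * r)) \<partial>lborel) = (\<integral>\<^sup>+r. ennreal (exp (c * r)) * indicator {0..s} r \<partial>lborel)"
  proof (rule nn_integral_cong_AE)
    have "AE r in lborel. r \<noteq> 0 \<and> r \<noteq> s"
      using AE_lborel_singleton[of 0] AE_lborel_singleton[of s] by eventually_elim auto
    then show "AE r in lborel. indicator {0<..<s} r * ennreal (exp (c * r)) = ennreal (exp (c * r)) * indicator {0..s} r"
      by eventually_elim (auto split: split_indicator)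
  qed
  also have "\<dots> = ennreal (exp (c * s) / c - exp (c * 0) / c)"
    by (rule nn_integral_FTC_Icc) (use assms in \<open>auto intro!: derivative_eq_intros\<close>)
  finally show ?thesis by (simp add: diff_divide_distrib)
qed

text \<open>Integrating in space leaves
  \<open>exp (s / 2) * cosh (y - c) * exp ((\<kappa> - 1 / 2) * r)\<close> at time \<open>r\<close>;
  integrating in time then gives the factor \<open>1 / (\<kappa> - 1 / 2)\<close>. A large
  \<open>\<kappa>\<close> thus makes the heat potential as small as desired in the weighted sup
  norm.\<close>

lemma past_kernel_cosh:
  assumes s: "s > 0" and \<kappa>: "\<kappa> > 1 / 2"
  shows "(\<integral>\<^sup>+z. ennreal (past_kernel s y z * (exp (\<kappa> * fst z) * cosh (snd z - c))) \<partial>spacetime)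
    \<le> ennreal (exp (\<kappa> * s) * cosh (y - c) / (\<kappa> - 1 / 2))"
proof -
  have "(\<integral>\<^sup>+z. ennreal (past_kernel s y z * (exp (\<kappa> * fst z) * cosh (snd z - c))) \<partial>spacetime)
    = (\<integral>\<^sup>+r. indicator {0<..} r * (\<integral>\<^sup>+v. ennreal (past_kernel s y (r, v) * (exp (\<kappa> * r) * cosh (v - c))) \<partial>lborel) \<partial>lborel)"
    by (subst nn_integral_spacetime) auto
  also have "\<dots> = (\<integral>\<^sup>+r. ennreal (exp (s / 2) * cosh (y - c)) * (indicator {0<..<s} r * ennreal (exp ((\<kappa> - 1 / 2) * r))) \<partial>lborel)"
  proof (intro nn_integral_cong)
    fix r :: real
    have "(\<integral>\<^sup>+v. ennreal (past_kernel s y (r, v) * (exp (\<kappa> * r) * cosh (v - c))) \<partial>lborel) =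
        ennreal (exp (\<kappa> * r)) * ennreal (exp ((s - r) / 2) * cosh (y - c))" if "r < s"
    proof -
      have "(\<integral>\<^sup>+v. ennreal (past_kernel s y (r, v) * (exp (\<kappa> * r) * cosh (v - c))) \<partial>lborel) =
        (\<integral>\<^sup>+v. ennreal (exp (\<kappa> * r)) * ennreal (heat_kernel (s - r) (y - v) * cosh (v - c)) \<partial>lborel)"
        using that by (intro nn_integral_cong) (simp add: past_kernel_def ennreal_mult[symmetric] mult_ac)
      then show ?thesis
        using that by (simp add: nn_integral_cmult heat_kernel_cosh_nn_integral)
    qed
    moreover have "exp (\<kappa> * r) * (exp ((s - r) / 2) * cosh (y - c)) = exp (s / 2) * cosh (y - c) * exp ((\<kappa> - 1 / 2) * r)"
    proof -
      have "\<kappa> * r + (s - r) / 2 = s / 2 + (\<kappa> - 1 / 2) * r" by (simp add: field_simps)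
      then have "exp (\<kappa> * r) * exp ((s - r) / 2) = exp (s / 2) * exp ((\<kappa> - 1 / 2) * r)"
        by (simp only: exp_add[symmetric])
      then show ?thesis by (simp add: mult.assoc[symmetric])
    qed
    ultimately show "indicator {0<..} r * (\<integral>\<^sup>+v. ennreal (past_kernel s y (r, v) * (exp (\<kappa> * r) * cosh (v - c))) \<partial>lborel) =
       ennreal (exp (s / 2) * cosh (y - c)) * (indicator {0<..<s} r * ennreal (exp ((\<kappa> - 1 / 2) * r)))"
      by (cases "r < s") (auto simp: past_kernel_def ennreal_mult[symmetric] split: split_indicator)
  qed
  also have "\<dots> = ennreal (exp (s / 2) * cosh (y - c)) * ennreal ((exp ((\<kappa> - 1 / 2) * s) - 1) / (\<kappa> - 1 / 2))"
    using s \<kappa> by (subst nn_integral_cmult) (auto simp: nn_integral_exp_interval)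
  also have "\<dots> \<le> ennreal (exp (s / 2) * cosh (y - c)) * ennreal (exp ((\<kappa> - 1 / 2) * s) / (\<kappa> - 1 / 2))"
    using \<kappa> by (intro mult_left_mono ennreal_leI divide_right_mono) auto
  also have "\<dots> = ennreal (exp (\<kappa> * s) * cosh (y - c) / (\<kappa> - 1 / 2))"
  proof -
    have "exp (s / 2) * exp ((\<kappa> - 1 / 2) * s) = exp (\<kappa> * s)"
      by (simp add: exp_add[symmetric] field_simps)
    then show ?thesis using \<kappa> by (simp add: ennreal_mult[symmetric] mult_ac)
  qed
  finally show ?thesis .
qed

text \<open>Duhamel's formula for killing at rate \<open>a\<close> on the whole line. By the
  semigroup property, the flow up to time \<open>r\<close> followed by the kernel for
  \<open>s - r\<close> gives \<open>heat_flow f s y\<close> for every \<open>r\<close>, so only the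
  integral of \<open>exp (- a * r)\<close> over the times before \<open>s\<close> remains.\<close>

lemma past_kernel_heat_flow:
  assumes [measurable]: "f \<in> borel_measurable borel" and f: "\<And>y. 0 \<le> f y" "\<And>y. f y \<le> C"
    and s: "s > 0" and a: "a > 0"
  shows "has_bochner_integral spacetime (\<lambda>z. past_kernel s y z * (exp (- a * fst z) * heat_flow f (fst z) (snd z)))
    (heat_flow f s y * (1 - exp (- a * s)) / a)"
proof -
  note H = heat_flow_nn_integral[OF assms(1) f]
  have "(\<integral>\<^sup>+z. ennreal (past_kernel s y z * (exp (- a * fst z) * heat_flow f (fst z) (snd z))) \<partial>spacetime)
    = (\<integral>\<^sup>+r. indicator {0<..} r * (\<integral>\<^sup>+v. ennreal (past_kernel s y (r, v) * (exp (- a * r) * heat_flow f r v)) \<partial>lborel) \<partial>lborel)"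
    by (subst nn_integral_spacetime) auto
  also have "\<dots> = (\<integral>\<^sup>+r. ennreal (heat_flow f s y) * (indicator {0<..<s} r * ennreal (exp (- a * r))) \<partial>lborel)"
  proof (intro nn_integral_cong)
    fix r :: real
    have "(\<integral>\<^sup>+v. ennreal (past_kernel s y (r, v) * (exp (- a * r) * heat_flow f r v)) \<partial>lborel) =
        ennreal (exp (- a * r)) * ennreal (heat_flow f s y)" if r: "0 < r" "r < s"
    proof -
      have "(\<integral>\<^sup>+v. ennreal (past_kernel s y (r, v) * (exp (- a * r) * heat_flow f r v)) \<partial>lborel) =
        (\<integral>\<^sup>+v. ennreal (exp (- a * r)) * (\<integral>\<^sup>+w. ennreal (heat_kernel (s - r) (y - v) * heat_kernel r (v - w)) * ennreal (f w) \<partial>lborel) \<partial>lborel)"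
      proof (intro nn_integral_cong)
        fix v
        have "ennreal (past_kernel s y (r, v) * (exp (- a * r) * heat_flow f r v)) =
          ennreal (exp (- a * r)) * (ennreal (heat_kernel (s - r) (y - v)) * ennreal (heat_flow f r v))"
          using r H(2) by (simp add: past_kernel_def ennreal_mult[symmetric] mult_ac)
        also have "\<dots> = ennreal (exp (- a * r)) * (\<integral>\<^sup>+w. ennreal (heat_kernel (s - r) (y - v)) * ennreal (heat_kernel r (v - w) * f w) \<partial>lborel)"
          using r by (simp add: H(1) nn_integral_cmult)
        finally show "ennreal (past_kernel s y (r, v) * (exp (- a * r) * heat_flow f r v)) = 
          ennreal (exp (- a * r)) * (\<integral>\<^sup>+w. ennreal (heat_kernel (s - r) (y - v) * heat_kernel r (v - w)) * ennreal (f w) \<partial>lborel)"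
          using f by (simp add: ennreal_mult mult_ac)
      qed
      also have "\<dots> = ennreal (exp (- a * r)) * (\<integral>\<^sup>+v. \<integral>\<^sup>+w. ennreal (heat_kernel (s - r) (y - v) * heat_kernel r (v - w)) * ennreal (f w) \<partial>lborel \<partial>lborel)"
        by (subst nn_integral_cmult) auto
      also have "(\<integral>\<^sup>+v. \<integral>\<^sup>+w. ennreal (heat_kernel (s - r) (y - v) * heat_kernel r (v - w)) * ennreal (f w) \<partial>lborel \<partial>lborel) =
        (\<integral>\<^sup>+w. \<integral>\<^sup>+v. ennreal (heat_kernel (s - r) (y - v) * heat_kernel r (v - w)) * ennreal (f w) \<partial>lborel \<partial>lborel)"
        by (rule lborel_pair.Fubini'[symmetric]) measurable
      also have "\<dots> = (\<integral>\<^sup>+w. ennreal (heat_kernel s (y - w) * f w) \<partial>lborel)"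
      proof (intro nn_integral_cong)
        fix w
        have "(\<integral>\<^sup>+v. ennreal (heat_kernel (s - r) (y - v) * heat_kernel r (v - w)) * ennreal (f w) \<partial>lborel) =
          (\<integral>\<^sup>+v. ennreal (heat_kernel (s - r) (y - v) * heat_kernel r (v - w)) \<partial>lborel) * ennreal (f w)"
          by (rule nn_integral_multc) measurable
        also have "\<dots> = ennreal (heat_kernel s (y - w) * f w)"
        proof -
          have "(\<integral>\<^sup>+v. ennreal (heat_kernel (s - r) (y - v) * heat_kernel r (v - w)) \<partial>lborel) = ennreal (heat_kernel s (y - w))"
            using heat_kernel_semigroup[of "s - r" r y w] r by simp
          then show ?thesis by (simp only: ennreal_mult[OF heat_kernel_nonneg f(1)])
        qed
        finally show "(\<integral>\<^sup>+v. ennreal (heat_kernel (s - r) (y - v) * heat_kernel r (v - w)) * ennreal (f w) \<partial>lborel) =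
          ennreal (heat_kernel s (y - w) * f w)" .
      qed
      also have "\<dots> = ennreal (heat_flow f s y)" using H(1)[OF s] by simp
      finally show ?thesis .
    qed
    then show "indicator {0<..} r * (\<integral>\<^sup>+v. ennreal (past_kernel s y (r, v) * (exp (- a * r) * heat_flow f r v)) \<partial>lborel) =
      ennreal (heat_flow f s y) * (indicator {0<..<s} r * ennreal (exp (- a * r)))"
      by (cases "r < s") (auto simp: past_kernel_def mult_ac split: split_indicator)
  qed
  also have "\<dots> = ennreal (heat_flow f s y) * ennreal ((exp (- a * s) - 1) / (- a))"
    using s a by (subst nn_integral_cmult) (auto simp: nn_integral_exp_interval[of "- a", simplified])
  also have "\<dots> = ennreal (heat_flow f s y * (1 - exp (- a * s)) / a)"
  proof -
    have *: "(exp (- a * s) - 1) / (- a) = (1 - exp (- a * s)) / a"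
      using a by (simp add: field_simps)
    have "exp (- a * s) \<le> 1" using a s by simp
    then show ?thesis
      using H(2)[OF s, of y] a unfolding * by (subst ennreal_mult[symmetric]) auto
  qed
  finally have nn: "(\<integral>\<^sup>+z. ennreal (past_kernel s y z * (exp (- a * fst z) * heat_flow f (fst z) (snd z))) \<partial>spacetime)
    = ennreal (heat_flow f s y * (1 - exp (- a * s)) / a)" .
  have pos: "0 \<le> past_kernel s y z * (exp (- a * fst z) * heat_flow f (fst z) (snd z))" if "z \<in> space spacetime" for z
    using that H(2)[of "fst z" "snd z"] by (auto simp: space_spacetime)
  show ?thesis
    by (rule has_bochner_integral_nn_integral)
      (use pos nn a s H(2)[OF s] in \<open>auto intro!: measurable_spacetime AE_I2\<close>)
qed

text \<open>The weight \<open>exp (\<kappa> r) cosh (v - x)\<close> dominates its own image under the heat potential; this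
  turns the perturbation outside the window of width \<open>L\<close> into the factor \<open>exp (- L)\<close>.\<close>

lemma damped_heat_equation_bound:
  fixes m :: "real \<times> real \<Rightarrow> real"
  assumes [measurable]: "f \<in> borel_measurable borel" and f: "\<And>y. 0 \<le> f y" "\<And>y. f y \<le> C"
    and a: "a > 0" and T: "T > 0" and L: "L \<ge> 0"
    and D: "D = {0<..T} \<times> {x - L..x + L}"
    and bounded: "\<And>s y. 0 < s \<Longrightarrow> s \<le> T \<Longrightarrow> \<bar>m (s, y)\<bar> \<le> K"
    and int: "\<And>s y. 0 < s \<Longrightarrow> s \<le> T \<Longrightarrow> integrable spacetime (\<lambda>z. indicator D z * (past_kernel s y z * m z))"
    and eq: "\<And>s y. 0 < s \<Longrightarrow> s \<le> T \<Longrightarrow>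
      m (s, y) = heat_flow f s y - a * (LINT z|spacetime. indicator D z * (past_kernel s y z * m z))"
  shows "\<bar>m (T, x)\<bar> \<le> C * exp (- a * T) + 2 * C * exp ((1 / 2 + 2 * a) * T - L)"
proof -
  note H = heat_flow_nn_integral[OF assms(1) f]
  have C: "C \<ge> 0" using f[of 0] by linarith
  \<comment> \<open>The excess \<open>2 * a\<close> over 1/2 makes the heat potential of
    \<open>\<phi>\<close> at most \<open>\<phi> / (2 * a)\<close>; against the prefactor
    \<open>a\<close> of the equation this is a contraction by 1/2.\<close>
  define \<kappa> where "\<kappa> = 1 / 2 + 2 * a"
  \<comment> \<open>The comparison function: the solution with killing everywhere instead of on
    \<open>D\<close>.\<close>
  define q where "q z = exp (- a * fst z) * heat_flow f (fst z) (snd z)" for z :: "real \<times> real"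
  define \<phi> where "\<phi> z = exp (\<kappa> * fst z) * cosh (snd z - x)" for z :: "real \<times> real"
  have \<phi>1: "1 \<le> \<phi> z" if "fst z \<ge> 0" for z
    using that a cosh_real_ge_1[of "snd z - x"] mult_mono[of 1 "exp (\<kappa> * fst z)" 1 "cosh (snd z - x)"]
    by (simp add: \<phi>_def \<kappa>_def)
  have \<phi>0: "0 \<le> \<phi> z" for z by (simp add: \<phi>_def)
  have [measurable]: "\<phi> \<in> borel_measurable borel" "q \<in> borel_measurable borel"
    unfolding \<phi>_def[abs_def] q_def[abs_def] by measurable
  have q: "0 \<le> q (r, z)" "q (r, z) \<le> C" if "r > 0" for r z
  proof -
    show "0 \<le> q (r, z)" using H(2)[OF that] by (simp add: q_def)
    have "exp (- a * r) * heat_flow f r z \<le> 1 * C"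
      using H(2,3)[OF that] a that by (intro mult_mono) auto
    then show "q (r, z) \<le> C" by (simp add: q_def)
  qed
  have qeq: "q (s, y) = heat_flow f s y - a * (LINT z|spacetime. past_kernel s y z * q z)"
    and qint: "integrable spacetime (\<lambda>z. past_kernel s y z * q z)" if "s > 0" for s y
    using past_kernel_heat_flow[OF assms(1) f that a, of y] a
    by (auto simp: has_bochner_integral_iff q_def field_simps)
  \<comment> \<open>One pass through the two integral equations halves the constant and adds
    \<open>C * exp (- L)\<close> from outside the window, so the recursion has the fixed point
    \<open>2 * C * exp (- L)\<close>.\<close>
  have improve: "\<forall>s y. 0 < s \<and> s \<le> T \<longrightarrow> \<bar>m (s, y) - q (s, y)\<bar> \<le> (N / 2 + C * exp (- L)) * \<phi> (s, y)"
    if N: "\<forall>s y. 0 < s \<and> s \<le> T \<longrightarrow> \<bar>m (s, y) - q (s, y)\<bar> \<le> N * \<phi> (s, y)" and N0: "N \<ge> 0" for N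
  proof (intro allI impI)
    fix s y assume "0 < s \<and> s \<le> T"
    then have s: "0 < s" "s \<le> T" by auto
    define R where "R z = indicator D z * (past_kernel s y z * m z) - past_kernel s y z * q z" for z
    define N' where "N' = N + 2 * C * exp (- L)"
    have N'0: "N' \<ge> 0" using N0 C by (simp add: N'_def)
    have IR: "integrable spacetime R" unfolding R_def[abs_def]
      by (intro Bochner_Integration.integrable_diff int qint s)
    have "m (s, y) - q (s, y) = - a * (LINT z|spacetime. R z)"
      unfolding R_def eq[OF s] qeq[OF s(1)]
      by (subst Bochner_Integration.integral_diff[OF int[OF s] qint[OF s(1)]]) (simp add: algebra_simps)
    then have "\<bar>m (s, y) - q (s, y)\<bar> = a * \<bar>LINT z|spacetime. R z\<bar>" using a by (simp add: abs_mult)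
    moreover have "ennreal \<bar>LINT z|spacetime. R z\<bar> \<le> ennreal (N' * (\<phi> (s, y) / (2 * a)))"
    proof -
      have "ennreal \<bar>LINT z|spacetime. R z\<bar> \<le> (\<integral>\<^sup>+z. ennreal \<bar>R z\<bar> \<partial>spacetime)"
        using integral_norm_bound_ennreal[OF IR] by simp
      also have "\<dots> \<le> (\<integral>\<^sup>+z. ennreal N' * ennreal (past_kernel s y z * \<phi> z) \<partial>spacetime)"
      proof (rule nn_integral_mono)
        fix z assume "z \<in> space spacetime"
        then obtain r v where z: "z = (r, v)" and r: "r > 0" by (auto simp: space_spacetime)
        have "\<bar>R z\<bar> \<le> past_kernel s y z * (N' * \<phi> z)"
        proof (cases "r < s")
          case False
          then show ?thesis by (simp add: R_def z past_kernel_def)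
        next
          case True
          show ?thesis
          proof (cases "v \<in> {x - L..x + L}")
            case True
            have "\<bar>R z\<bar> = past_kernel s y z * \<bar>m z - q z\<bar>"
              using True \<open>r < s\<close> s r by (simp add: R_def D z right_diff_distrib[symmetric] abs_mult)
            also have "\<dots> \<le> past_kernel s y z * (N * \<phi> z)"
              using N r \<open>r < s\<close> s by (intro mult_left_mono) (auto simp: z)
            also have "\<dots> \<le> past_kernel s y z * (N' * \<phi> z)"
              using C \<phi>0 by (intro mult_left_mono mult_right_mono) (auto simp: N'_def)
            finally show ?thesis .
          next
            case False
            \<comment> \<open>Outside the window \<open>R\<close> consists of the \<open>q\<close>
              term alone. There \<open>\<phi>\<close> is at least \<open>exp L / 2\<close>, so the
              bounded function \<open>q\<close> is at most
              \<open>2 * C * exp (- L) * \<phi>\<close>.\<close>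
            then have "L \<le> \<bar>v - x\<bar>" by auto
            then have "exp L \<le> 2 * cosh (v - x)"
              by (cases "v \<ge> x") (auto simp: cosh_field_def intro: add_increasing add_increasing2)
            then have "1 \<le> 2 * exp (- L) * cosh (v - x)"
              by (simp add: exp_minus field_simps)
            also have "\<dots> \<le> 2 * exp (- L) * \<phi> z"
              using r a by (auto simp: \<phi>_def z \<kappa>_def)
            finally have "C * 1 \<le> C * (2 * exp (- L) * \<phi> z)" using C by (intro mult_left_mono)
            also have "\<dots> \<le> N' * \<phi> z"
              using N0 \<phi>0[of z] by (simp add: N'_def distrib_right)
            finally have *: "q z \<le> N' * \<phi> z" using q[OF r, of v] by (simp add: z)
            have "\<bar>R z\<bar> = past_kernel s y z * q z"
              using False q(1)[OF r, of v] by (simp add: R_def D z abs_mult)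
            also have "\<dots> \<le> past_kernel s y z * (N' * \<phi> z)" using * by (intro mult_left_mono) auto
            finally show ?thesis .
          qed
        qed
        then show "ennreal \<bar>R z\<bar> \<le> ennreal N' * ennreal (past_kernel s y z * \<phi> z)"
          using N'0 \<phi>0 by (subst ennreal_mult[symmetric]) (auto simp: mult_ac intro!: ennreal_leI)
      qed
      also have "\<dots> = ennreal N' * (\<integral>\<^sup>+z. ennreal (past_kernel s y z * \<phi> z) \<partial>spacetime)"
        by (intro nn_integral_cmult measurable_spacetime) measurable
      also have "\<dots> \<le> ennreal N' * ennreal (\<phi> (s, y) / (2 * a))"
        using past_kernel_cosh[OF s(1), of \<kappa> y x] a
        by (intro mult_left_mono) (auto simp: \<phi>_def \<kappa>_def)
      also have "\<dots> = ennreal (N' * (\<phi> (s, y) / (2 * a)))"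
        using N'0 \<phi>0 a by (subst ennreal_mult[symmetric]) auto
      finally show ?thesis .
    qed
    then have "\<bar>LINT z|spacetime. R z\<bar> \<le> N' * (\<phi> (s, y) / (2 * a))"
      using N'0 \<phi>0 a by (subst (asm) ennreal_le_iff) auto
    ultimately have "\<bar>m (s, y) - q (s, y)\<bar> \<le> a * (N' * (\<phi> (s, y) / (2 * a)))"
      using a by (simp only:) (intro mult_left_mono; simp)
    also have "\<dots> = (N / 2 + C * exp (- L)) * \<phi> (s, y)" using a by (simp add: N'_def field_simps)
    finally show "\<bar>m (s, y) - q (s, y)\<bar> \<le> (N / 2 + C * exp (- L)) * \<phi> (s, y)" .
  qed
  have K0: "K \<ge> 0" using bounded[OF T order_refl, of x] by linarith
  \<comment> \<open>The crude initial constant \<open>K + C\<close> is halved at each step and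
    disappears in the limit, so \<open>K\<close> does not enter the conclusion.\<close>
  have iter: "\<forall>s y. 0 < s \<and> s \<le> T \<longrightarrow> \<bar>m (s, y) - q (s, y)\<bar> \<le> (2 * C * exp (- L) + (K + C) / 2 ^ n) * \<phi> (s, y)" for n
  proof (induction n)
    case 0
    show ?case
    proof (intro allI impI)
      fix s y assume s: "0 < s \<and> s \<le> T"
      have "\<bar>m (s, y) - q (s, y)\<bar> \<le> (K + C) * 1"
        using bounded[of s y] q[of s y] s by auto
      also have "\<dots> \<le> (2 * C * exp (- L) + (K + C) / 2 ^ 0) * \<phi> (s, y)"
        using K0 C \<phi>1[of "(s, y)"] s by (intro mult_mono) auto
      finally show "\<bar>m (s, y) - q (s, y)\<bar> \<le> (2 * C * exp (- L) + (K + C) / 2 ^ 0) * \<phi> (s, y)" .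
    qed
  next
    case (Suc n)
    have "(2 * C * exp (- L) + (K + C) / 2 ^ n) / 2 + C * exp (- L) = 2 * C * exp (- L) + (K + C) / 2 ^ Suc n"
      by (simp add: field_simps)
    moreover have "0 \<le> 2 * C * exp (- L) + (K + C) / 2 ^ n" using K0 C by simp
    ultimately show ?case using improve[OF Suc.IH] by metis
  qed
  have "(\<lambda>n. (2 * C * exp (- L) + (K + C) * (1 / 2) ^ n) * \<phi> (T, x)) \<longlonglongrightarrow> (2 * C * exp (- L) + (K + C) * 0) * \<phi> (T, x)"
    by (intro tendsto_mult_right tendsto_add tendsto_const tendsto_mult_left LIMSEQ_realpow_zero) auto
  moreover have "\<bar>m (T, x) - q (T, x)\<bar> \<le> (2 * C * exp (- L) + (K + C) * (1 / 2) ^ n) * \<phi> (T, x)" for n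
    using iter[of n] T by (simp add: power_one_over)
  ultimately have "\<bar>m (T, x) - q (T, x)\<bar> \<le> (2 * C * exp (- L) + (K + C) * 0) * \<phi> (T, x)"
    by (rule LIMSEQ_le_const[OF _ exI, rule_format])
  moreover have "\<phi> (T, x) = exp (\<kappa> * T)" by (simp add: \<phi>_def)
  moreover have "\<bar>q (T, x)\<bar> \<le> C * exp (- a * T)"
    using H(2,3)[OF T, of x] by (simp add: q_def mult.commute mult_right_mono)
  moreover have "exp (- L) * exp (\<kappa> * T) = exp (\<kappa> * T - L)" by (simp add: exp_add[symmetric])
  ultimately show ?thesis unfolding \<kappa>_def[symmetric] by (simp add: mult.assoc)
qed

section \<open>Moments and the lower tail of the solution\<close>

text \<open>The substitution \<open>v = 128 * r\<close> produces
  \<open>Gamma (1 / 2) = sqrt pi\<close>. As \<open>128 = 2 * 8\<^sup>2\<close>, the roots cancel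
  and the value is \<open>1 / sqrt (2 * 128) = 1 / 16\<close>.\<close>

lemma nn_integral_exp_over_sqrt:
  "(\<integral>\<^sup>+r. ennreal (indicator {0<..} r * (exp (- 128 * r) / sqrt (2 * pi * r))) \<partial>lborel) = ennreal (1 / 16)"
proof -
  have "(\<integral>\<^sup>+r. ennreal (indicator {0<..} r * (exp (- 128 * r) / sqrt (2 * pi * r))) \<partial>lborel) =
     ennreal (1 / 128) * (\<integral>\<^sup>+v. ennreal (indicator {0<..} (v / 128) * (exp (- v) / sqrt (2 * pi * (v / 128)))) \<partial>lborel)"
    by (subst nn_integral_real_affine[of _ "1 / 128" 0]) auto
  also have "(\<integral>\<^sup>+v. ennreal (indicator {0<..} (v / 128) * (exp (- v) / sqrt (2 * pi * (v / 128)))) \<partial>lborel) =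
      (\<integral>\<^sup>+v. ennreal (8 / sqrt pi) * ennreal (indicator {0..} v * v powr (1 / 2 - 1) / exp v) \<partial>lborel)"
  proof (rule nn_integral_cong)
    fix v :: real
    have root: "sqrt (2 * pi * (v / 128)) = sqrt pi * sqrt v / 8"
    proof -
      have "2 * pi * (v / 128) = pi * v / 8\<^sup>2" by simp
      then show ?thesis by (simp only: real_sqrt_divide real_sqrt_mult real_sqrt_power) simp
    qed
    show "ennreal (indicator {0<..} (v / 128) * (exp (- v) / sqrt (2 * pi * (v / 128)))) =
      ennreal (8 / sqrt pi) * ennreal (indicator {0..} v * v powr (1 / 2 - 1) / exp v)"
    proof (cases "v > 0")
      case True
      have powr: "v powr (1 / 2 - 1) = 1 / sqrt v"
        using True powr_minus_divide[of v "1 / 2"] powr_half_sqrt[of v] by simp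
      show ?thesis
        unfolding root powr using True
        by (simp add: ennreal_mult[symmetric] exp_minus divide_simps)
    next
      case False
      then show ?thesis by (cases "v = 0") auto
    qed
  qed
  also have "\<dots> = ennreal (8 / sqrt pi) * ennreal (Gamma (1 / 2))"
    by (subst nn_integral_cmult) (auto simp: Gamma_conv_nn_integral_real)
  also have "ennreal (1 / 128) * (ennreal (8 / sqrt pi) * ennreal (Gamma (1 / 2))) =
      ennreal (1 / 128 * (8 / sqrt pi * Gamma (1 / 2)))"
  proof -
    have "ennreal x * (ennreal y * ennreal z) = ennreal (x * (y * z))"
      if "x \<ge> 0" "y \<ge> 0" "z \<ge> 0" for x y z using that by (simp add: ennreal_mult)
    from this[of "1 / 128" "8 / sqrt pi" "Gamma (1 / 2)"] show ?thesis
      unfolding Gamma_one_half_real by auto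
  qed
  also have "1 / 128 * (8 / sqrt pi * Gamma (1 / 2)) = (1 / 16 :: real)"
    by (simp add: Gamma_one_half_real)
  finally show ?thesis .
qed

text \<open>The rate \<open>128\<close> makes the resolvent of the squared kernel small enough for the second
  moment equation to be a contraction with factor \<open>1 / 2\<close>.\<close>

lemma past_kernel_square:
  "(\<integral>\<^sup>+z. ennreal ((past_kernel t x z)\<^sup>2 * exp (128 * fst z)) \<partial>spacetime) \<le> ennreal (exp (128 * t) / 16)"
proof -
  have "(\<integral>\<^sup>+z. ennreal ((past_kernel t x z)\<^sup>2 * exp (128 * fst z)) \<partial>spacetime) =
    (\<integral>\<^sup>+r. indicator {0<..} r * (\<integral>\<^sup>+v. ennreal ((past_kernel t x (r, v))\<^sup>2 * exp (128 * r)) \<partial>lborel) \<partial>lborel)"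
    by (subst nn_integral_spacetime) auto
  also have "\<dots> \<le> (\<integral>\<^sup>+r. ennreal (indicator {0<..} (t - r) * (exp (128 * r) / sqrt (2 * pi * (t - r)))) \<partial>lborel)"
  proof (rule nn_integral_mono)
    fix r :: real
    have "(\<integral>\<^sup>+v. ennreal ((past_kernel t x (r, v))\<^sup>2 * exp (128 * r)) \<partial>lborel) \<le>
      ennreal (exp (128 * r) / sqrt (2 * pi * (t - r)))" if r: "r < t"
    proof -
      \<comment> \<open>One factor of the square is bounded by the maximum of the Gaussian density;
        the other still integrates to 1.\<close>
      have "heat_kernel (t - r) w \<le> 1 / sqrt (2 * pi * (t - r))" for w
        using r by (simp add: heat_kernel_def normal_density_def divide_right_mono)
      then have "(heat_kernel (t - r) w)\<^sup>2 \<le> 1 / sqrt (2 * pi * (t - r)) * heat_kernel (t - r) w" for w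
        unfolding power2_eq_square by (intro mult_right_mono) auto
      then have "(heat_kernel (t - r) w)\<^sup>2 * exp (128 * r) \<le> 1 / sqrt (2 * pi * (t - r)) * heat_kernel (t - r) w * exp (128 * r)" for w
        by (intro mult_right_mono) auto
      then have "(\<integral>\<^sup>+v. ennreal ((past_kernel t x (r, v))\<^sup>2 * exp (128 * r)) \<partial>lborel) \<le>
        (\<integral>\<^sup>+v. ennreal (exp (128 * r) / sqrt (2 * pi * (t - r))) * ennreal (heat_kernel (t - r) (x - v)) \<partial>lborel)"
        using r by (intro nn_integral_mono) (auto simp: past_kernel_def ennreal_mult[symmetric] mult_ac intro!: ennreal_leI)
      also have "\<dots> = ennreal (exp (128 * r) / sqrt (2 * pi * (t - r)))"
        using r by (simp add: nn_integral_cmult heat_kernel_nn_integral)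
      finally show ?thesis .
    qed
    then show "indicator {0<..} r * (\<integral>\<^sup>+v. ennreal ((past_kernel t x (r, v))\<^sup>2 * exp (128 * r)) \<partial>lborel) \<le>
      ennreal (indicator {0<..} (t - r) * (exp (128 * r) / sqrt (2 * pi * (t - r))))"
      by (cases "r < t") (auto simp: past_kernel_def split: split_indicator)
  qed
  also have "\<dots> = (\<integral>\<^sup>+r. ennreal (indicator {0<..} r * (exp (128 * (t - r)) / sqrt (2 * pi * r))) \<partial>lborel)"
    by (subst nn_integral_reflect[of _ t]) auto
  also have "\<dots> = (\<integral>\<^sup>+r. ennreal (exp (128 * t)) * ennreal (indicator {0<..} r * (exp (- 128 * r) / sqrt (2 * pi * r))) \<partial>lborel)"
  proof (intro nn_integral_cong)
    fix r :: real
    have "exp (128 * (t - r)) = exp (128 * t) * exp (- 128 * r)" by (simp add: exp_add[symmetric])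
    then show "ennreal (indicator {0<..} r * (exp (128 * (t - r)) / sqrt (2 * pi * r))) =
      ennreal (exp (128 * t)) * ennreal (indicator {0<..} r * (exp (- 128 * r) / sqrt (2 * pi * r)))"
      by (auto simp: ennreal_mult[symmetric] split: split_indicator)
  qed
  also have "\<dots> = ennreal (exp (128 * t)) * ennreal (1 / 16)"
    by (subst nn_integral_cmult) (simp_all only: nn_integral_exp_over_sqrt, measurable)
  also have "\<dots> = ennreal (exp (128 * t) / 16)" by (simp add: ennreal_mult[symmetric])
  finally show ?thesis .
qed

section \<open>Second moments of the solution\<close>

context white_noise
begin

lemma mild_solution_decomposition:
  assumes sol: "she_mild_solution M W u0 u" and t: "t > 0"
  obtains J where "has_walsh_integral M W (\<lambda>s y \<omega>. past_kernel t x (s, y) * u s y \<omega>) J"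
    "AE \<omega> in M. u t x \<omega> = heat_flow u0 t x + J \<omega>"
proof -
  have *: "(\<lambda>s y \<omega>. if s < t then heat_kernel (t - s) (x - y) * u s y \<omega> else 0) =
     (\<lambda>s y \<omega>. past_kernel t x (s, y) * u s y \<omega>)"
    by (auto simp: past_kernel_def fun_eq_iff)
  from sol t obtain J where
    "has_walsh_integral M W (\<lambda>s y \<omega>. if s < t then heat_kernel (t - s) (x - y) * u s y \<omega> else 0) J"
    "AE \<omega> in M. u t x \<omega> = (LINT y|lborel. heat_kernel t (x - y) * u0 y) + J \<omega>"
    unfolding she_mild_solution_def by blast
  then show ?thesis by (intro that) (simp_all add: * heat_flow_def)
qed

lemma mild_solution_measurable:
  "she_mild_solution M W u0 u \<Longrightarrow> t > 0 \<Longrightarrow> u t x \<in> borel_measurable M"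
  unfolding she_mild_solution_def noise_filtration_eq_field by (blast intro: measurable_noise_field)

text \<open>A bound \<open>N * exp (128 * s)\<close> fed into the mild equation returns with
  \<open>N\<close> replaced by \<open>2 * C\<^sup>2 + N / 2\<close>: the squared kernel gives
  \<open>N / 16\<close>, the Walsh estimate multiplies by 4 and the square of the sum by 2. The
  fixed point is \<open>4 * C\<^sup>2\<close>. The moment bound in the definition of a solution
  starts the iteration and is forgotten in the limit.\<close>

lemma mild_solution_second_moment:
  assumes sol: "she_mild_solution M W u0 u"
    and u0: "u0 \<in> borel_measurable borel" "\<And>y. 0 \<le> u0 y" "\<And>y. u0 y \<le> C" and t: "t > 0"
  shows "integrable M (\<lambda>\<omega>. (u t x \<omega>)\<^sup>2)" "expectation (\<lambda>\<omega>. (u t x \<omega>)\<^sup>2) \<le> 4 * C\<^sup>2 * exp (128 * t)"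
proof -
  define V where "V s y = (\<integral>\<^sup>+\<omega>. ennreal ((u s y \<omega>)\<^sup>2) \<partial>M)" for s y
  have improve: "\<forall>s y. 0 < s \<and> s \<le> t \<longrightarrow> V s y \<le> ennreal ((2 * C\<^sup>2 + N / 2) * exp (128 * s))"
    if N: "\<forall>s y. 0 < s \<and> s \<le> t \<longrightarrow> V s y \<le> ennreal (N * exp (128 * s))" and N0: "N \<ge> 0" for N
  proof (intro allI impI)
    fix s y assume "0 < s \<and> s \<le> t"
    then have s: "0 < s" "s \<le> t" by auto
    obtain J where J: "has_walsh_integral M W (\<lambda>r z \<omega>. past_kernel s y (r, z) * u r z \<omega>) J"
      and eq: "AE \<omega> in M. u s y \<omega> = heat_flow u0 s y + J \<omega>"
      using mild_solution_decomposition[OF sol s(1)] .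
    from J have [measurable]: "J \<in> borel_measurable M"
      and m[measurable]: "(\<lambda>((r, z), \<omega>). past_kernel s y (r, z) * u r z \<omega>) \<in> borel_measurable (spacetime \<Otimes>\<^sub>M M)"
      by (auto simp: has_walsh_integral_def)
    have "(\<integral>\<^sup>+\<omega>. ennreal ((J \<omega>)\<^sup>2) \<partial>M) \<le>
      4 * (\<integral>\<^sup>+p. ennreal (((\<lambda>((r, z), \<omega>). past_kernel s y (r, z) * u r z \<omega>) p)\<^sup>2) \<partial>(spacetime \<Otimes>\<^sub>M M))"
      using walsh_second_moment[OF J] by (simp add: case_prod_unfold)
    also have "(\<integral>\<^sup>+p. ennreal (((\<lambda>((r, z), \<omega>). past_kernel s y (r, z) * u r z \<omega>) p)\<^sup>2) \<partial>(spacetime \<Otimes>\<^sub>M M)) =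
      (\<integral>\<^sup>+z. (\<integral>\<^sup>+\<omega>. ennreal ((past_kernel s y z * u (fst z) (snd z) \<omega>)\<^sup>2) \<partial>M) \<partial>spacetime)"
      using m by (subst nn_integral_fst[symmetric]) (auto simp: case_prod_unfold)
    also have "\<dots> \<le> (\<integral>\<^sup>+z. ennreal N * ennreal ((past_kernel s y z)\<^sup>2 * exp (128 * fst z)) \<partial>spacetime)"
    proof (rule nn_integral_mono)
      fix z assume "z \<in> space spacetime"
      then obtain r v where z: "z = (r, v)" and r: "r > 0" by (auto simp: space_spacetime)
      show "(\<integral>\<^sup>+\<omega>. ennreal ((past_kernel s y z * u (fst z) (snd z) \<omega>)\<^sup>2) \<partial>M)
        \<le> ennreal N * ennreal ((past_kernel s y z)\<^sup>2 * exp (128 * fst z))"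
      proof (cases "r < s")
        case True
        have "(\<integral>\<^sup>+\<omega>. ennreal ((past_kernel s y z * u (fst z) (snd z) \<omega>)\<^sup>2) \<partial>M) = ennreal ((past_kernel s y z)\<^sup>2) * V r v"
          using mild_solution_measurable[OF sol r]
          by (simp add: V_def z power_mult_distrib ennreal_mult nn_integral_cmult)
        also have "\<dots> \<le> ennreal ((past_kernel s y z)\<^sup>2) * ennreal (N * exp (128 * r))"
          using N True r s by (intro mult_left_mono) auto
        also have "\<dots> = ennreal N * ennreal ((past_kernel s y z)\<^sup>2 * exp (128 * fst z))"
          using N0 by (simp add: z ennreal_mult[symmetric] mult_ac)
        finally show ?thesis .
      qed (simp add: z past_kernel_def)
    qed
    also have "\<dots> = ennreal N * (\<integral>\<^sup>+z. ennreal ((past_kernel s y z)\<^sup>2 * exp (128 * fst z)) \<partial>spacetime)"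
      by (intro nn_integral_cmult measurable_spacetime) measurable
    also have "\<dots> \<le> ennreal N * ennreal (exp (128 * s) / 16)"
      by (intro mult_left_mono past_kernel_square) auto
    also have "4 * \<dots> = ennreal (N / 4 * exp (128 * s))"
      using N0 by (simp add: ennreal_mult[symmetric] ennreal_numeral[symmetric] del: ennreal_numeral)
    finally have J2: "(\<integral>\<^sup>+\<omega>. ennreal ((J \<omega>)\<^sup>2) \<partial>M) \<le> ennreal (N / 4 * exp (128 * s))"
      by (simp add: mult_left_mono)
    have "V s y \<le> (\<integral>\<^sup>+\<omega>. ennreal (2 * C\<^sup>2) + 2 * ennreal ((J \<omega>)\<^sup>2) \<partial>M)"
      unfolding V_def
    proof (rule nn_integral_mono_AE)
      have h: "(heat_flow u0 s y)\<^sup>2 \<le> C\<^sup>2"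
        using heat_flow_nn_integral(2,3)[OF u0 s(1), of y] by (intro power_mono) auto
      show "AE \<omega> in M. ennreal ((u s y \<omega>)\<^sup>2) \<le> ennreal (2 * C\<^sup>2) + 2 * ennreal ((J \<omega>)\<^sup>2)"
        using eq
      proof eventually_elim
        case (elim \<omega>)
        have "(heat_flow u0 s y + J \<omega>)\<^sup>2 \<le> 2 * (heat_flow u0 s y)\<^sup>2 + 2 * (J \<omega>)\<^sup>2"
          using zero_le_power2[of "heat_flow u0 s y - J \<omega>"] by (simp add: power2_eq_square algebra_simps)
        with h have "(u s y \<omega>)\<^sup>2 \<le> 2 * C\<^sup>2 + 2 * (J \<omega>)\<^sup>2" by (simp add: elim)
        then have "ennreal ((u s y \<omega>)\<^sup>2) \<le> ennreal (2 * C\<^sup>2 + 2 * (J \<omega>)\<^sup>2)" by (rule ennreal_leI)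
        then show ?case by (simp add: ennreal_mult)
      qed
    qed
    also have "\<dots> = ennreal (2 * C\<^sup>2) + 2 * (\<integral>\<^sup>+\<omega>. ennreal ((J \<omega>)\<^sup>2) \<partial>M)"
      by (simp add: nn_integral_add nn_integral_cmult emeasure_space_1)
    also have "\<dots> \<le> ennreal (2 * C\<^sup>2) + 2 * ennreal (N / 4 * exp (128 * s))"
      by (intro add_left_mono mult_left_mono J2) auto
    also have "\<dots> = ennreal (2 * C\<^sup>2 + 2 * (N / 4 * exp (128 * s)))"
    proof -
      have "2 * ennreal q = ennreal (2 * q)" if "q \<ge> 0" for q
        using that by (simp add: ennreal_mult)
      then have *: "2 * ennreal (N / 4 * exp (128 * s)) = ennreal (2 * (N / 4 * exp (128 * s)))"
        using N0 by (metis divide_nonneg_nonneg exp_ge_zero mult_nonneg_nonneg zero_le_numeral)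
      show ?thesis unfolding * using N0 by (intro ennreal_plus[symmetric]) auto
    qed
    also have "\<dots> \<le> ennreal ((2 * C\<^sup>2 + N / 2) * exp (128 * s))"
    proof (rule ennreal_leI)
      have "2 * C\<^sup>2 * 1 \<le> 2 * C\<^sup>2 * exp (128 * s)" using s by (intro mult_left_mono) auto
      then show "2 * C\<^sup>2 + 2 * (N / 4 * exp (128 * s)) \<le> (2 * C\<^sup>2 + N / 2) * exp (128 * s)"
        by (simp add: distrib_right)
    qed
    finally show "V s y \<le> ennreal ((2 * C\<^sup>2 + N / 2) * exp (128 * s))" .
  qed
  obtain K where K: "\<forall>s\<in>{0<..t}. \<forall>y. V s y \<le> ennreal K"
    using sol t unfolding she_mild_solution_def V_def by blast
  \<comment> \<open>\<open>ennreal\<close> cuts negative reals off at 0, so the constant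
    \<open>K\<close> of the solution class could be negative.\<close>
  define K' where "K' = max K 0"
  have iter: "\<forall>s y. 0 < s \<and> s \<le> t \<longrightarrow> V s y \<le> ennreal ((4 * C\<^sup>2 + K' / 2 ^ n) * exp (128 * s))" for n
  proof (induction n)
    case 0
    show ?case
    proof (intro allI impI)
      fix s y assume s: "0 < s \<and> s \<le> t"
      then have "V s y \<le> ennreal K" using K by auto
      also have "\<dots> \<le> ennreal ((4 * C\<^sup>2 + K' / 2 ^ 0) * exp (128 * s))"
      proof (rule ennreal_leI)
        have "K \<le> (4 * C\<^sup>2 + K') * 1"
          using zero_le_power2[of C] max.cobounded1[of K 0] unfolding K'_def mult_1_right by linarith
        also have "\<dots> \<le> (4 * C\<^sup>2 + K') * exp (128 * s)" using s by (intro mult_left_mono) (auto simp: K'_def)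
        finally show "K \<le> (4 * C\<^sup>2 + K' / 2 ^ 0) * exp (128 * s)" by simp
      qed
      finally show "V s y \<le> ennreal ((4 * C\<^sup>2 + K' / 2 ^ 0) * exp (128 * s))" .
    qed
  next
    case (Suc n)
    have "2 * C\<^sup>2 + (4 * C\<^sup>2 + K' / 2 ^ n) / 2 = 4 * C\<^sup>2 + K' / 2 ^ Suc n"
      by (simp add: field_simps)
    moreover have "0 \<le> 4 * C\<^sup>2 + K' / 2 ^ n" by (simp add: K'_def)
    ultimately show ?case using improve[OF Suc.IH] by metis
  qed
  have "(\<lambda>n. ennreal ((4 * C\<^sup>2 + K' * (1 / 2) ^ n) * exp (128 * t))) \<longlonglongrightarrow> ennreal ((4 * C\<^sup>2 + K' * 0) * exp (128 * t))"
    by (intro tendsto_ennrealI tendsto_mult_right tendsto_add tendsto_const tendsto_mult_left LIMSEQ_realpow_zero) auto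
  moreover have "V t x \<le> ennreal ((4 * C\<^sup>2 + K' * (1 / 2) ^ n) * exp (128 * t))" for n
    using iter[of n] t by (simp add: power_one_over)
  ultimately have "V t x \<le> ennreal ((4 * C\<^sup>2 + K' * 0) * exp (128 * t))"
    by (rule LIMSEQ_le_const[OF _ exI, rule_format])
  then have V: "V t x \<le> ennreal (4 * C\<^sup>2 * exp (128 * t))" by simp
  then show I: "integrable M (\<lambda>\<omega>. (u t x \<omega>)\<^sup>2)"
    using mild_solution_measurable[OF sol t, of x] by (auto simp: integrable_iff_bounded V_def intro: le_less_trans)
  show "expectation (\<lambda>\<omega>. (u t x \<omega>)\<^sup>2) \<le> 4 * C\<^sup>2 * exp (128 * t)"
    using V I by (simp add: V_def nn_integral_eq_integral)
qed

section \<open>Tilted means and the lower tail\<close>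

lemma tilt_square_moment:
  assumes "D \<in> finite_spacetime_sets"
  shows "integrable M (\<lambda>\<omega>. (tilt a D \<omega>)\<^sup>2)" "expectation (\<lambda>\<omega>. (tilt a D \<omega>)\<^sup>2) = exp (a\<^sup>2 * measure spacetime D)"
  using tilt_power_integral[OF assms, of a 2] by (simp_all add: has_bochner_integral_iff)

lemma tilt_mean:
  assumes "D \<in> finite_spacetime_sets"
  shows "integrable M (tilt a D)" "expectation (tilt a D) = 1"
  using tilt_power_integral[OF assms, of a 1] by (simp_all add: has_bochner_integral_iff)

lemma window_measure:
  assumes "T \<ge> 0" "L \<ge> 0"
  shows "{0<..T} \<times> {x - L..x + L} \<in> finite_spacetime_sets"
    "measure spacetime ({0<..T} \<times> {x - L..x + L}) = 2 * L * T"
proof -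
  have sub: "{0<..T} \<subseteq> {0<..}" by auto
  have "emeasure spacetime ({0<..T} \<times> {x - L..x + L}) = ennreal (2 * L * T)"
    using assms by (subst emeasure_spacetime_Times) (auto simp: ennreal_mult[symmetric] mult_ac)
  then show "{0<..T} \<times> {x - L..x + L} \<in> finite_spacetime_sets"
    "measure spacetime ({0<..T} \<times> {x - L..x + L}) = 2 * L * T"
    using assms emeasure_spacetime_Times(1)[of "{0<..T}" "{x - L..x + L}"] sub
    by (auto simp: finite_spacetime_sets_def measure_def)
qed

text \<open>Pairing the mild equation with the density turns the stochastic integral into
  \<open>- a\<close> times the heat potential of \<open>m\<close> on the window, and
  \<open>heat_flow\<close> keeps its weight because the density has mean 1. This is the integral
  equation of \<open>damped_heat_equation_bound\<close>.\<close>

lemma tilted_mean_bound: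
  assumes sol: "she_mild_solution M W u0 u"
    and u0: "u0 \<in> borel_measurable borel" "\<And>y. 0 \<le> u0 y" "\<And>y. u0 y \<le> C"
    and a: "a > 0" and T: "T > 0" and L: "L \<ge> 0"
  shows "\<bar>expectation (\<lambda>\<omega>. tilt a ({0<..T} \<times> {x - L..x + L}) \<omega> * u T x \<omega>)\<bar>
    \<le> C * exp (- a * T) + 2 * C * exp ((1 / 2 + 2 * a) * T - L)"
proof -
  define D where "D = {0<..T} \<times> {x - L..x + L}"
  have D: "D \<in> finite_spacetime_sets" using window_measure(1)[of T L x] T L by (simp add: D_def)
  note [measurable] = tilt_measurable[OF D]
  define m where "m z = expectation (\<lambda>\<omega>. tilt a D \<omega> * u (fst z) (snd z) \<omega>)" for z
  have C: "C \<ge> 0" using u0(2,3)[of 0] by linarith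
  have Itu: "integrable M (\<lambda>\<omega>. tilt a D \<omega> * u s y \<omega>)" if "s > 0" for s y
    using mild_solution_measurable[OF sol that] mild_solution_second_moment(1)[OF sol u0 that]
    by (intro integrable_mult_L2 tilt_square_moment D) auto
  \<comment> \<open>A qualitative bound, however large, is enough: it only starts the iteration in
    \<open>damped_heat_equation_bound\<close>.\<close>
  have bound: "\<bar>m (s, y)\<bar> \<le> sqrt (exp (a\<^sup>2 * measure spacetime D)) * sqrt (4 * C\<^sup>2 * exp (128 * T))"
    if s: "0 < s" "s \<le> T" for s y
  proof -
    have "\<bar>m (s, y)\<bar> \<le> sqrt (expectation (\<lambda>\<omega>. (tilt a D \<omega>)\<^sup>2)) * sqrt (expectation (\<lambda>\<omega>. (u s y \<omega>)\<^sup>2))"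
      unfolding m_def fst_conv snd_conv
      using mild_solution_measurable[OF sol s(1)] mild_solution_second_moment(1)[OF sol u0 s(1)]
      by (intro Cauchy_Schwarz_integral tilt_square_moment D) auto
    also have "\<dots> \<le> sqrt (exp (a\<^sup>2 * measure spacetime D)) * sqrt (4 * C\<^sup>2 * exp (128 * T))"
    proof (intro mult_mono real_sqrt_le_mono)
      have "4 * C\<^sup>2 * exp (128 * s) \<le> 4 * C\<^sup>2 * exp (128 * T)" using s by (intro mult_left_mono) auto
      then show "expectation (\<lambda>\<omega>. (u s y \<omega>)\<^sup>2) \<le> 4 * C\<^sup>2 * exp (128 * T)"
        using mild_solution_second_moment(2)[OF sol u0 s(1), of y] by linarith
    qed (auto simp: tilt_square_moment[OF D])
    finally show ?thesis .
  qed
  have "integrable spacetime (\<lambda>z. indicator D z * (past_kernel s y z * m z)) \<and>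
    m (s, y) = heat_flow u0 s y - a * (LINT z|spacetime. indicator D z * (past_kernel s y z * m z))"
    if s: "0 < s" "s \<le> T" for s y
  proof -
    obtain J where J: "has_walsh_integral M W (\<lambda>r z \<omega>. past_kernel s y (r, z) * u r z \<omega>) J"
      and eq: "AE \<omega> in M. u s y \<omega> = heat_flow u0 s y + J \<omega>"
      using mild_solution_decomposition[OF sol s(1)] .
    have [measurable]: "J \<in> borel_measurable M" using J by (auto simp: has_walsh_integral_def)
    have k: "expectation (\<lambda>\<omega>. tilt a D \<omega> * (past_kernel s y z * u (fst z) (snd z) \<omega>)) = past_kernel s y z * m z" for z
      unfolding m_def by (subst integral_mult_right_zero[symmetric]) (simp add: mult_ac)
    have "AE \<omega> in M. tilt a D \<omega> * J \<omega> = tilt a D \<omega> * u s y \<omega> - heat_flow u0 s y * tilt a D \<omega>"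
      using eq by eventually_elim (simp add: algebra_simps)
    then have "expectation (\<lambda>\<omega>. tilt a D \<omega> * J \<omega>) = 
       expectation (\<lambda>\<omega>. tilt a D \<omega> * u s y \<omega> - heat_flow u0 s y * tilt a D \<omega>)"
      using mild_solution_measurable[OF sol s(1)] by (intro integral_cong_AE) auto
    also have "\<dots> = m (s, y) - heat_flow u0 s y"
      using Itu[OF s(1)] tilt_mean[OF D] by (simp add: m_def)
    finally show ?thesis
      using walsh_tilt[OF J D, of a] by (simp add: k)
  qed
  then have "\<bar>m (T, x)\<bar> \<le> C * exp (- a * T) + 2 * C * exp ((1 / 2 + 2 * a) * T - L)"
    by (intro damped_heat_equation_bound[where m = m, OF u0 a T L D_def bound]) auto
  then show ?thesis by (simp add: m_def D_def)
qed

text \<open>If the event had too small a probability, the tilted mean of \<open>u\<close> would essentially be carried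
  by its complement and hence be too large.  Cauchy--Schwarz on the event replaces the positivity of
  \<open>u\<close>.\<close>

lemma small_value_inequality:
  fixes a x :: real
  assumes sol: "she_mild_solution M W u0 u"
    and u0: "u0 \<in> borel_measurable borel" "\<And>y. 0 \<le> u0 y" "\<And>y. u0 y \<le> C"
    and T: "T > 0" and D: "D \<in> finite_spacetime_sets" and \<delta>: "\<delta> \<ge> 0"
  defines "p \<equiv> prob {\<omega> \<in> space M. u T x \<omega> \<le> \<delta>}" and "d \<equiv> measure spacetime D"
  shows "\<delta> * (1 - exp (a\<^sup>2 * d / 2) * sqrt p) \<le>
    expectation (\<lambda>\<omega>. tilt a D \<omega> * u T x \<omega>) + 2 * C * exp (64 * T) * (exp (3 / 2 * a\<^sup>2 * d) * sqrt (sqrt p))"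
proof -
  note [measurable] = tilt_measurable[OF D] mild_solution_measurable[OF sol T]
  note u2 = mild_solution_second_moment[OF sol u0 T]
  have C: "C \<ge> 0" using u0(2,3)[of 0] by linarith
  define A where "A = {\<omega> \<in> space M. u T x \<omega> \<le> \<delta>}"
  have A[measurable]: "A \<in> events" unfolding A_def by measurable
  define t where "t = tilt a D"
  have [measurable]: "t \<in> borel_measurable M" by (simp add: t_def)
  have t0: "0 \<le> t \<omega>" for \<omega> using tilt_pos[of a D \<omega>] by (simp add: t_def)
  have t2: "integrable M (\<lambda>\<omega>. (t \<omega>)\<^sup>2)" "expectation (\<lambda>\<omega>. (t \<omega>)\<^sup>2) = exp (a\<^sup>2 * d)"
    using tilt_square_moment[OF D, of a] by (simp_all add: t_def d_def)
  have t4: "integrable M (\<lambda>\<omega>. ((t \<omega>)\<^sup>2)\<^sup>2)" "expectation (\<lambda>\<omega>. ((t \<omega>)\<^sup>2)\<^sup>2) = exp (6 * a\<^sup>2 * d)"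
    using tilt_power_integral[OF D, of a 4] by (simp_all add: has_bochner_integral_iff t_def d_def power_mult[symmetric])
  have iA: "integrable M (\<lambda>\<omega>. (indicator A \<omega> :: real)\<^sup>2)" "expectation (\<lambda>\<omega>. (indicator A \<omega> :: real)\<^sup>2) = p"
  proof -
    have "(indicator A \<omega> :: real)\<^sup>2 = indicator A \<omega>" for \<omega> by (simp split: split_indicator)
    then show "integrable M (\<lambda>\<omega>. (indicator A \<omega> :: real)\<^sup>2)" "expectation (\<lambda>\<omega>. (indicator A \<omega> :: real)\<^sup>2) = p"
      by (simp_all add: p_def A_def[symmetric] emeasure_eq_measure)
  qed
  have tA: "integrable M (\<lambda>\<omega>. t \<omega> * indicator A \<omega>)"
    by (intro integrable_mult_L2 t2 iA) measurable
  have Itu: "integrable M (\<lambda>\<omega>. t \<omega> * u T x \<omega>)"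
    by (intro integrable_mult_L2 t2 u2) measurable
  have tA2: "integrable M (\<lambda>\<omega>. (t \<omega>)\<^sup>2 * indicator A \<omega>)"
    by (intro integrable_mult_L2 t4 iA) measurable
  have sq: "(t \<omega> * indicator A \<omega>)\<^sup>2 = (t \<omega>)\<^sup>2 * indicator A \<omega>" for \<omega>
    by (auto split: split_indicator)
  have ItuA: "integrable M (\<lambda>\<omega>. u T x \<omega> * (t \<omega> * indicator A \<omega>))"
    using tA2 by (intro integrable_mult_L2 u2) (auto simp: sq)
  \<comment> \<open>The left side is the probability of the event under the tilted measure.\<close>
  have b1: "expectation (\<lambda>\<omega>. t \<omega> * indicator A \<omega>) \<le> exp (a\<^sup>2 * d / 2) * sqrt p"
  proof -
    have "\<bar>expectation (\<lambda>\<omega>. t \<omega> * indicator A \<omega>)\<bar> \<le> sqrt (exp (a\<^sup>2 * d)) * sqrt p"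
      unfolding t2(2)[symmetric] iA(2)[symmetric] by (intro Cauchy_Schwarz_integral t2 iA) measurable
    also have "sqrt (exp (a\<^sup>2 * d)) = exp (a\<^sup>2 * d / 2)" by (rule real_sqrt_unique) (auto simp: exp_double[symmetric])
    finally show ?thesis by linarith
  qed
  \<comment> \<open>Cauchy-Schwarz twice, for \<open>u\<close> against \<open>t\<close> restricted
    to \<open>A\<close> and for the square of \<open>t\<close> against the indicator of
    \<open>A\<close>. The second use costs the fourth moment of the density and leaves the fourth
    root of \<open>p\<close>.\<close>
  have b2: "\<bar>expectation (\<lambda>\<omega>. u T x \<omega> * (t \<omega> * indicator A \<omega>))\<bar> \<le> 2 * C * exp (64 * T) * (exp (3 / 2 * a\<^sup>2 * d) * sqrt (sqrt p))"
  proof -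
    have "\<bar>expectation (\<lambda>\<omega>. (t \<omega>)\<^sup>2 * indicator A \<omega>)\<bar> \<le> sqrt (exp (6 * a\<^sup>2 * d)) * sqrt p"
      unfolding t4(2)[symmetric] iA(2)[symmetric] by (intro Cauchy_Schwarz_integral t4 iA) measurable
    also have "sqrt (exp (6 * a\<^sup>2 * d)) = exp (3 * a\<^sup>2 * d)" by (rule real_sqrt_unique) (auto simp: exp_double[symmetric])
    finally have "sqrt (expectation (\<lambda>\<omega>. (t \<omega> * indicator A \<omega>)\<^sup>2)) \<le> sqrt (exp (3 * a\<^sup>2 * d) * sqrt p)"
      by (intro real_sqrt_le_mono) (simp add: sq)
    also have "\<dots> = exp (3 / 2 * a\<^sup>2 * d) * sqrt (sqrt p)"
    proof -
      have "sqrt (exp (3 * a\<^sup>2 * d)) = exp (3 / 2 * a\<^sup>2 * d)" by (rule real_sqrt_unique) (auto simp: exp_double[symmetric])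
      then show ?thesis by (simp add: real_sqrt_mult)
    qed
    finally have s1: "sqrt (expectation (\<lambda>\<omega>. (t \<omega> * indicator A \<omega>)\<^sup>2)) \<le> exp (3 / 2 * a\<^sup>2 * d) * sqrt (sqrt p)" .
    have "sqrt (expectation (\<lambda>\<omega>. (u T x \<omega>)\<^sup>2)) \<le> sqrt ((2 * C * exp (64 * T))\<^sup>2)"
      using u2(2)[of x] by (intro real_sqrt_le_mono) (simp add: power_mult_distrib exp_double[symmetric])
    also have "\<dots> = 2 * C * exp (64 * T)" using C by (simp add: abs_mult)
    finally have s2: "sqrt (expectation (\<lambda>\<omega>. (u T x \<omega>)\<^sup>2)) \<le> 2 * C * exp (64 * T)" .
    have "\<bar>expectation (\<lambda>\<omega>. u T x \<omega> * (t \<omega> * indicator A \<omega>))\<bar> \<le>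
       sqrt (expectation (\<lambda>\<omega>. (u T x \<omega>)\<^sup>2)) * sqrt (expectation (\<lambda>\<omega>. (t \<omega> * indicator A \<omega>)\<^sup>2))"
      using tA2 by (intro Cauchy_Schwarz_integral u2) (auto simp: sq)
    also have "\<dots> \<le> 2 * C * exp (64 * T) * (exp (3 / 2 * a\<^sup>2 * d) * sqrt (sqrt p))"
      using C by (intro mult_mono s1 s2) auto
    finally show ?thesis .
  qed
  \<comment> \<open>Both integrands vanish on \<open>A\<close>, and off \<open>A\<close> the value
    of \<open>u\<close> exceeds \<open>\<delta>\<close>.\<close>
  have "expectation (\<lambda>\<omega>. \<delta> * (t \<omega> - t \<omega> * indicator A \<omega>)) \<le>
     expectation (\<lambda>\<omega>. t \<omega> * u T x \<omega> - u T x \<omega> * (t \<omega> * indicator A \<omega>))"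
  proof (rule integral_mono)
    fix \<omega> assume "\<omega> \<in> space M"
    then show "\<delta> * (t \<omega> - t \<omega> * indicator A \<omega>) \<le> t \<omega> * u T x \<omega> - u T x \<omega> * (t \<omega> * indicator A \<omega>)"
      using mult_right_mono[of \<delta> "u T x \<omega>" "t \<omega>"] t0[of \<omega>] by (auto simp: A_def mult.commute split: split_indicator)
  qed (use tA Itu ItuA tilt_mean[OF D, of a] in \<open>auto simp: t_def\<close>)
  then have "\<delta> * (1 - expectation (\<lambda>\<omega>. t \<omega> * indicator A \<omega>)) \<le>
     expectation (\<lambda>\<omega>. t \<omega> * u T x \<omega>) - expectation (\<lambda>\<omega>. u T x \<omega> * (t \<omega> * indicator A \<omega>))"
    using tA Itu ItuA tilt_mean[OF D, of a] by (simp add: t_def)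
  moreover have "\<delta> * (1 - exp (a\<^sup>2 * d / 2) * sqrt p) \<le> \<delta> * (1 - expectation (\<lambda>\<omega>. t \<omega> * indicator A \<omega>))"
    using b1 \<delta> by (intro mult_left_mono) auto
  ultimately show ?thesis using b2 unfolding t_def by linarith
qed

lemma lower_tail:
  assumes sol: "she_mild_solution M W u0 u"
    and u0: "u0 \<in> borel_measurable borel" "\<And>y. 0 \<le> u0 y" "\<And>y. u0 y \<le> C"
    and \<gamma>: "\<gamma> > 0"
  shows "\<exists>c>0. \<exists>t0\<ge>1. \<forall>t\<ge>t0. \<forall>x. exp (- c * t\<^sup>2) \<le> prob {\<omega> \<in> space M. u t x \<omega> \<le> exp (- \<gamma> * t)}"
proof -
  \<comment> \<open>The surplus 1 over \<open>\<gamma>\<close> leaves a factor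
    \<open>exp (- t)\<close>, which finally beats the constants.\<close>
  define a where "a = \<gamma> + 1"
  \<comment> \<open>Chosen so that \<open>k * t\<^sup>2\<close> is the area \<open>2 * L * t\<close>
    of the window.\<close>
  define k where "k = 1 + 6 * a"
  \<comment> \<open>A quarter of \<open>c\<close>, from the fourth root of \<open>p\<close>, has to
    offset \<open>3 / 2 * a\<^sup>2 * k\<close> from the density and 64 from the second moment of
    \<open>u\<close>, and still leave decay at rate \<open>a\<close>.\<close>
  define c where "c = 4 * (3 / 2 * a\<^sup>2 * k + 64 + a)"
  have a: "a > 1" using \<gamma> by (simp add: a_def)
  have k: "k > 0" using a by (simp add: k_def)
  have C: "C \<ge> 0" using u0(2,3)[of 0] by linarith
  have c: "c > 0" using a k by (simp add: c_def add_pos_pos)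
  show ?thesis
  \<comment> \<open>\<open>t \<ge> 1\<close> gives \<open>t \<le> t\<^sup>2\<close>, and
    \<open>t \<ge> 10 * C\<close> contradicts the final inequality
    \<open>exp t \<le> 10 * C\<close>.\<close>
  proof (rule exI[of _ c], rule conjI, rule c, rule exI[of _ "max 1 (10 * C)"], intro conjI allI impI)
    fix t x :: real assume "max 1 (10 * C) \<le> t"
    then have t: "1 \<le> t" "10 * C \<le> t" by auto
    have tt: "t \<le> t\<^sup>2" using t by (simp add: power2_eq_square)
    define p where "p = prob {\<omega> \<in> space M. u t x \<omega> \<le> exp (- \<gamma> * t)}"
    \<comment> \<open>Solves \<open>(1 / 2 + 2 * a) * t - L = - a * t\<close>, so that the leak from
      outside the window decays like the main term.\<close>
    define L where "L = (1 / 2 + 3 * a) * t"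
    define D where "D = {0<..t} \<times> {x - L..x + L}"
    have L: "L \<ge> 0" using a t by (simp add: L_def)
    have D: "D \<in> finite_spacetime_sets" "measure spacetime D = k * t\<^sup>2"
      using window_measure[of t L x] t L by (auto simp: D_def L_def k_def power2_eq_square algebra_simps)
    show "exp (- c * t\<^sup>2) \<le> prob {\<omega> \<in> space M. u t x \<omega> \<le> exp (- \<gamma> * t)}"
    proof (rule ccontr)
      assume "\<not> ?thesis"
      then have p: "p \<le> exp (- c * t\<^sup>2)" by (simp add: p_def)
      have sqrt_exp: "sqrt (exp y) = exp (y / 2)" for y :: real
        by (rule real_sqrt_unique) (auto simp: exp_double[symmetric])
      have p2: "sqrt p \<le> exp (- (c / 2) * t\<^sup>2)"
        using real_sqrt_le_mono[OF p] by (simp add: sqrt_exp)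
      have p4: "sqrt (sqrt p) \<le> exp (- (c / 4) * t\<^sup>2)"
        using real_sqrt_le_mono[OF p2] by (simp add: sqrt_exp)
      have ineq: "exp (- \<gamma> * t) * (1 - exp (a\<^sup>2 * (k * t\<^sup>2) / 2) * sqrt p) \<le>
        expectation (\<lambda>\<omega>. tilt a D \<omega> * u t x \<omega>) + 2 * C * exp (64 * t) * (exp (3 / 2 * a\<^sup>2 * (k * t\<^sup>2)) * sqrt (sqrt p))"
        using small_value_inequality[OF sol u0 _ D(1), of t "exp (- \<gamma> * t)" a x] t by (simp add: D(2) p_def)
      have "\<bar>expectation (\<lambda>\<omega>. tilt a D \<omega> * u t x \<omega>)\<bar> \<le> C * exp (- a * t) + 2 * C * exp ((1 / 2 + 2 * a) * t - L)"
        using tilted_mean_bound[OF sol u0, of a t L x] a t L by (simp add: D_def)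
      also have "(1 / 2 + 2 * a) * t - L = - a * t" by (simp add: L_def algebra_simps)
      finally have e1: "expectation (\<lambda>\<omega>. tilt a D \<omega> * u t x \<omega>) \<le> 3 * C * exp (- a * t)" by linarith
      have e2: "2 * C * exp (64 * t) * (exp (3 / 2 * a\<^sup>2 * (k * t\<^sup>2)) * sqrt (sqrt p)) \<le> 2 * C * exp (- a * t)"
      proof -
        have "exp (64 * t) * (exp (3 / 2 * a\<^sup>2 * (k * t\<^sup>2)) * sqrt (sqrt p)) \<le>
          exp (64 * t) * (exp (3 / 2 * a\<^sup>2 * (k * t\<^sup>2)) * exp (- (c / 4) * t\<^sup>2))"
          by (intro mult_left_mono p4) auto
        also have "\<dots> = exp (64 * t - (64 + a) * t\<^sup>2)"
          by (simp add: exp_add[symmetric] c_def algebra_simps)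
        also have "\<dots> \<le> exp (- a * t)"
        proof -
          have "(64 + a) * t \<le> (64 + a) * t\<^sup>2" using a tt by (intro mult_left_mono) auto
          then show ?thesis by (simp add: algebra_simps)
        qed
        finally have "2 * C * (exp (64 * t) * (exp (3 / 2 * a\<^sup>2 * (k * t\<^sup>2)) * sqrt (sqrt p))) \<le> 2 * C * exp (- a * t)"
          using C by (intro mult_left_mono) auto
        then show ?thesis by (simp add: mult.assoc)
      qed
      \<comment> \<open>Under the tilted measure the event still has probability at most 1/2, so at
        least half of the tilted mass sits where \<open>u\<close> exceeds
        \<open>exp (- \<gamma> * t)\<close>.\<close>
      have e3: "exp (a\<^sup>2 * (k * t\<^sup>2) / 2) * sqrt p \<le> 1 / 2"
      proof -
        have "exp (a\<^sup>2 * (k * t\<^sup>2) / 2) * sqrt p \<le> exp (a\<^sup>2 * (k * t\<^sup>2) / 2) * exp (- (c / 2) * t\<^sup>2)"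
          by (intro mult_left_mono p2) auto
        also have "\<dots> = exp (- (5 / 2 * a\<^sup>2 * k + 128 + 2 * a) * t\<^sup>2)"
          by (simp add: exp_add[symmetric] c_def algebra_simps)
        also have "\<dots> \<le> exp (- 1)"
        proof -
          have "1 * 1 \<le> (5 / 2 * a\<^sup>2 * k + 128 + 2 * a) * t\<^sup>2"
            using a k t by (intro mult_mono) (auto intro: add_increasing)
          then show ?thesis by (simp only: mult_minus_left neg_le_iff_le exp_le_cancel_iff mult_1)
        qed
        also have "\<dots> \<le> 1 / 2"
          using exp_ge_add_one_self[of 1] by (simp add: exp_minus field_simps)
        finally show ?thesis .
      qed
      have "exp (- \<gamma> * t) * (1 / 2) \<le> exp (- \<gamma> * t) * (1 - exp (a\<^sup>2 * (k * t\<^sup>2) / 2) * sqrt p)"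
        using e3 by (intro mult_left_mono) auto
      \<comment> \<open>Three of the five multiples of \<open>C\<close> come from the tilted mean,
        two from the Cauchy-Schwarz term on the event.\<close>
      also have "\<dots> \<le> 5 * C * exp (- a * t)" using ineq e1 e2 by linarith
      also have "exp (- a * t) = exp (- \<gamma> * t) * exp (- t)" by (simp add: a_def exp_add[symmetric] algebra_simps)
      finally have "exp (- \<gamma> * t) * (1 / 2) \<le> exp (- \<gamma> * t) * (5 * C * exp (- t))" by (simp add: mult_ac)
      then have "1 / 2 \<le> 5 * C * exp (- t)" by (simp only: mult_le_cancel_left_pos[OF exp_gt_zero])
      then have "exp t \<le> 10 * C" by (simp add: exp_minus field_simps)
      then show False using t exp_ge_add_one_self[of t] by linarith
    qed
  qed simp
qed

end

theorem theorem1p4: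
  fixes M :: "'a measure"
    and W :: "(real \<times> real) set \<Rightarrow> 'a \<Rightarrow> real"
    and u0 :: "real \<Rightarrow> real"
    and u :: "real \<Rightarrow> real \<Rightarrow> 'a \<Rightarrow> real"
    and \<gamma> \<epsilon> :: real
  assumes "prob_space M"
    and "space_time_white_noise M W"
    and "\<And>x. 0 < u0 x"
    and "(\<lambda>x. ln (u0 x)) \<in> borel_measurable borel"
    and "bounded (range (\<lambda>x. ln (u0 x)))"
    and "she_mild_solution M W u0 u"
    and "1 / 24 < \<gamma>"
    and "0 < \<epsilon>"
  shows "\<exists>c>0. \<exists>t0>0. \<forall>t\<ge>t0. \<forall>x.
    exp (- c * t powr (4 + \<epsilon>)) \<le> measure M {\<omega> \<in> space M. u t x \<omega> \<le> exp (- \<gamma> * t)}"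
proof -
  interpret white_noise M W
    using assms(1,2) by (simp add: white_noise_def white_noise_axioms_def)
  obtain B where B: "\<bar>ln (u0 x)\<bar> \<le> B" for x
    using assms(5) by (auto simp: bounded_iff)
  have "u0 y \<le> exp B" for y
  proof -
    have "exp (ln (u0 y)) \<le> exp B" using B[of y] by simp
    then show ?thesis using assms(3)[of y] by simp
  qed
  moreover have "u0 \<in> borel_measurable borel"
  proof -
    have "(\<lambda>x. exp (ln (u0 x))) \<in> borel_measurable borel" using assms(4) by measurable
    then show ?thesis using assms(3) by simp
  qed
  ultimately obtain c t0 where c: "c > 0" and t0: "t0 \<ge> 1"
    and tail: "\<forall>t\<ge>t0. \<forall>x. exp (- c * t\<^sup>2) \<le> prob {\<omega> \<in> space M. u t x \<omega> \<le> exp (- \<gamma> * t)}"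
    using lower_tail[OF assms(6), of "exp B" \<gamma>] assms(3,7) by (force intro: less_imp_le)
  \<comment> \<open>Since \<open>t0 \<ge> 1\<close>, larger powers of \<open>t\<close> are larger,
    so the quadratic exponent is the stronger bound.\<close>
  have "exp (- c * t powr (4 + \<epsilon>)) \<le> exp (- c * t\<^sup>2)" if "t \<ge> t0" for t
  proof -
    have "t powr 2 \<le> t powr (4 + \<epsilon>)" using that t0 assms(8) by (intro powr_mono) auto
    then have "t\<^sup>2 \<le> t powr (4 + \<epsilon>)" using that t0 by simp
    then show ?thesis using c by simp
  qed
  with tail have "\<forall>t\<ge>t0. \<forall>x. exp (- c * t powr (4 + \<epsilon>)) \<le> prob {\<omega> \<in> space M. u t x \<omega> \<le> exp (- \<gamma> * t)}"
    by (meson order_trans)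
  moreover have "t0 > 0" using t0 by simp
  ultimately show ?thesis using c by blast
qed

end
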